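(* For almost all and quasi-all polynomials $P$, the function $u(x)=P(x)e^{-x^2/2}$ has only trivial partners. That is, for every integer $n\ge 0$, identifying polynomials $P(x)=\sum_{j=0}^n p_jx^j$ with their coefficient vectors $(p_0,\dots,p_n)\in\mathbb{C}^{n+1}$, the set of $P$ for which $u(x)=P(x)e^{-x^2/2}$ has an ambiguity partner $v\in L^2(\mathbb{R})$ that is not a trivial partner of $u$ is of Lebesgue measure zero and is of first Baire category (meager) in $\mathbb{C}^{n+1}$.
   Context: For $u\in L^2(\mathbb{R})$ the radar ambiguity function is $$A(u)(x,y)=\int_{\mathbb{R}}u(t)\,\overline{u(t-x)}\,e^{iyt}\,dt,\qquad x,y\in\mathbb{R}.$$ Two functions $u,v\in L^2(\mathbb{R})$ are (radar) ambiguity partners if $|A(u)(x,y)|=|A(v)(x,y)|$ for all $x,y\in\mathbb{R}$. They are trivial partners if there exist $c\in\mathbb{C}$ with $|c|=1$ and $\alpha,\beta\in\mathbb{R}$ such that either $v(t)=c\,e^{i\beta t}u(t-\alpha)$ for a.e. $t$, or $v(t)=c\,e^{-i\beta t}u(-t-\alpha)$ for a.e. $t$. "$u$ has only trivial partners" means that every ambiguity partner $v\in L^2(\mathbb{R})$ of $u$ is a trivial partner of $u$. "Almost all" refers to Lebesgue measure and "quasi-all" to Baire category. *)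

theory Defs
  imports "HOL-Analysis.Analysis"
begin

definition square_integrable :: "(real \<Rightarrow> complex) \<Rightarrow> bool" where
  "square_integrable u \<longleftrightarrow>
     u \<in> borel_measurable lebesgue \<and> integrable lebesgue (\<lambda>t. (norm (u t))\<^sup>2)"

definition ambiguity :: "(real \<Rightarrow> complex) \<Rightarrow> real \<Rightarrow> real \<Rightarrow> complex" where
  "ambiguity u x y = (LINT t|lebesgue. u t * cnj (u (t - x)) * cis (y * t))"

definition ambiguity_partners :: "(real \<Rightarrow> complex) \<Rightarrow> (real \<Rightarrow> complex) \<Rightarrow> bool" where
  "ambiguity_partners u v \<longleftrightarrow> (\<forall>x y. norm (ambiguity u x y) = norm (ambiguity v x y))"

definition trivial_partners :: "(real \<Rightarrow> complex) \<Rightarrow> (real \<Rightarrow> complex) \<Rightarrow> bool" where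
  "trivial_partners u v \<longleftrightarrow>
     (\<exists>c \<alpha> \<beta>. norm c = 1 \<and>
        ((AE t in lebesgue. v t = c * cis (\<beta> * t) * u (t - \<alpha>)) \<or>
         (AE t in lebesgue. v t = c * cis (- \<beta> * t) * u (- t - \<alpha>))))"

definition only_trivial_partners :: "(real \<Rightarrow> complex) \<Rightarrow> bool" where
  "only_trivial_partners u \<longleftrightarrow>
     (\<forall>v. square_integrable v \<longrightarrow> ambiguity_partners u v \<longrightarrow> trivial_partners u v)"

definition gauss_poly :: "nat \<Rightarrow> (nat \<Rightarrow> complex) \<Rightarrow> real \<Rightarrow> complex" where
  "gauss_poly n p x = (\<Sum>j\<le>n. p j * of_real x ^ j) * of_real (exp (- x\<^sup>2 / 2))"

text \<open>
  The space of coefficient vectors \<open>(p 0, \<dots>, p n)\<close> is \<open>{..n} \<rightarrow>\<^sub>E UNIV\<close>: functions on \<open>nat\<close> that are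
  \<open>undefined\<close> outside \<open>{..n}\<close>. It is both the space of \<open>lebesgue_coeffs n\<close> and the
  \<open>topspace\<close> of \<open>top_coeffs n\<close>. The product measure is only the Borel-Lebesgue measure, hence the completion.
\<close>

definition lebesgue_coeffs :: "nat \<Rightarrow> (nat \<Rightarrow> complex) measure" where
  "lebesgue_coeffs n = completion (\<Pi>\<^sub>M j\<in>{..n}. lborel)"

definition top_coeffs :: "nat \<Rightarrow> (nat \<Rightarrow> complex) topology" where
  "top_coeffs n = product_topology (\<lambda>j. euclidean) {..n}"

definition nowhere_dense_in :: "'a topology \<Rightarrow> 'a set \<Rightarrow> bool" where
  "nowhere_dense_in X A \<longleftrightarrow> A \<subseteq> topspace X \<and> X interior_of (X closure_of A) = {}"

definition meager_in :: "'a topology \<Rightarrow> 'a set \<Rightarrow> bool" where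
  "meager_in X A \<longleftrightarrow> (\<exists>\<N>. countable \<N> \<and> (\<forall>N\<in>\<N>. nowhere_dense_in X N) \<and> A = \<Union>\<N>)"

end

(*
  Let u = P exp(-t^2/2) with deg P = n, and let v be a partner of u. The product of the Bargmann transform g of v at z
  and at -z is an integral of A(v) against a Gaussian kernel; since |A(v)| = |A(u)| is polynomial times Gaussian,
  g(z) g(-z) has polynomial growth and hence is a polynomial. As g has order at most two, g = p exp(b z) with a
  polynomial p, which means that v is a time-frequency shift of some Q exp(-t^2/2).

  For u = P exp(-t^2/2) the function A(u)(x,y) is a Gaussian times F(z, conj z), 2z = x + iy, where F is a polynomial, and
  |A(u)|^2 determines F(z,w) F(-z,-w). With q(z) the integral of P(t+z) exp(-t^2), the coefficient of w^(2n) in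
  this product gives q(z) q(-z), so the transform of Q has the zeros of q with the signs of a subset N changed.
  The coefficient of w^(2n-2) at the zeros z outside N gives
  conj(sum of N) = n/2 * sum over r in N of r / (z^2 - r^2).
  After a reflection, N has at most n/2 elements. Scaling all zeros by l > 0 multiplies one side by l and the
  other one by 1/l, and the right-hand side, a rational function of z^2 with numerator of degree less than
  |N|, cannot vanish at all n - |N| zeros. So on almost every ray N must be empty, which means that Q = c P.
*)
theory Submission
  imports Defs "HOL-Computational_Algebra.Computational_Algebra" "HOL-Complex_Analysis.Complex_Analysis" "HOL-Probability.Probability"
begin

section \<open>Gaussian integrals\<close>

text \<open>The zero-free factor of \<open>g\<close> is the exponential of a polynomial of degree at
  most two. The product g(z) g(-z) cancels its linear term and forces the quadratic one to vanish;
  the linear term survives as the time-frequency shift, to which the modulus of the ambiguity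
  function is blind.

  The coefficient of w^(2n-1) is a multiple of the derivative of q(z) q(-z), so it adds nothing to
  the leading one; w^(2n-2) is the first that can distinguish choices of signs. It involves the
  third coefficient of P and the second derivative of q, but at a zero of q the former drops out and
  the latter is absorbed into the second derivative of q(z) q(-z), which both partners share.

  The resulting identity contains a complex conjugate and is therefore not a complex polynomial
  condition on the zeros. Scaling by a positive real commutes with conjugation, which is why the
  argument runs along rays and ends with Fubini. To obtain measure and category at once, conditions
  on zeros are restricted to compact balls, where they define closed sets.\<close>

type_synonym cseq = "nat \<Rightarrow> complex"

abbreviation gauss_ker :: "complex \<Rightarrow> real \<Rightarrow> complex" where
  "gauss_ker c t \<equiv> exp (- (of_real t)\<^sup>2 + c * of_real t)"

definition gint :: "complex \<Rightarrow> complex poly \<Rightarrow> complex" where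
  "gint c S = (LINT t|lborel. poly S (of_real t) * gauss_ker c t)"

text \<open>Half of the Gaussian absorbs the linear exponent, by (t - Re c)^2 >= 0. The rest is
  bounded by absolute moments of the normal density.\<close>

lemma gauss_dominated:
  fixes S :: "complex poly"
  shows "norm (poly S (of_real t) * gauss_ker c t)
     \<le> exp ((Re c)\<^sup>2 / 2) * ((\<Sum>k\<le>degree S. norm (coeff S k) * \<bar>t\<bar> ^ k) * exp (- t\<^sup>2 / 2))"
proof -
  have "norm (poly S (of_real t)) \<le> (\<Sum>k\<le>degree S. norm (coeff S k) * \<bar>t\<bar> ^ k)"
    unfolding poly_altdef by (rule norm_sum[THEN order_trans]) (simp add: norm_mult norm_power)
  moreover have "norm (gauss_ker c t) \<le> exp ((Re c)\<^sup>2 / 2) * exp (- t\<^sup>2 / 2)"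
  proof -
    have "0 \<le> (t - Re c)\<^sup>2" by simp
    then have "- t\<^sup>2 + Re c * t \<le> (Re c)\<^sup>2 / 2 - t\<^sup>2 / 2"
      by (simp add: power2_eq_square algebra_simps)
    then show ?thesis by (simp add: power2_eq_square flip: exp_add)
  qed
  ultimately have "norm (poly S (of_real t)) * norm (gauss_ker c t)
     \<le> (\<Sum>k\<le>degree S. norm (coeff S k) * \<bar>t\<bar> ^ k) * (exp ((Re c)\<^sup>2 / 2) * exp (- t\<^sup>2 / 2))"
    by (intro mult_mono) (auto intro!: sum_nonneg)
  then show ?thesis by (simp add: norm_mult mult_ac)
qed

lemma integrable_abs_power_gauss: "integrable lborel (\<lambda>t::real. \<bar>t\<bar> ^ k * exp (- t\<^sup>2 / 2))"
proof -
  have "integrable lborel (\<lambda>x. sqrt (2 * pi) * (std_normal_density x * \<bar>x\<bar> ^ k))"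
    by (intro integrable_mult_right integrable_std_normal_moment_abs)
  moreover have "sqrt (2 * pi) * (std_normal_density x * \<bar>x\<bar> ^ k) = \<bar>x\<bar> ^ k * exp (- x\<^sup>2 / 2)" for x
    by (simp add: std_normal_density_def)
  ultimately show ?thesis by simp
qed

lemma gint_integrable:
  "integrable lborel (\<lambda>t. poly S (complex_of_real t) * gauss_ker c t)"
proof (rule Bochner_Integration.integrable_bound)
  show "integrable lborel (\<lambda>t. exp ((Re c)\<^sup>2 / 2) * ((\<Sum>k\<le>degree S. norm (coeff S k) * \<bar>t\<bar> ^ k) * exp (- t\<^sup>2 / 2)))"
    by (simp only: sum_distrib_right mult.assoc) (intro integrable_mult_right Bochner_Integration.integrable_sum integrable_abs_power_gauss)
  show "(\<lambda>t. poly S (of_real t) * gauss_ker c t) \<in> borel_measurable lborel"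
    unfolding poly_altdef by measurable
  show "AE t in lborel. norm (poly S (of_real t) * gauss_ker c t)
      \<le> norm (exp ((Re c)\<^sup>2 / 2) * ((\<Sum>k\<le>degree S. norm (coeff S k) * \<bar>t\<bar> ^ k) * exp (- t\<^sup>2 / 2)))"
    by (intro AE_I2 order_trans[OF gauss_dominated]) simp
qed

lemma gint_add: "gint c (S + T) = gint c S + gint c T"
  unfolding gint_def by (simp only: poly_add distrib_right Bochner_Integration.integral_add gint_integrable)

lemma gint_smult: "gint c (smult a S) = a * gint c S"
  unfolding gint_def by (simp add: mult.assoc)

lemma gint_0 [simp]: "gint c 0 = 0"
  by (simp add: gint_def)

lemma gint_sum: "gint c (sum f A) = (\<Sum>x\<in>A. gint c (f x))"
  by (induction A rule: infinite_finite_induct) (auto simp: gint_add)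

lemma gauss_poly_tendsto_0:
  fixes S :: "complex poly"
  assumes "filterlim (\<lambda>t. \<bar>t\<bar>) at_top F"
  shows "((\<lambda>t. poly S (of_real t) * gauss_ker c t) \<longlongrightarrow> 0) F"
proof (rule Lim_null_comparison[OF always_eventually[OF allI[OF gauss_dominated]]])
  have *: "((\<lambda>s::real. s ^ k * exp (- s\<^sup>2 / 2)) \<longlongrightarrow> 0) at_top" for k
  proof (rule tendsto_sandwich[OF _ _ tendsto_const])
    show "((\<lambda>s::real. s ^ k / exp s) \<longlongrightarrow> 0) at_top" by (rule tendsto_power_div_exp_0)
    show "eventually (\<lambda>s::real. 0 \<le> s ^ k * exp (- s\<^sup>2 / 2)) at_top"
      using eventually_ge_at_top[of 0] by eventually_elim simp
    show "eventually (\<lambda>s::real. s ^ k * exp (- s\<^sup>2 / 2) \<le> s ^ k / exp s) at_top"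
      using eventually_ge_at_top[of 2]
    proof eventually_elim
      case (elim s)
      have "2 * s \<le> s * s" using elim by (intro mult_right_mono) auto
      then have "exp (- s\<^sup>2 / 2) \<le> exp (- s)" by (simp add: power2_eq_square)
      then have "s ^ k * exp (- s\<^sup>2 / 2) \<le> s ^ k * exp (- s)"
        using elim by (intro mult_left_mono) auto
      then show ?case by (simp add: exp_minus field_simps)
    qed
  qed
  have "((\<lambda>t. \<bar>t\<bar> ^ k * exp (- \<bar>t\<bar>\<^sup>2 / 2)) \<longlongrightarrow> 0) F" for k
    using filterlim_compose[OF *[of k] assms] by simp
  then have "((\<lambda>t. exp ((Re c)\<^sup>2 / 2) * (\<Sum>k\<le>degree S. norm (coeff S k) * (\<bar>t\<bar> ^ k * exp (- t\<^sup>2 / 2)))) \<longlongrightarrow>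
      exp ((Re c)\<^sup>2 / 2) * (\<Sum>k\<le>degree S. norm (coeff S k) * 0)) F"
    by (intro tendsto_intros) simp
  then show "((\<lambda>t. exp ((Re c)\<^sup>2 / 2) * ((\<Sum>k\<le>degree S. norm (coeff S k) * \<bar>t\<bar> ^ k) * exp (- t\<^sup>2 / 2))) \<longlongrightarrow> 0) F"
    by (simp add: sum_distrib_right mult.assoc)
qed

text \<open>The integral of the derivative of S(t) exp(-t^2 + c t) vanishes. This recursion takes
  the place of contour shifts in all Gaussian integrals below.\<close>

lemma gint_by_parts: "gint c ([:0, 1:] * S) = gint c (pderiv S) / 2 + c / 2 * gint c S"
proof -
  define F where "F = (\<lambda>t. poly S (complex_of_real t) * gauss_ker c t)"
  define T where "T = pderiv S + smult c S - smult 2 ([:0, 1:] * S)"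
  define f where "f = (\<lambda>t. poly T (complex_of_real t) * gauss_ker c t)"
  have der: "(F has_vector_derivative f t) (at t)" for t
  proof -
    have "((\<lambda>z. poly S z * exp (- z\<^sup>2 + c * z)) has_field_derivative f t) (at (of_real t))"
      unfolding f_def T_def
      by (rule derivative_eq_intros poly_DERIV refl)+ (simp add: algebra_simps)
    from has_vector_derivative_real_field[OF this] show ?thesis unfolding F_def .
  qed
  have cont: "isCont f t" for t
    unfolding f_def by (intro continuous_intros)
  have int: "integrable lborel f" unfolding f_def by (rule gint_integrable)
  have "filterlim (\<lambda>t::real. \<bar>t\<bar>) at_top at_bot"
    by (simp add: filterlim_at_bot_mirror filterlim_abs_real)
  then have lim: "(F \<longlongrightarrow> 0) at_top" "(F \<longlongrightarrow> 0) at_bot"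
    unfolding F_def by (auto intro: gauss_poly_tendsto_0 filterlim_abs_real simp del: uminus_add_conv_diff)
  have "(LBINT t=-\<infinity>..\<infinity>. f t) = 0 - 0"
    using der cont int lim
    by (intro interval_integral_FTC_integrable[where F = F])
       (auto simp: set_integrable_def einterval_def ereal_tendsto_simps)
  then have "(LINT t|lborel. f t) = 0"
    by (simp add: interval_lebesgue_integral_def einterval_def set_lebesgue_integral_def)
  then have "gint c T = 0" by (simp add: gint_def f_def)
  then have "gint c (pderiv S) + c * gint c S = 2 * gint c ([:0, 1:] * S)"
    unfolding T_def diff_conv_add_uminus
    by (simp only: gint_add gint_smult flip: smult_minus_left) simp
  then show ?thesis by (simp add: field_simps)
qed

text \<open>Only a real substitution is needed: t = Re c / 2 + x / sqrt 2 turns the real part of the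
  exponent into -x^2/2 plus a constant, and Im c / sqrt 2 becomes the argument of the characteristic
  function of the normal distribution.\<close>

lemma gint_1: "gint c 1 = of_real (sqrt pi) * exp (c\<^sup>2 / 4)"
proof -
  define a b where "a = Re c" "b = Im c"
  have c: "c = Complex a b" by (simp add: a_b_def)
  have "char std_normal_distribution y = (LINT x|lborel. std_normal_density x *\<^sub>R cis (y * x))" for y
    unfolding char_def by (subst integral_density) (auto simp: cis_conv_exp)
  then have "(LINT x|lborel. std_normal_density x *\<^sub>R cis (b / sqrt 2 * x)) = of_real (exp (- (b / sqrt 2)\<^sup>2 / 2))"
    by (metis char_std_normal_distribution)
  then have A: "(LINT x|lborel. exp (of_real (- x\<^sup>2 / 2)) * cis (b / sqrt 2 * x)) = of_real (sqrt (2 * pi) * exp (- b\<^sup>2 / 4))"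
  proof -
    assume *: "(LINT x|lborel. std_normal_density x *\<^sub>R cis (b / sqrt 2 * x)) = of_real (exp (- (b / sqrt 2)\<^sup>2 / 2))"
    have "exp (of_real (- x\<^sup>2 / 2)) * cis (b / sqrt 2 * x) = of_real (sqrt (2 * pi)) * (std_normal_density x *\<^sub>R cis (b / sqrt 2 * x))" for x
      by (simp add: std_normal_density_def scaleR_conv_of_real exp_of_real real_sqrt_mult del: of_real_exp flip: exp_of_real)
    then show ?thesis
      by (simp only: integral_mult_right_zero *) (simp add: power_divide)
  qed
  have "gint c 1 = \<bar>1 / sqrt 2\<bar> *\<^sub>R (LINT x|lborel. exp (- (of_real (a / 2 + 1 / sqrt 2 * x))\<^sup>2 + c * of_real (a / 2 + 1 / sqrt 2 * x)))"
    unfolding gint_def by (subst lborel_integral_real_affine[where c = "1 / sqrt 2" and t = "a / 2"]) simp_all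
  also have "(\<lambda>x. exp (- (complex_of_real (a / 2 + 1 / sqrt 2 * x))\<^sup>2 + c * of_real (a / 2 + 1 / sqrt 2 * x)))
     = (\<lambda>x. exp (of_real (a\<^sup>2 / 4) + \<i> * of_real (a * b / 2)) * (exp (of_real (- x\<^sup>2 / 2)) * cis (b / sqrt 2 * x)))"
  proof
    fix x :: real
    define k where "k = 1 / sqrt 2"
    have k: "k * k = 1 / 2" by (simp add: k_def)
    have "Re (- (complex_of_real (a / 2 + k * x))\<^sup>2 + c * of_real (a / 2 + k * x)) = a\<^sup>2 / 4 - (k * k) * x\<^sup>2"
      by (simp add: c power2_eq_square algebra_simps)
    moreover have "Im (- (complex_of_real (a / 2 + k * x))\<^sup>2 + c * of_real (a / 2 + k * x)) = a * b / 2 + b * k * x"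
      by (simp add: c power2_eq_square algebra_simps)
    ultimately have "- (complex_of_real (a / 2 + k * x))\<^sup>2 + c * of_real (a / 2 + k * x)
      = of_real (a\<^sup>2 / 4) + \<i> * of_real (a * b / 2) + (of_real (- x\<^sup>2 / 2) + \<i> * of_real (b * k * x))"
      unfolding k by (simp add: complex_eq_iff)
    then show "exp (- (complex_of_real (a / 2 + 1 / sqrt 2 * x))\<^sup>2 + c * of_real (a / 2 + 1 / sqrt 2 * x))
      = exp (of_real (a\<^sup>2 / 4) + \<i> * of_real (a * b / 2)) * (exp (of_real (- x\<^sup>2 / 2)) * cis (b / sqrt 2 * x))"
      unfolding k_def cis_conv_exp by (simp only: exp_add[symmetric] times_divide_eq_left mult_1 times_divide_eq_right mult_1_right)
  qed
  finally have "gint c 1 = \<bar>1 / sqrt 2\<bar> *\<^sub>R (exp (of_real (a\<^sup>2 / 4) + \<i> * of_real (a * b / 2)) * of_real (sqrt (2 * pi) * exp (- b\<^sup>2 / 4)))"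
    by (simp only: integral_mult_right_zero A)
  also have "\<dots> = of_real (sqrt pi) * (exp (of_real (a\<^sup>2 / 4) + \<i> * of_real (a * b / 2)) * exp (of_real (- b\<^sup>2 / 4)))"
    by (simp add: scaleR_conv_of_real real_sqrt_mult flip: exp_of_real)
  also have "exp (of_real (a\<^sup>2 / 4) + \<i> * of_real (a * b / 2)) * exp (complex_of_real (- b\<^sup>2 / 4)) = exp (c\<^sup>2 / 4)"
    unfolding exp_add[symmetric] c
    by (rule arg_cong[of _ _ exp]) (simp add: complex_eq_iff power2_eq_square field_simps)
  finally show ?thesis .
qed

text \<open>In substance a contour shift by c/2. It follows by induction on the degree, since both
  sides obey the same recursion by parts and agree on constants.\<close>

lemma gint_shift: "gint c S = exp (c\<^sup>2 / 4) * gint 0 (pcompose S [:c / 2, 1:])"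
proof (induction "degree S" arbitrary: S rule: less_induct)
  case less
  have const: "gint c [:a:] = exp (c\<^sup>2 / 4) * gint 0 [:a:]" for a
    using gint_smult[of c a 1] gint_smult[of 0 a 1] by (simp add: gint_1)
  obtain a T where S: "S = pCons a T" by (rule pCons_cases)
  show ?case
  proof (cases "T = 0")
    case True
    then show ?thesis by (simp add: S const)
  next
    case False
    then have d: "degree T < degree S" "degree (pderiv T) < degree S"
      using degree_pderiv[of T] by (auto simp: S)
    have S': "S = [:a:] + [:0, 1:] * T" by (simp add: S)
    have "gint 0 (pcompose S [:c / 2, 1:]) =
       gint 0 [:a:] + gint 0 (smult (c / 2) (pcompose T [:c / 2, 1:]) + [:0, 1:] * pcompose T [:c / 2, 1:])"
      unfolding S' by (simp add: pcompose_add pcompose_mult gint_add[symmetric] pcompose_pCons)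
    also have "\<dots> = gint 0 [:a:] + c / 2 * gint 0 (pcompose T [:c / 2, 1:]) + gint 0 (pcompose (pderiv T) [:c / 2, 1:]) / 2"
      by (simp only: gint_add gint_smult gint_by_parts) (simp add: pderiv_pcompose pderiv_pCons)
    finally show ?thesis
      unfolding S' gint_add gint_by_parts
      using less(1)[OF d(1)] less(1)[OF d(2)] const[of a] by (simp add: S' algebra_simps)
  qed
qed

section \<open>Gaussian convolution of a polynomial\<close>

text \<open>
  \<open>heat P\<close> is the polynomial \<open>z \<mapsto> \<integral> P (t + z) exp (- t\<^sup>2) dt\<close>; the recursion is integration by parts.
\<close>

definition heat :: "complex poly \<Rightarrow> complex poly" where
  "heat P = fold_coeffs (\<lambda>a h. [:of_real (sqrt pi) * a:] + pCons 0 h + smult (1/2) (pderiv h)) P 0"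

lemma heat_0 [simp]: "heat 0 = 0"
  by (simp add: heat_def)

lemma heat_pCons [simp]:
  "heat (pCons a P) = [:of_real (sqrt pi) * a:] + pCons 0 (heat P) + smult (1/2) (pderiv (heat P))"
  unfolding heat_def by (cases "P = 0"; cases "a = 0") auto

lemma gint_0_1: "gint 0 1 = of_real (sqrt pi)"
  by (simp add: gint_1)

lemma pderiv_linear_pcompose: "pderiv (pcompose P [:z, 1:]) = pcompose (pderiv P) [:z, 1:]"
  by (simp add: pderiv_pcompose pderiv_pCons)

lemma gint_pcompose_X:
  "gint 0 (pcompose ([:0, 1:] * P) [:z, 1:])
    = z * gint 0 (pcompose P [:z, 1:]) + gint 0 (pcompose (pderiv P) [:z, 1:]) / 2"
proof -
  have "pcompose ([:0, 1:] * P) [:z, 1:] = smult z (pcompose P [:z, 1:]) + [:0, 1:] * pcompose P [:z, 1:]"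
    by (simp add: pcompose_pCons)
  then show ?thesis
    by (simp only: gint_add gint_smult gint_by_parts pderiv_linear_pcompose) simp
qed

lemma heat_add: "heat (P + Q) = heat P + heat Q"
proof (induction P Q rule: poly_induct2)
  case (pCons a P b Q)
  then show ?case by (simp add: pderiv_add smult_add_right algebra_simps)
qed simp

lemma heat_smult: "heat (smult c P) = smult c (heat P)"
  by (induction P) (simp_all add: pderiv_smult smult_add_right mult.left_commute)

lemma heat_pderiv: "heat (pderiv P) = pderiv (heat P)"
proof (induction P)
  case (pCons a P)
  then show ?case by (simp add: pderiv_pCons heat_add pderiv_add pderiv_smult)
qed simp

lemma poly_heat: "poly (heat P) z = gint 0 (pcompose P [:z, 1:])"
proof (induction "degree P" arbitrary: P rule: less_induct)
  case less
  obtain a T where P: "P = pCons a T" by (rule pCons_cases)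
  have a: "gint 0 [:a:] = of_real (sqrt pi) * a"
    using gint_smult[of 0 a 1] by (simp add: gint_0_1)
  show ?case
  proof (cases "T = 0")
    case True
    then show ?thesis by (simp add: P a)
  next
    case False
    then have d: "degree T < degree P" "degree (pderiv T) < degree P"
      using degree_pderiv[of T] by (auto simp: P)
    have "P = [:a:] + [:0, 1:] * T" by (simp add: P)
    then have "gint 0 (pcompose P [:z, 1:]) = gint 0 [:a:] + gint 0 (pcompose ([:0, 1:] * T) [:z, 1:])"
      by (simp only: pcompose_add gint_add) simp
    then show ?thesis
      unfolding gint_pcompose_X a using less(1)[OF d(1)] less(1)[OF d(2)]
      by (simp add: P heat_pderiv)
  qed
qed

text \<open>The correction term lies two degrees lower, so the two top coefficients are merely
  scaled; this makes the sum of the zeros of \<open>heat P\<close> readable from \<open>P\<close>. A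
  bound on the degree instead of equality lets the induction pass through vanishing top
  coefficients.\<close>

lemma coeff_heat_aux:
  assumes "degree P \<le> n"
  shows "degree (heat P) \<le> n \<and> coeff (heat P) n = of_real (sqrt pi) * coeff P n
    \<and> (n > 0 \<longrightarrow> coeff (heat P) (n - 1) = of_real (sqrt pi) * coeff P (n - 1))"
  using assms
proof (induction n arbitrary: P)
  case 0
  then obtain a where "P = [:a:]" using degree_eq_zeroE by blast
  then show ?case by simp
next
  case (Suc n)
  obtain a T where P: "P = pCons a T" by (rule pCons_cases)
  have T: "degree T \<le> n" using Suc.prems by (cases "T = 0") (auto simp: P)
  note IH = Suc.IH[OF T]
  have z: "coeff (pderiv (heat T)) (Suc n) = 0" "coeff (pderiv (heat T)) n = 0"
    using IH by (auto intro!: coeff_eq_0 simp: coeff_pderiv)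
  have "degree (pderiv (heat T)) \<le> Suc n" using IH degree_pderiv[of "heat T"] by auto
  moreover have "degree (pCons 0 (heat T)) \<le> Suc n" using IH by (auto simp: degree_pCons_le intro: order_trans[OF degree_pCons_le])
  ultimately have "degree (heat P) \<le> Suc n"
    unfolding P heat_pCons by (intro degree_add_le) auto
  then show ?case
    using IH z by (cases n) (auto simp: P coeff_pCons split: nat.splits)
qed

lemma degree_heat [simp]: "degree (heat P) = degree P"
proof (cases "P = 0")
  case False
  then show ?thesis
    using coeff_heat_aux[of P "degree P"] le_degree[of "heat P" "degree P"] by auto
qed simp

lemma lead_coeff_heat: "lead_coeff (heat P) = of_real (sqrt pi) * lead_coeff P"
  using coeff_heat_aux[of P "degree P"] by auto

text \<open>Subtracting the image of a suitable leading monomial lowers the degree. This turns a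
  polynomial found on the Bargmann side back into a polynomial times a Gaussian.\<close>

lemma heat_surj: "\<exists>P. heat P = q"
proof (induction "degree q" arbitrary: q rule: less_induct)
  case less
  define T where "T = monom (lead_coeff q / of_real (sqrt pi)) (degree q)"
  have dT: "degree T \<le> degree q" by (simp add: T_def degree_monom_le)
  have h: "degree (heat T) \<le> degree q" "coeff (heat T) (degree q) = lead_coeff q"
    using coeff_heat_aux[OF dT] by (auto simp: T_def)
  show ?case
  proof (cases "degree q = 0")
    case True
    then obtain a where "q = [:a:]" using degree_eq_zeroE by blast
    then have "heat [:a / of_real (sqrt pi):] = q" by simp
    then show ?thesis ..
  next
    case False
    have "degree (q - heat T) < degree q"
    proof (rule ccontr)
      assume "\<not> degree (q - heat T) < degree q"
      moreover have "degree (q - heat T) \<le> degree q" using h by (intro degree_diff_le) auto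
      ultimately have "degree (q - heat T) = degree q" by simp
      moreover have "coeff (q - heat T) (degree q) = 0" using h by simp
      ultimately have "q - heat T = 0" by (metis leading_coeff_0_iff)
      then show False using \<open>degree (q - heat T) = degree q\<close> False by simp
    qed
    from less[OF this] obtain S where "heat S = q - heat T" by auto
    then have "heat (S + T) = q" by (simp add: heat_add)
    then show ?thesis ..
  qed
qed

lemma heat_inj: assumes "heat P = heat Q" shows "P = Q"
proof -
  have "heat (P + smult (-1) Q) = 0" using assms by (simp only: heat_add heat_smult) simp
  then have "P + smult (-1) Q = 0"
    by (metis degree_heat lead_coeff_heat leading_coeff_0_iff mult_eq_0_iff of_real_eq_0_iff pi_neq_zero real_sqrt_eq_zero_cancel_iff)
  then show ?thesis by simp
qed

lemma bargmann_gauss: "gint (2 * z) P = exp (z\<^sup>2) * poly (heat P) z"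
  by (simp add: gint_shift[of "2 * z"] poly_heat power2_eq_square)

section \<open>The ambiguity function as a polynomial\<close>

text \<open>The value at z is the integral of t^j P(t + z) exp(-t^2). The recursion splits off one
  factor t and integrates by parts; the coefficients compared later involve j <= 2.\<close>

fun moment_poly :: "nat \<Rightarrow> complex poly \<Rightarrow> complex poly" where
  "moment_poly 0 P = heat P"
| "moment_poly (Suc 0) P = smult (1/2) (pderiv (heat P))"
| "moment_poly (Suc (Suc j)) P = smult (of_nat (Suc j) / 2) (moment_poly j P) + smult (1/2) (pderiv (moment_poly (Suc j) P))"

lemma moment_poly_pderiv: "moment_poly j (pderiv P) = pderiv (moment_poly j P)"
  by (induction j P rule: moment_poly.induct) (simp_all add: heat_pderiv pderiv_smult pderiv_add)

lemma poly_moment_poly: "poly (moment_poly j P) z = gint 0 (monom 1 j * pcompose P [:z, 1:])"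
proof (induction j arbitrary: P rule: less_induct)
  case (less j)
  show ?case
  proof (cases j)
    case 0
    then show ?thesis by (simp add: poly_heat)
  next
    case (Suc k)
    let ?S = "pcompose P [:z, 1:]"
    have 1: "gint 0 (monom 1 j * ?S) = gint 0 (pderiv (monom 1 k * ?S)) / 2"
    proof -
      have "monom 1 j * ?S = [:0, 1:] * (monom 1 k * ?S)"
        by (simp add: Suc monom_Suc)
      then show ?thesis by (simp only: gint_by_parts) simp
    qed
    have 2: "gint 0 (monom 1 k * pcompose (pderiv P) [:z, 1:]) = poly (pderiv (moment_poly k P)) z"
      using less[of k "pderiv P"] by (simp add: Suc moment_poly_pderiv)
    show ?thesis
    proof (cases k)
      case 0
      then show ?thesis using 1 2 by (simp add: Suc pderiv_linear_pcompose)
    next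
      case (Suc i)
      have "pderiv (monom 1 k * ?S) = smult (of_nat k) (monom 1 i * ?S) + monom 1 k * pcompose (pderiv P) [:z, 1:]"
        by (simp add: Suc pderiv_mult pderiv_monom pderiv_linear_pcompose smult_monom flip: mult_smult_left)
      then show ?thesis
        using 1 2 less[of i P] by (simp add: gint_add gint_smult \<open>j = Suc k\<close> Suc field_simps)
    qed
  qed
qed

abbreviation eval2 :: "complex poly poly \<Rightarrow> complex \<Rightarrow> complex \<Rightarrow> complex" where
  "eval2 H z w \<equiv> poly (poly H [:w:]) z"

abbreviation cnj_poly :: "complex poly \<Rightarrow> complex poly" where
  "cnj_poly \<equiv> map_poly cnj"

text \<open>
  A polynomial in \<open>w\<close> whose coefficients are polynomials in \<open>z\<close>, with value
  \<open>\<integral> P (t + s z) P\<^sup>* (t - s w) exp (- t\<^sup>2) dt\<close>. Up to an exponential factor the value at \<open>s = 1\<close>, \<open>w = cnj z\<close> is the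
  ambiguity function of \<open>P (t) exp (- t\<^sup>2 / 2)\<close> at \<open>2 z\<close>, and \<open>s = -1\<close> gives its conjugate.
\<close>

definition amb_poly :: "complex \<Rightarrow> complex poly \<Rightarrow> complex poly poly" where
  "amb_poly s P = (\<Sum>i\<le>degree P. \<Sum>k\<le>i.
     monom (smult (cnj (coeff P i) * of_nat (i choose k) * (- s) ^ k) (pcompose (moment_poly (i - k) P) [:0, s:])) k)"

lemma poly_ext: "(\<And>x. poly p x = poly q x) \<Longrightarrow> p = q" for p q :: "complex poly"
  by (metis poly_eq_poly_eq_iff ext)

lemma smult_left_cancel: "c \<noteq> 0 \<Longrightarrow> smult c p = smult c q \<longleftrightarrow> p = q" for c :: complex
  by (auto simp: poly_eq_iff)

lemma poly_cnj_poly: "poly (cnj_poly S) y = cnj (poly S (cnj y))"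
  by (metis complex_cnj_cnj poly_cnj)

text \<open>The binomial theorem expands the conjugated factor in powers of w, and each remaining
  power of t is a moment.\<close>

lemma eval2_amb_poly:
  "eval2 (amb_poly s P) z w = gint 0 (pcompose P [:s * z, 1:] * pcompose (cnj_poly P) [:- (s * w), 1:])"
proof -
  have "pcompose (cnj_poly P) [:- (s * w), 1:] =
     (\<Sum>i\<le>degree P. \<Sum>k\<le>i. smult (cnj (coeff P i) * of_nat (i choose k) * (- (s * w)) ^ k) (monom 1 (i - k)))"
  proof (rule poly_ext)
    fix x
    have "poly (pcompose (cnj_poly P) [:- (s * w), 1:]) x = (\<Sum>i\<le>degree P. cnj (coeff P i) * (- (s * w) + x) ^ i)"
      unfolding poly_pcompose by (simp add: poly_altdef[of P] coeff_map_poly degree_map_poly)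
    then show "poly (pcompose (cnj_poly P) [:- (s * w), 1:]) x = poly (\<Sum>i\<le>degree P. \<Sum>k\<le>i. smult (cnj (coeff P i) * of_nat (i choose k) * (- (s * w)) ^ k) (monom 1 (i - k))) x"
      unfolding binomial_ring by (simp add: poly_sum poly_monom sum_distrib_left mult_ac)
  qed
  then have "pcompose P [:s * z, 1:] * pcompose (cnj_poly P) [:- (s * w), 1:] =
     (\<Sum>i\<le>degree P. \<Sum>k\<le>i. smult (cnj (coeff P i) * of_nat (i choose k) * (- (s * w)) ^ k) (monom 1 (i - k) * pcompose P [:s * z, 1:]))"
    by (simp add: sum_distrib_left mult.commute)
  then have "gint 0 (pcompose P [:s * z, 1:] * pcompose (cnj_poly P) [:- (s * w), 1:]) =
     (\<Sum>i\<le>degree P. \<Sum>k\<le>i. (cnj (coeff P i) * of_nat (i choose k) * (- (s * w)) ^ k) * poly (moment_poly (i - k) P) (s * z))"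
    by (simp add: gint_sum gint_smult poly_moment_poly)
  also have "\<dots> = eval2 (amb_poly s P) z w"
    by (simp add: amb_poly_def poly_sum poly_monom poly_pcompose power_mult_distrib mult_ac power_minus[of "s * w"] power_minus[of s] poly_power)
  finally show ?thesis by simp
qed

text \<open>The pairs (z, cnj z) form a totally real plane: with z = u + i v and w = u - i v they
  are the real pairs (u, v). The identity theorem is applied to one variable after the
  other.\<close>

lemma eval2_zero_imp_zero:
  assumes "\<And>z. eval2 H z (cnj z) = 0"
  shows "H = 0"
proof -
  have real_zero: "f w = 0" if "f holomorphic_on UNIV" "\<And>x. f (of_real x) = 0" for f :: "complex \<Rightarrow> complex" and w
  proof (rule analytic_continuation[OF that(1), of "range of_real" 0])
    show "(0::complex) islimpt range of_real"
    proof (rule islimptI)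
      fix T :: "complex set" assume "0 \<in> T" "open T"
      then obtain e where e: "e > 0" "ball 0 e \<subseteq> T" by (meson open_contains_ball)
      then have "complex_of_real (e / 2) \<in> T" by (intro subsetD[OF e(2)]) auto
      then show "\<exists>y\<in>range complex_of_real. y \<in> T \<and> y \<noteq> 0"
        by (intro bexI[OF _ rangeI[of complex_of_real "e / 2"]]) (use e(1) in auto)
    qed
  qed (use that in auto)
  have ev: "eval2 H z w = (\<Sum>k\<le>degree H. poly (coeff H k) z * w ^ k)" for z w
    by (simp add: poly_altdef[of H] poly_sum poly_power)
  have hol: "(\<lambda>u. eval2 H (a + b * u) (c + d * u)) holomorphic_on UNIV" for a b c d
    unfolding ev poly_altdef[of "coeff H _"] by (intro holomorphic_intros)
  have 1: "eval2 H (of_real x + \<i> * of_real y) (of_real x - \<i> * of_real y) = 0" for x y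
    using assms[of "of_real x + \<i> * of_real y"] by simp
  have 2: "eval2 H (u + \<i> * of_real y) (u - \<i> * of_real y) = 0" for u y
    using real_zero[OF hol[where a = "\<i> * of_real y" and b = 1 and c = "- \<i> * of_real y" and d = 1]] 1 by (simp add: add.commute)
  have 3: "eval2 H (u + \<i> * v) (u - \<i> * v) = 0" for u v
    using real_zero[OF hol[where a = u and b = \<i> and c = u and d = "- \<i>"]] 2 by simp
  have "eval2 H z w = 0" for z w
    using 3[of "(z + w) / 2" "(z - w) / (2 * \<i>)"] by (simp add: field_simps)
  then have z: "poly H [:w:] = 0" for w
    by (metis poly_0 poly_ext)
  \<comment> \<open>A nonzero \<open>H\<close>, as a polynomial over the ring of polynomials in z,
    cannot have every constant as a root.\<close>
  show ?thesis
  proof (rule ccontr)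
    assume "H \<noteq> 0"
    then have "finite {x. poly H x = 0}" by (rule poly_roots_finite)
    moreover have "range (\<lambda>w. [:w:]) \<subseteq> {x. poly H x = 0}" using z by auto
    ultimately have "finite (range (\<lambda>w::complex. [:w:]))" by (rule rev_finite_subset)
    moreover have "inj (\<lambda>w::complex. [:w:])" by (auto simp: inj_def)
    ultimately have "finite (UNIV :: complex set)" using finite_imageD by blast
    then show False by (simp add: infinite_UNIV_char_0)
  qed
qed

lemma coeff_amb_poly:
  "coeff (amb_poly s P) k = (\<Sum>i\<in>{k..degree P}.
     smult (cnj (coeff P i) * of_nat (i choose k) * (- s) ^ k) (pcompose (moment_poly (i - k) P) [:0, s:]))"
proof -
  have "coeff (amb_poly s P) k = (\<Sum>i\<le>degree P. if k \<le> i then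
     smult (cnj (coeff P i) * of_nat (i choose k) * (- s) ^ k) (pcompose (moment_poly (i - k) P) [:0, s:]) else 0)"
    unfolding amb_poly_def coeff_sum by (intro sum.cong refl) simp
  also have "\<dots> = (\<Sum>i\<in>{k..degree P}.
     smult (cnj (coeff P i) * of_nat (i choose k) * (- s) ^ k) (pcompose (moment_poly (i - k) P) [:0, s:]))"
    by (rule sum.mono_neutral_cong_right) auto
  finally show ?thesis .
qed

lemma degree_amb_poly:
  assumes "s \<noteq> 0" "P \<noteq> 0"
  shows "degree (amb_poly s P) = degree P"
    and "lead_coeff (amb_poly s P) = smult (cnj (lead_coeff P) * (- s) ^ degree P) (pcompose (heat P) [:0, s:])"
proof -
  have c: "coeff (amb_poly s P) (degree P) = smult (cnj (lead_coeff P) * (- s) ^ degree P) (pcompose (heat P) [:0, s:])"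
    by (simp add: coeff_amb_poly)
  have "heat P \<noteq> 0" using assms heat_inj[of P 0] by auto
  then have "pcompose (heat P) [:0, s:] \<noteq> 0" using assms by (subst pcompose_eq_0_iff) auto
  then have "coeff (amb_poly s P) (degree P) \<noteq> 0" unfolding c using assms by simp
  moreover have "degree (amb_poly s P) \<le> degree P"
    by (rule degree_le) (auto simp: coeff_amb_poly)
  ultimately show "degree (amb_poly s P) = degree P"
    by (meson le_antisym le_degree)
  with c show "lead_coeff (amb_poly s P) = smult (cnj (lead_coeff P) * (- s) ^ degree P) (pcompose (heat P) [:0, s:])"
    by simp
qed

section \<open>Comparison of the coefficients of two partners\<close>

abbreviation refl_poly :: "complex poly \<Rightarrow> complex poly" where
  "refl_poly q \<equiv> pcompose q [:0, -1:]"

text \<open>The leading coefficients in w are cnj (lead_coeff P) times (-1)^n q(z) and q(-z). The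
  sign (-1)^n is the same for both partners once their degrees agree.\<close>

lemma amb_poly_product_top:
  assumes eq: "amb_poly 1 P * amb_poly (-1) P = amb_poly 1 Q * amb_poly (-1) Q" and "P \<noteq> 0"
  shows "Q \<noteq> 0" "degree P = degree Q"
    and "smult ((cnj (lead_coeff P))\<^sup>2) (heat P * refl_poly (heat P)) = smult ((cnj (lead_coeff Q))\<^sup>2) (heat Q * refl_poly (heat Q))"
proof -
  have minus_one_neq_zero: "- 1 \<noteq> (0 :: complex)" by simp
  have nz: "amb_poly s R \<noteq> 0" if "s \<noteq> 0" "R \<noteq> 0" for s R
  proof -
    have "heat R \<noteq> 0" using that heat_inj[of R 0] by auto
    then have "pcompose (heat R) [:0, s:] \<noteq> 0" using that by (subst pcompose_eq_0_iff) auto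
    then have "lead_coeff (amb_poly s R) \<noteq> 0" using that by (subst degree_amb_poly(2)) auto
    then show ?thesis by auto
  qed
  have z: "amb_poly s 0 = 0" for s by (simp add: amb_poly_def)
  show Q: "Q \<noteq> 0" using eq nz[of 1 P] nz[of "-1" P] \<open>P \<noteq> 0\<close> by (auto simp: z)
  have "degree (amb_poly 1 P * amb_poly (-1) P) = 2 * degree P"
    "degree (amb_poly 1 Q * amb_poly (-1) Q) = 2 * degree Q"
    using \<open>P \<noteq> 0\<close> Q by (simp_all add: degree_mult_eq nz degree_amb_poly)
  then show d: "degree P = degree Q" using eq by simp
  have "lead_coeff (amb_poly 1 P * amb_poly (-1) P) = lead_coeff (amb_poly 1 Q * amb_poly (-1) Q)"
    using eq by simp
  then have "smult ((-1) ^ degree P) (smult ((cnj (lead_coeff P))\<^sup>2) (heat P * refl_poly (heat P))) =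
     smult ((-1) ^ degree P) (smult ((cnj (lead_coeff Q))\<^sup>2) (heat Q * refl_poly (heat Q)))"
    unfolding lead_coeff_mult degree_amb_poly(2)[OF one_neq_zero \<open>P \<noteq> 0\<close>] degree_amb_poly(2)[OF one_neq_zero Q]
      degree_amb_poly(2)[OF minus_one_neq_zero \<open>P \<noteq> 0\<close>] degree_amb_poly(2)[OF minus_one_neq_zero Q]
    by (simp add: d power2_eq_square mult_ac)
  then show "smult ((cnj (lead_coeff P))\<^sup>2) (heat P * refl_poly (heat P)) = smult ((cnj (lead_coeff Q))\<^sup>2) (heat Q * refl_poly (heat Q))"
    by (rule smult_left_cancel[THEN iffD1, rotated]) simp
qed

lemma coeff_mult_drop2:
  fixes F G :: "'a :: comm_semiring_0 poly"
  assumes "degree F \<le> m + 2" "degree G \<le> m + 2"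
  shows "coeff (F * G) (2 * m + 2) = coeff F m * coeff G (m + 2) + coeff F (m + 1) * coeff G (m + 1) + coeff F (m + 2) * coeff G m"
proof -
  have "coeff (F * G) (2 * m + 2) = (\<Sum>i\<in>{m, m + 1, m + 2}. coeff F i * coeff G (2 * m + 2 - i))"
    unfolding coeff_mult
  proof (rule sum.mono_neutral_right)
    show "\<forall>i\<in>{..2 * m + 2} - {m, m + 1, m + 2}. coeff F i * coeff G (2 * m + 2 - i) = 0"
    proof
      fix i assume i: "i \<in> {..2 * m + 2} - {m, m + 1, m + 2}"
      then have "i > m + 2 \<or> 2 * m + 2 - i > m + 2" by auto
      then show "coeff F i * coeff G (2 * m + 2 - i) = 0"
        using assms by (auto simp: coeff_eq_0)
    qed
  qed auto
  also have "2 * m + 2 - m = m + 2" "2 * m + 2 - (m + 1) = m + 1" "2 * m + 2 - (m + 2) = m" by auto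
  then have "(\<Sum>i\<in>{m, m + 1, m + 2}. coeff F i * coeff G (2 * m + 2 - i)) =
    coeff F m * coeff G (m + 2) + coeff F (m + 1) * coeff G (m + 1) + coeff F (m + 2) * coeff G m"
    by (simp add: add.assoc)
  finally show ?thesis .
qed

text \<open>Only the values at the zeros of \<open>heat P\<close> matter, where most terms of the coefficient vanish.\<close>

lemma amb_poly_product_second:
  fixes P :: "complex poly"
  defines "q \<equiv> heat P" and "n \<equiv> degree P"
  defines "a \<equiv> cnj (coeff P n)" and "b \<equiv> cnj (coeff P (n - 1))"
  assumes n: "degree P = m + 2" and z: "poly q z = 0"
  shows "(-1) ^ m * poly (coeff (amb_poly 1 P * amb_poly (-1) P) (2 * m + 2)) z
    = a\<^sup>2 * of_nat (n choose 2) / 4 * poly (pderiv (pderiv (q * refl_poly q))) z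
      - a\<^sup>2 * of_nat n / 4 * poly (pderiv q) z * poly (pderiv q) (- z)
      - a * b / 2 * poly (pderiv q) z * poly q (- z)"
proof -
  have P: "P \<noteq> 0" using n by auto
  have nm: "n = Suc (Suc m)" using n by (simp add: n_def)
  define d where "d = cnj (coeff P m)"
  define e where "e = poly (pderiv (pderiv q))"
  have iv: "{m..Suc (Suc m)} = {m, Suc m, Suc (Suc m)}" "{Suc m..Suc (Suc m)} = {Suc m, Suc (Suc m)}" by auto
  have ch: "Suc (Suc m) choose m = Suc (Suc m) choose 2"
    by (metis add_2_eq_Suc' binomial_symmetric add_diff_cancel_left' le_add1)
  define k where "k = (-1 :: complex) ^ m"
  have kk: "k * (k * x) = x" for x by (simp add: k_def flip: mult.assoc power_mult_distrib)
  have alg: "k * (k * U * V + - (k * W) * X) = U * V - W * X" for U V W X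
    using kk[of 1] by algebra
  have c0: "poly (coeff (amb_poly s P) (Suc (Suc m))) z = (- s) ^ m * s\<^sup>2 * (a * poly q (s * z))" for s
    by (simp add: coeff_amb_poly n poly_pcompose a_def nm q_def power2_eq_square mult_ac)
  have c1: "poly (coeff (amb_poly s P) (Suc m)) z = - ((- s) ^ m * s * (of_nat n * a * poly (pderiv q) (s * z) / 2 + b * poly q (s * z)))" for s
    by (simp add: coeff_amb_poly n poly_pcompose a_def b_def nm q_def iv binomial_Suc_n algebra_simps)
  have c2: "poly (coeff (amb_poly s P) m) z = (- s) ^ m * (of_nat (n choose 2) * a * (poly q (s * z) / 2 + e (s * z) / 4)
      + of_nat (Suc m) * b * poly (pderiv q) (s * z) / 2 + d * poly q (s * z))" for s
    by (simp add: coeff_amb_poly n poly_pcompose a_def b_def d_def e_def nm q_def iv binomial_Suc_n ch numeral_2_eq_2 pderiv_smult algebra_simps)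
  \<comment> \<open>The top coefficient of the first factor vanishes at the zero z, which removes
    the w^m coefficient of the second factor; in the first factor \<open>d\<close> is multiplied by
    q(z) = 0. So the third coefficient of P disappears.\<close>
  have p: "poly (coeff (amb_poly 1 P) (Suc (Suc m))) z = 0"
      "poly (coeff (amb_poly 1 P) (Suc m)) z = - (k * (of_nat n * a * poly (pderiv q) z / 2))"
      "poly (coeff (amb_poly 1 P) m) z = k * (of_nat (n choose 2) * a * (e z / 4) + of_nat (Suc m) * b * poly (pderiv q) z / 2)"
      "poly (coeff (amb_poly (-1) P) (Suc (Suc m))) z = a * poly q (- z)"
      "poly (coeff (amb_poly (-1) P) (Suc m)) z = of_nat n * a * poly (pderiv q) (- z) / 2 + b * poly q (- z)"
    using z by (simp_all add: c0 c1 c2 k_def)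
  \<comment> \<open>The second derivative of \<open>q\<close> is traded for that of q(z) q(-z),
    because the latter is common to both partners.\<close>
  have dd: "poly (pderiv (pderiv (q * refl_poly q))) z = e z * poly q (- z) - 2 * poly (pderiv q) z * poly (pderiv q) (- z)"
    using z by (simp add: pderiv_mult pderiv_add pderiv_diff pderiv_pcompose pderiv_pCons pderiv_minus poly_pcompose e_def algebra_simps)
  have "coeff (amb_poly 1 P * amb_poly (-1) P) (2 * m + 2) =
     coeff (amb_poly 1 P) m * coeff (amb_poly (-1) P) (m + 2) + coeff (amb_poly 1 P) (m + 1) * coeff (amb_poly (-1) P) (m + 1)
     + coeff (amb_poly 1 P) (m + 2) * coeff (amb_poly (-1) P) m"
    by (rule coeff_mult_drop2) (simp_all add: degree_amb_poly P n)
  then have "k * poly (coeff (amb_poly 1 P * amb_poly (-1) P) (2 * m + 2)) z =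
    k * (k * (of_nat (n choose 2) * a * (e z / 4) + of_nat (Suc m) * b * poly (pderiv q) z / 2) * (a * poly q (- z))
    + - (k * (of_nat n * a * poly (pderiv q) z / 2)) * (of_nat n * a * poly (pderiv q) (- z) / 2 + b * poly q (- z)))"
    by (simp only: add_2_eq_Suc' Suc_eq_plus1[symmetric] poly_add poly_mult p mult_zero_left add_0_right)
  then have "(-1) ^ m * poly (coeff (amb_poly 1 P * amb_poly (-1) P) (2 * m + 2)) z =
    (of_nat (n choose 2) * a * (e z / 4) + of_nat (Suc m) * b * poly (pderiv q) z / 2) * (a * poly q (- z))
    - (of_nat n * a * poly (pderiv q) z / 2) * (of_nat n * a * poly (pderiv q) (- z) / 2 + b * poly q (- z))"
    unfolding alg k_def[symmetric] .
  \<comment> \<open>The terms in q'(z) q'(-z) have the coefficient (n choose 2)/2 - n^2/4 = -n/4,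
    those with a b the coefficient (n - 1)/2 - n/2 = -1/2.\<close>
  also have "\<dots> = a\<^sup>2 * of_nat (n choose 2) / 4 * poly (pderiv (pderiv (q * refl_poly q))) z
      - a\<^sup>2 * of_nat n / 4 * poly (pderiv q) z * poly (pderiv q) (- z)
      - a * b / 2 * poly (pderiv q) z * poly q (- z)"
  proof -
    have "2 * (n choose 2) = n * (m + 1)" unfolding nm by (simp add: choose_two)
    then have "2 * complex_of_nat (n choose 2) = of_nat n * (of_nat m + 1)"
      by (metis of_nat_1 of_nat_add of_nat_mult of_nat_numeral)
    then have C: "complex_of_nat (n choose 2) = of_nat n * (of_nat m + 1) / 2" by (simp add: field_simps)
    have nn: "complex_of_nat n = of_nat m + 2" unfolding nm by simp
    show ?thesis by (simp only: dd C) (simp add: nn field_simps power2_eq_square)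
  qed
  finally show ?thesis .
qed

text \<open>Subtracting the formulas of P and Q at a common zero cancels the second derivative of
  q(z) q(-z). The first derivative of this product at z is q'(z) q(-z) = g'(z) g(-z); division by it
  leaves logarithmic derivatives at -z.\<close>

lemma partner_root_identity:
  fixes P Q :: "complex poly"
  assumes eq: "amb_poly 1 P * amb_poly (-1) P = amb_poly 1 Q * amb_poly (-1) Q"
    and n: "degree P = n" "n \<ge> 2" and lead: "lead_coeff P = lead_coeff Q"
    and z: "poly (heat P) z = 0" "poly (heat Q) z = 0"
    and nz: "poly (pderiv (heat P)) z \<noteq> 0" "poly (heat P) (- z) \<noteq> 0"
  shows "of_nat n / 2 * (poly (pderiv (heat P)) (- z) / poly (heat P) (- z) - poly (pderiv (heat Q)) (- z) / poly (heat Q) (- z))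
    = cnj ((coeff Q (n - 1) - coeff P (n - 1)) / lead_coeff P)"
proof -
  define q g where "q = heat P" and "g = heat Q"
  define a bP bQ where "a = cnj (lead_coeff P)" and "bP = cnj (coeff P (n - 1))" and "bQ = cnj (coeff Q (n - 1))"
  have P: "P \<noteq> 0" using n by auto
  then have a: "a \<noteq> 0" by (simp add: a_def)
  have dQ: "degree Q = n" using amb_poly_product_top(2)[OF eq P] n by simp
  obtain m where m: "n = m + 2" using n by (metis add.commute le_Suc_ex)
  have "smult (a\<^sup>2) (q * refl_poly q) = smult (a\<^sup>2) (g * refl_poly g)"
    using amb_poly_product_top(3)[OF eq P] lead by (simp add: a_def q_def g_def)
  then have M: "q * refl_poly q = g * refl_poly g" using a by (simp add: smult_left_cancel)
  define D where "D = poly (pderiv q) z * poly q (- z)"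
  have D: "D \<noteq> 0" using nz by (simp add: D_def q_def)
  have "poly (pderiv (q * refl_poly q)) z = D"
    using z by (simp add: pderiv_mult poly_pcompose q_def D_def)
  moreover have "poly (pderiv (g * refl_poly g)) z = poly (pderiv g) z * poly g (- z)"
    using z by (simp add: pderiv_mult poly_pcompose g_def)
  ultimately have D': "D = poly (pderiv g) z * poly g (- z)" using M by simp
  have lQ: "coeff Q n = coeff P n" using lead dQ n by simp
  have aP: "cnj (coeff P n) = a" and aQ: "cnj (coeff Q n) = a" using n lQ by (simp_all add: a_def)
  have dP: "degree P = m + 2" and dQ': "degree Q = m + 2" using n m dQ by auto
  have e1: "(-1) ^ m * poly (coeff (amb_poly 1 P * amb_poly (-1) P) (2 * m + 2)) z =
      a\<^sup>2 * of_nat (n choose 2) / 4 * poly (pderiv (pderiv (q * refl_poly q))) z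
         - a\<^sup>2 * of_nat n / 4 * poly (pderiv q) z * poly (pderiv q) (- z) - a * bP / 2 * D"
    using amb_poly_product_second[OF dP z(1)]
    by (simp only: n(1) q_def[symmetric] aP bP_def[symmetric] D_def mult.assoc)
  have e2: "(-1) ^ m * poly (coeff (amb_poly 1 Q * amb_poly (-1) Q) (2 * m + 2)) z =
      a\<^sup>2 * of_nat (n choose 2) / 4 * poly (pderiv (pderiv (q * refl_poly q))) z
         - a\<^sup>2 * of_nat n / 4 * poly (pderiv g) z * poly (pderiv g) (- z) - a * bQ / 2 * D"
    using amb_poly_product_second[OF dQ' z(2)]
    by (simp only: dQ g_def[symmetric] aQ bQ_def[symmetric] D' M mult.assoc)
  have "a\<^sup>2 * of_nat n / 4 * poly (pderiv q) z * poly (pderiv q) (- z) + a * bP / 2 * D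
     = a\<^sup>2 * of_nat n / 4 * poly (pderiv g) z * poly (pderiv g) (- z) + a * bQ / 2 * D"
  proof -
    have aux: "T - X - Y = T - X' - Y' \<Longrightarrow> X + Y = X' + Y'" for T X Y X' Y' :: complex
      by algebra
    show ?thesis
    proof (rule aux)
      show "a\<^sup>2 * of_nat (n choose 2) / 4 * poly (pderiv (pderiv (q * refl_poly q))) z
         - a\<^sup>2 * of_nat n / 4 * poly (pderiv q) z * poly (pderiv q) (- z) - a * bP / 2 * D =
        a\<^sup>2 * of_nat (n choose 2) / 4 * poly (pderiv (pderiv (q * refl_poly q))) z
         - a\<^sup>2 * of_nat n / 4 * poly (pderiv g) z * poly (pderiv g) (- z) - a * bQ / 2 * D"
        using e1 e2 eq by simp
    qed
  qed
  then have "a * (of_nat n / 2 * (poly (pderiv q) z * poly (pderiv q) (- z) - poly (pderiv g) z * poly (pderiv g) (- z)) * (a / 2)) = a * ((bQ - bP) * D * (1 / 2))"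
    by (simp add: algebra_simps power2_eq_square)
  then have *: "of_nat n / 2 * (poly (pderiv q) z * poly (pderiv q) (- z) - poly (pderiv g) z * poly (pderiv g) (- z)) * a = (bQ - bP) * D"
    unfolding mult_left_cancel[OF a] by (simp add: mult.commute[of _ a])
  have "poly (pderiv q) z * poly (pderiv q) (- z) = D * (poly (pderiv q) (- z) / poly q (- z))"
    using D by (simp add: D_def)
  moreover have "poly (pderiv g) z * poly (pderiv g) (- z) = D * (poly (pderiv g) (- z) / poly g (- z))"
    using D unfolding D' by simp
  ultimately have "D * (of_nat n / 2 * (poly (pderiv q) (- z) / poly q (- z) - poly (pderiv g) (- z) / poly g (- z))) * a = D * (bQ - bP)"
    using * by (simp add: algebra_simps)
  then have "of_nat n / 2 * (poly (pderiv q) (- z) / poly q (- z) - poly (pderiv g) (- z) / poly g (- z)) = (bQ - bP) / a"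
    unfolding mult.assoc mult_left_cancel[OF D] using a by (simp add: nonzero_eq_divide_eq mult.assoc)
  then show ?thesis
    by (simp only: q_def g_def a_def bQ_def bP_def complex_cnj_divide complex_cnj_diff)
qed

section \<open>Reconstruction of a polynomial from its ambiguity function\<close>

lemma gint_refl: "gint 0 (refl_poly S) = gint 0 S"
  unfolding gint_def
  by (subst lborel_integral_real_affine[where c = "-1" and t = 0]) (simp_all add: poly_pcompose)

lemma refl_refl [simp]: "refl_poly (refl_poly P) = P"
  by (rule poly_ext) (simp add: poly_pcompose)

lemma refl_pcompose: "pcompose (refl_poly P) [:z, 1:] = refl_poly (pcompose P [:- z, 1:])"
  by (rule poly_ext) (simp add: poly_pcompose)

lemma heat_refl: "heat (refl_poly P) = refl_poly (heat P)"
  by (rule poly_ext) (simp add: poly_pcompose poly_heat refl_pcompose gint_refl)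

lemma cnj_poly_refl: "cnj_poly (refl_poly P) = refl_poly (cnj_poly P)"
  by (rule poly_ext) (simp add: poly_pcompose poly_cnj_poly)

lemma eval2_ext: assumes "\<And>z w. eval2 F z w = eval2 G z w" shows "F = G"
proof -
  have "F - G = 0" by (rule eval2_zero_imp_zero) (simp add: assms)
  then show ?thesis by simp
qed

text \<open>The substitution t -> -t in the integral. It swaps the two factors of the squared
  modulus, so a partner may be replaced by its reflection.\<close>

lemma amb_poly_refl: "amb_poly s (refl_poly P) = amb_poly (- s) P"
proof (rule eval2_ext)
  fix z w
  have "pcompose (refl_poly P) [:s * z, 1:] * pcompose (cnj_poly (refl_poly P)) [:- (s * w), 1:] =
     refl_poly (pcompose P [:- s * z, 1:] * pcompose (cnj_poly P) [:- (- s * w), 1:])"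
    unfolding cnj_poly_refl refl_pcompose by (simp add: pcompose_mult)
  then show "eval2 (amb_poly s (refl_poly P)) z w = eval2 (amb_poly (- s) P) z w"
    by (simp add: eval2_amb_poly gint_refl)
qed

lemma amb_poly_smult:
  assumes "norm c = 1" shows "amb_poly s (smult c P) = amb_poly s P"
proof (rule eval2_ext)
  fix z w
  have "cnj_poly (smult c P) = smult (cnj c) (cnj_poly P)"
    by (rule poly_eqI) (simp add: coeff_map_poly)
  moreover have "c * cnj c = 1" using assms by (metis complex_norm_square of_real_1 one_power2)
  ultimately show "eval2 (amb_poly s (smult c P)) z w = eval2 (amb_poly s P) z w"
    by (simp add: eval2_amb_poly pcompose_smult gint_smult mult.commute[of "cnj c"])
qed

lemma coeff_prod_roots:
  fixes S :: "complex set"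
  assumes "finite S"
  shows "degree (\<Prod>z\<in>S. [:- z, 1:]) = card S \<and> coeff (\<Prod>z\<in>S. [:- z, 1:]) (card S) = 1 \<and>
    (S \<noteq> {} \<longrightarrow> coeff (\<Prod>z\<in>S. [:- z, 1:]) (card S - 1) = - \<Sum>S)"
  using assms
proof (induction S)
  case (insert x S)
  have nz: "(\<Prod>z\<in>S. [:- z, 1:]) \<noteq> 0" using insert by (auto simp: prod_zero_iff)
  have d: "degree ([:- x, 1:] * (\<Prod>z\<in>S. [:- z, 1:])) = Suc (card S)"
    using nz insert by (subst degree_mult_eq) auto
  have "coeff (\<Prod>z\<in>S. [:- z, 1:]) (Suc (card S)) = 0"
    using insert by (intro coeff_eq_0) auto
  then show ?case using insert d
    by (cases "S = {}") (auto simp: coeff_pCons card_gt_0_iff gr0_conv_Suc split: nat.splits)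
qed simp

lemma logarithmic_derivative:
  fixes S :: "complex set"
  assumes "finite S" "p = smult c (\<Prod>z\<in>S. [:- z, 1:])" "c \<noteq> 0" "x \<notin> S"
  shows "poly (pderiv p) x / poly p x = (\<Sum>z\<in>S. 1 / (x - z))"
proof -
  have "poly (pderiv (\<Prod>z\<in>S. [:- z, 1:])) x / poly (\<Prod>z\<in>S. [:- z, 1:]) x = (\<Sum>z\<in>S. 1 / (x - z))"
    using assms(1,4)
  proof (induction S)
    case (insert y S)
    have nz: "poly (\<Prod>z\<in>S. [:- z, 1:]) x \<noteq> 0" "x - y \<noteq> 0" using insert by (auto simp: poly_prod)
    have d1: "poly (pderiv ([:- y, 1:] * p)) x = (x - y) * poly (pderiv p) x + poly p x" for p
      by (simp only: pderiv_mult poly_add poly_mult) (simp add: pderiv_pCons)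
    have d2: "poly ([:- y, 1:] * p) x = (x - y) * poly p x" for p
      by (simp only: poly_mult) simp
    have "x \<notin> S" using insert by auto
    then show ?case
      unfolding prod.insert[OF insert(1,2)] sum.insert[OF insert(1,2)] d1 d2
      using insert nz by (simp add: add_divide_distrib)
  qed simp
  then show ?thesis using assms by (simp add: pderiv_smult)
qed

text \<open>
  Cleared denominators of \<open>cnj (\<Sum>i<m. r i) = n / 2 * (\<Sum>i<m. r i / (z\<^sup>2 - (r i)\<^sup>2))\<close>. This is what the second coefficient
  of the ambiguity polynomials says at a common zero \<open>z\<close> if the partner arises by changing the sign of the
  zeros \<open>r 0, \<dots>, r (m - 1)\<close>. The cleared form keeps the condition closed.
\<close>

definition res_den :: "nat \<Rightarrow> cseq \<Rightarrow> complex \<Rightarrow> complex" where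
  "res_den m r z = (\<Prod>i<m. z\<^sup>2 - (r i)\<^sup>2)"

definition res_num :: "nat \<Rightarrow> cseq \<Rightarrow> complex \<Rightarrow> complex" where
  "res_num m r z = (\<Sum>i<m. r i * (\<Prod>j\<in>{..<m} - {i}. z\<^sup>2 - (r j)\<^sup>2))"

definition gen_cond :: "nat \<Rightarrow> nat \<Rightarrow> cseq \<Rightarrow> complex \<Rightarrow> bool" where
  "gen_cond n m r z \<longleftrightarrow> cnj (\<Sum>i<m. r i) * res_den m r z =
     of_nat n / 2 * res_num m r z"

definition generic :: "nat \<Rightarrow> complex poly \<Rightarrow> bool" where
  "generic n q \<longleftrightarrow> degree q = n \<and> q \<noteq> 0 \<and>
    (\<forall>z. poly q z = 0 \<longrightarrow> poly (pderiv q) z \<noteq> 0 \<and> poly q (- z) \<noteq> 0) \<and>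
    (\<forall>m r. 0 < m \<longrightarrow> 2 * m \<le> n \<longrightarrow> q = smult (lead_coeff q) (\<Prod>i<n. [:- r i, 1:]) \<longrightarrow>
      (\<exists>k\<in>{m..<n}. \<not> gen_cond n m r (r k)))"

lemma simple_roots_decompose:
  fixes q :: "complex poly"
  assumes "q \<noteq> 0" "\<And>z. poly q z = 0 \<Longrightarrow> poly (pderiv q) z \<noteq> 0"
  shows "q = smult (lead_coeff q) (\<Prod>z | poly q z = 0. [:- z, 1:])"
    and "card {z. poly q z = 0} = degree q"
proof -
  have "rsquarefree q" using assms by (auto simp: rsquarefree_roots)
  then show *: "q = smult (lead_coeff q) (\<Prod>z | poly q z = 0. [:- z, 1:])"
    by (rule complex_poly_decompose_rsquarefree[symmetric])
  have "degree q = degree (\<Prod>z | poly q z = 0. [:- z, 1:])"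
    using arg_cong[OF *, of degree] assms(1) by (metis degree_smult_eq leading_coeff_0_iff)
  then show "card {z. poly q z = 0} = degree q"
    using coeff_prod_roots[OF poly_roots_finite[OF assms(1)]] by simp
qed

text \<open>Vieta for \<open>heat P\<close>, whose two top coefficients are those of P times sqrt
  pi.\<close>

lemma sum_roots_heat:
  fixes P :: "complex poly"
  assumes "heat P \<noteq> 0" "\<And>z. poly (heat P) z = 0 \<Longrightarrow> poly (pderiv (heat P)) z \<noteq> 0" "degree P > 0"
  shows "coeff P (degree P - 1) / lead_coeff P = - \<Sum>{z. poly (heat P) z = 0}"
proof -
  define Z where "Z = {z. poly (heat P) z = 0}"
  note dec = simple_roots_decompose[OF assms(1,2), folded Z_def]
  have "finite Z" unfolding Z_def by (rule poly_roots_finite[OF assms(1)])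
  moreover have card: "card Z = degree P" using dec(2) by simp
  then have "Z \<noteq> {}" using assms(3) by auto
  ultimately have e: "coeff (smult (lead_coeff (heat P)) (\<Prod>z\<in>Z. [:- z, 1:])) (degree P - 1) = lead_coeff (heat P) * (- \<Sum>Z)"
    using coeff_prod_roots[of Z] card by simp
  have "coeff (heat P) (degree P - 1) = coeff (smult (lead_coeff (heat P)) (\<Prod>z\<in>Z. [:- z, 1:])) (degree P - 1)"
    using dec(1) by (rule arg_cong)
  then have "coeff (heat P) (degree P - 1) = lead_coeff (heat P) * (- \<Sum>Z)"
    unfolding e .
  moreover have "coeff (heat P) (degree P - 1) = of_real (sqrt pi) * coeff P (degree P - 1)"
    using coeff_heat_aux[of P "degree P"] assms(3) by simp
  ultimately have "of_real (sqrt pi) * coeff P (degree P - 1) = of_real (sqrt pi) * (lead_coeff P * (- \<Sum>Z))"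
    by (simp only: lead_coeff_heat mult.assoc)
  then have "coeff P (degree P - 1) = lead_coeff P * (- \<Sum>Z)"
    by (rule mult_left_cancel[THEN iffD1, rotated]) simp
  moreover have "P \<noteq> 0" using assms(3) by auto
  ultimately show ?thesis by (simp add: Z_def)
qed

lemma gen_cond_set:
  assumes b: "bij_betw r {..<m} N" and z: "\<And>x. x \<in> N \<Longrightarrow> z\<^sup>2 - x\<^sup>2 \<noteq> 0"
    and id: "cnj (\<Sum>N) = of_nat n / 2 * (\<Sum>x\<in>N. x / (z\<^sup>2 - x\<^sup>2))"
  shows "gen_cond n m r z"
proof -
  have z': "z\<^sup>2 - (r i)\<^sup>2 \<noteq> 0" if "i < m" for i using b z that by (auto simp: bij_betw_def)
  have s1: "\<Sum>N = (\<Sum>i<m. r i)" using sum.reindex_bij_betw[OF b, of "\<lambda>x. x"] by simp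
  have s2: "(\<Sum>x\<in>N. x / (z\<^sup>2 - x\<^sup>2)) = (\<Sum>i<m. r i / (z\<^sup>2 - (r i)\<^sup>2))"
    using sum.reindex_bij_betw[OF b, of "\<lambda>x. x / (z\<^sup>2 - x\<^sup>2)"] by simp
  have eq: "(\<Sum>i<m. r i / (z\<^sup>2 - (r i)\<^sup>2)) * res_den m r z = res_num m r z"
    unfolding res_num_def sum_distrib_right
  proof (intro sum.cong refl)
    fix i assume i: "i \<in> {..<m}"
    have "res_den m r z = (z\<^sup>2 - (r i)\<^sup>2) * (\<Prod>j\<in>{..<m} - {i}. z\<^sup>2 - (r j)\<^sup>2)"
      unfolding res_den_def using i by (intro prod.remove) auto
    then show "r i / (z\<^sup>2 - (r i)\<^sup>2) * res_den m r z = r i * (\<Prod>j\<in>{..<m} - {i}. z\<^sup>2 - (r j)\<^sup>2)"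
      using z' i by simp
  qed
  then show ?thesis
    unfolding gen_cond_def using id by (simp only: s1 s2 mult.assoc eq)
qed

text \<open>\<open>Z - Y\<close> consists of the zeros whose sign was changed. If it is not empty,
  \<open>generic\<close> provides an unchanged zero at which the resonance identity fails, while
  \<open>partner_root_identity\<close> proves it there.\<close>

lemma partner_roots:
  fixes P Q :: "complex poly"
  defines "Z \<equiv> {z. poly (heat P) z = 0}" and "Y \<equiv> {z. poly (heat Q) z = 0}"
  assumes gen: "generic n (heat P)"
    and eq: "amb_poly 1 P * amb_poly (-1) P = amb_poly 1 Q * amb_poly (-1) Q"
    and lead: "lead_coeff P = lead_coeff Q"
    and small: "2 * card (Z - Y) \<le> n"
  shows "P = Q"
proof -
  define q g where "q = heat P" and "g = heat Q"
  define N where "N = Z - Y"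
  have dq: "degree q = n" "degree P = n" and q0: "q \<noteq> 0" and P: "P \<noteq> 0"
    using gen by (auto simp: generic_def q_def)
  have qs: "poly q z = 0 \<Longrightarrow> poly (pderiv q) z \<noteq> 0" "poly q z = 0 \<Longrightarrow> poly q (- z) \<noteq> 0" for z
    using gen by (auto simp: generic_def q_def)
  have dQ: "degree Q = n" and Q: "Q \<noteq> 0" using amb_poly_product_top(1,2)[OF eq P] dq by auto
  have g0: "g \<noteq> 0" using Q heat_inj[of Q 0] by (auto simp: g_def)
  have dg: "degree g = n" by (simp add: g_def dQ)
  have lead': "lead_coeff q = lead_coeff g"
    using lead by (simp only: q_def g_def lead_coeff_heat)
  have "smult ((cnj (lead_coeff P))\<^sup>2) (q * refl_poly q) = smult ((cnj (lead_coeff P))\<^sup>2) (g * refl_poly g)"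
    using amb_poly_product_top(3)[OF eq P] lead by (simp add: q_def g_def)
  then have M: "q * refl_poly q = g * refl_poly g"
    by (rule smult_left_cancel[THEN iffD1, rotated]) (use P in simp)
  have M0: "poly q z * poly q (- z) = poly g z * poly g (- z)" for z
    using arg_cong[OF M, of "\<lambda>p. poly p z"] by (simp add: poly_pcompose)
  have M1: "poly (pderiv q) z * poly q (- z) - poly q z * poly (pderiv q) (- z) =
      poly (pderiv g) z * poly g (- z) - poly g z * poly (pderiv g) (- z)" for z
    using arg_cong[OF M, of "\<lambda>p. poly (pderiv p) z"]
    by (simp add: pderiv_mult pderiv_pcompose pderiv_pCons poly_pcompose algebra_simps)
  \<comment> \<open>Simple zeros and the absence of opposite zeros pass from \<open>q\<close> to
    \<open>g\<close>: both are encoded in the fact that the derivative of the common product q(z)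
    q(-z) does not vanish at its zeros.\<close>
  have gs: "poly (pderiv g) z \<noteq> 0 \<and> poly g (- z) \<noteq> 0" if "poly g z = 0" for z
  proof -
    have "poly q z = 0 \<or> poly q (- z) = 0" using M0[of z] that by simp
    moreover have "poly q (- z) = 0 \<Longrightarrow> poly (pderiv q) (- z) \<noteq> 0 \<and> poly q z \<noteq> 0" using qs[of "- z"] by simp
    ultimately have "poly (pderiv q) z * poly q (- z) - poly q z * poly (pderiv q) (- z) \<noteq> 0"
      using qs[of z] by auto
    then show ?thesis unfolding M1 using that by auto
  qed
  have fin: "finite Z" "finite Y" using poly_roots_finite[OF q0] poly_roots_finite[OF g0] by (auto simp: Z_def Y_def q_def g_def)
  have Zq: "z \<in> Z \<longleftrightarrow> poly q z = 0" and Yg: "z \<in> Y \<longleftrightarrow> poly g z = 0" for z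
    by (auto simp: Z_def Y_def q_def g_def)
  have qdec: "q = smult (lead_coeff q) (\<Prod>z\<in>Z. [:- z, 1:])" "card Z = n"
    unfolding Z_def q_def[symmetric] dq(1)[symmetric] by (intro simple_roots_decompose q0 qs(1); assumption)+
  have gdec: "g = smult (lead_coeff g) (\<Prod>z\<in>Y. [:- z, 1:])" "card Y = n"
    unfolding Y_def g_def[symmetric] dg[symmetric] by (intro simple_roots_decompose g0 gs[THEN conjunct1]; assumption)+
  \<comment> \<open>By q(z) q(-z) = g(z) g(-z), a zero of \<open>g\<close> is a zero of
    \<open>q\<close> or the negative of one, and where z is lost, -z is gained.\<close>
  have YN: "Y = (Z - N) \<union> uminus ` N"
  proof -
    have 1: "z \<in> Z - N \<or> - z \<in> N" if "z \<in> Y" for z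
      using M0[of z] gs[of z] that by (auto simp: N_def Zq Yg)
    have 2: "- z \<in> Y" if "z \<in> N" for z
      using M0[of z] that by (auto simp: N_def Zq Yg)
    show ?thesis
    proof (intro set_eqI iffI)
      fix z assume "z \<in> Y"
      with 1[OF this] show "z \<in> (Z - N) \<union> uminus ` N"
        by (auto intro: image_eqI[of z uminus "- z"])
    next
      fix z assume "z \<in> (Z - N) \<union> uminus ` N"
      then show "z \<in> Y" using 2 by (auto simp: N_def)
    qed
  qed
  show "P = Q"
  proof (cases "N = {}")
    case True
    then have "Z = Y" using YN by auto
    then have "q = g" by (metis qdec(1) gdec(1) lead')
    then show ?thesis using heat_inj by (simp add: q_def g_def)
  next
    case False
    define m where "m = card N"
    have finN: "finite N" using fin by (simp add: N_def)
    have m: "0 < m" "2 * m \<le> n" using False finN small by (auto simp: m_def N_def card_gt_0_iff)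
    have "card (Z - N) = n - m" using qdec(2) finN by (subst card_Diff_subset) (auto simp: N_def m_def)
    obtain h1 where h1: "bij_betw h1 {..<m} N"
      using ex_bij_betw_nat_finite[OF finN] by (auto simp: m_def atLeast0LessThan)
    have "\<exists>h2. bij_betw h2 {m..<n} (Z - N)"
      by (rule finite_same_card_bij) (use fin \<open>card (Z - N) = n - m\<close> in auto)
    then obtain h2 where h2: "bij_betw h2 {m..<n} (Z - N)" ..
    \<comment> \<open>The changed zeros are numbered first, in accordance with
      \<open>generic\<close>.\<close>
    define r where "r i = (if i < m then h1 i else h2 i)" for i
    have b1: "bij_betw r {..<m} N"
      by (rule bij_betw_cong[THEN iffD1, OF _ h1]) (simp add: r_def)
    have b2: "bij_betw r {m..<n} (Z - N)"
      by (rule bij_betw_cong[THEN iffD1, OF _ h2]) (simp add: r_def)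
    have "bij_betw r ({..<m} \<union> {m..<n}) (N \<union> (Z - N))"
      using b1 b2 by (rule bij_betw_combine) auto
    moreover have "{..<m} \<union> {m..<n} = {..<n}" "N \<union> (Z - N) = Z" using m by (auto simp: N_def)
    ultimately have b: "bij_betw r {..<n} Z" by simp
    have "q = smult (lead_coeff q) (\<Prod>i<n. [:- r i, 1:])"
      unfolding prod.reindex_bij_betw[OF b, of "\<lambda>z. [:- z, 1:]"] by (rule qdec(1))
    then obtain k where k: "k \<in> {m..<n}" "\<not> gen_cond n m r (r k)"
      using gen m unfolding generic_def q_def by blast
    define z where "z = r k"
    have z: "z \<in> Z - N" using b2 k by (auto simp: z_def bij_betw_def)
    then have zY: "z \<in> Y" using YN by auto
    have n2: "n \<ge> 2" using m by auto
    have nz: "- z \<notin> Z" "- z \<notin> Y" using z zY qs[of z] gs[of z] by (auto simp: Zq Yg)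
    have disj: "(Z - N) \<inter> uminus ` N = {}"
    proof (intro equalityI subsetI)
      fix y assume "y \<in> (Z - N) \<inter> uminus ` N"
      then obtain x where "y \<in> Z" "x \<in> Z" "y = - x" by (auto simp: N_def)
      then show "y \<in> {}" using qs(2)[of x] by (auto simp: Zq)
    qed simp
    have zx: "z - x \<noteq> 0" "z + x \<noteq> 0" if "x \<in> N" for x
    proof -
      show "z - x \<noteq> 0" using z that by auto
      show "z + x \<noteq> 0" using that nz by (auto simp: N_def add_eq_0_iff)
    qed
    \<comment> \<open>Unchanged zeros cancel in the difference of the logarithmic derivatives; a
      changed zero y contributes 1/(-z-y) - 1/(-z+y) = 2 y/(z^2-y^2).\<close>
    have "(\<Sum>y\<in>Z. 1 / (- z - y)) - (\<Sum>y\<in>Y. 1 / (- z - y)) = (\<Sum>y\<in>N. 1 / (- z - y)) - (\<Sum>y\<in>uminus ` N. 1 / (- z - y))"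
    proof -
      have "(\<Sum>y\<in>Z. 1 / (- z - y)) = (\<Sum>y\<in>Z - N. 1 / (- z - y)) + (\<Sum>y\<in>N. 1 / (- z - y))"
        using fin by (intro sum.subset_diff) (auto simp: N_def)
      moreover have "(\<Sum>y\<in>Y. 1 / (- z - y)) = (\<Sum>y\<in>Z - N. 1 / (- z - y)) + (\<Sum>y\<in>uminus ` N. 1 / (- z - y))"
        unfolding YN using fin finN disj by (intro sum.union_disjoint) auto
      ultimately show ?thesis by simp
    qed
    also have "(\<Sum>y\<in>uminus ` N. 1 / (- z - y)) = (\<Sum>y\<in>N. 1 / (- z + y))"
      by (subst sum.reindex) (auto simp: inj_on_def)
    also have "(\<Sum>y\<in>N. 1 / (- z - y)) - (\<Sum>y\<in>N. 1 / (- z + y)) = (\<Sum>y\<in>N. 2 * (y / (z\<^sup>2 - y\<^sup>2)))"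
      unfolding sum_subtractf[symmetric]
    proof (intro sum.cong refl)
      fix x assume "x \<in> N"
      note zx = zx[OF this]
      have "- z - x \<noteq> 0" "- z + x \<noteq> 0" "z\<^sup>2 - x\<^sup>2 \<noteq> 0"
        using zx by (auto simp: power2_eq_square square_diff_square_factored diff_eq_eq eq_neg_iff_add_eq_0 neg_eq_iff_add_eq_0)
      then show "1 / (- z - x) - 1 / (- z + x) = 2 * (x / (z\<^sup>2 - x\<^sup>2))"
        by (simp add: divide_simps) (simp add: power2_eq_square algebra_simps)
    qed
    finally have S1: "(\<Sum>y\<in>Z. 1 / (- z - y)) - (\<Sum>y\<in>Y. 1 / (- z - y)) = 2 * (\<Sum>y\<in>N. y / (z\<^sup>2 - y\<^sup>2))"
      by (simp add: sum_distrib_left)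
    have ld: "lead_coeff q \<noteq> 0" "lead_coeff g \<noteq> 0" using q0 g0 by auto
    have lq: "poly (pderiv q) (- z) / poly q (- z) = (\<Sum>y\<in>Z. 1 / (- z - y))"
      using logarithmic_derivative[OF fin(1) qdec(1) ld(1) nz(1)] .
    have lg: "poly (pderiv g) (- z) / poly g (- z) = (\<Sum>y\<in>Y. 1 / (- z - y))"
      using logarithmic_derivative[OF fin(2) gdec(1) ld(2) nz(2)] .
    have id: "of_nat n / 2 * (2 * (\<Sum>y\<in>N. y / (z\<^sup>2 - y\<^sup>2))) = cnj ((coeff Q (n - 1) - coeff P (n - 1)) / lead_coeff P)"
      using partner_root_identity[OF eq dq(2) n2 lead, of z] z zY qs[of z]
      by (simp add: q_def[symmetric] g_def[symmetric] lq lg S1 Zq Yg)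
    have sP: "coeff P (n - 1) / lead_coeff P = - \<Sum>Z"
      using sum_roots_heat[of P] gs qs(1) q0 dq n2 by (simp add: q_def Z_def)
    have sQ: "coeff Q (n - 1) / lead_coeff P = - \<Sum>Y"
      using sum_roots_heat[of Q] gs g0 dQ n2 lead by (simp add: g_def Y_def)
    have "\<Sum>Y = \<Sum>(Z - N) + \<Sum>(uminus ` N)"
      unfolding YN using fin finN disj by (intro sum.union_disjoint) auto
    moreover have "\<Sum>(uminus ` N) = - \<Sum>N"
      by (subst sum.reindex) (auto simp: inj_on_def sum_negf)
    moreover have "\<Sum>Z = \<Sum>(Z - N) + \<Sum>N"
      using fin by (intro sum.subset_diff) (auto simp: N_def)
    ultimately have "(coeff Q (n - 1) - coeff P (n - 1)) / lead_coeff P = 2 * \<Sum>N"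
      unfolding diff_divide_distrib sP sQ by simp
    then have "cnj (\<Sum>N) = of_nat n / 2 * (\<Sum>y\<in>N. y / (z\<^sup>2 - y\<^sup>2))"
      using id by simp
    then have "gen_cond n m r z"
      by (rule gen_cond_set[OF b1, rotated]) (use zx in \<open>auto simp: power2_eq_square square_diff_square_factored\<close>)
    with k show ?thesis by (simp add: z_def)
  qed
qed

text \<open>Of Q and its reflection, one keeps at least half of the zeros of \<open>heat P\<close>:
  by q(z) q(-z) = g(z) g(-z), a zero missing from one is present in the other. A constant of modulus
  one first equalizes the leading coefficients.\<close>

theorem generic_partner:
  fixes P Q :: "complex poly"
  assumes gen: "generic n (heat P)"
    and eq: "amb_poly 1 P * amb_poly (-1) P = amb_poly 1 Q * amb_poly (-1) Q"
  shows "\<exists>c. norm c = 1 \<and> (Q = smult c P \<or> Q = smult c (refl_poly P))"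
proof -
  have P: "P \<noteq> 0" and dP: "degree P = n" using gen by (auto simp: generic_def)
  have Q: "Q \<noteq> 0" and dQ: "degree Q = n" using amb_poly_product_top(1,2)[OF eq P] dP by auto
  define c where "c = lead_coeff P / lead_coeff Q"
  have c0: "c \<noteq> 0" using P Q by (simp add: c_def)
  have hP: "coeff (heat P) n = of_real (sqrt pi) * coeff P n" and hQ: "coeff (heat Q) n = of_real (sqrt pi) * coeff Q n"
    using lead_coeff_heat[of P] lead_coeff_heat[of Q] dP dQ by auto
  have "lead_coeff (smult ((cnj (lead_coeff P))\<^sup>2) (heat P * refl_poly (heat P))) =
     lead_coeff (smult ((cnj (lead_coeff Q))\<^sup>2) (heat Q * refl_poly (heat Q)))"
    using amb_poly_product_top(3)[OF eq P] by simp
  then have "(cnj (lead_coeff P) * lead_coeff P)\<^sup>2 = (cnj (lead_coeff Q) * lead_coeff Q)\<^sup>2"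
    unfolding lead_coeff_smult lead_coeff_mult
    by (simp add: dP dQ power2_eq_square lead_coeff_comp hP hQ mult_ac)
  then have "norm ((cnj (lead_coeff P) * lead_coeff P)\<^sup>2) = norm ((cnj (lead_coeff Q) * lead_coeff Q)\<^sup>2)"
    by simp
  then have "(norm (lead_coeff P)) ^ 4 = (norm (lead_coeff Q)) ^ 4"
    by (simp add: norm_mult norm_power power2_eq_square power4_eq_xxxx)
  then have "norm (lead_coeff P) = norm (lead_coeff Q)"
    by (metis norm_ge_zero power_eq_imp_eq_base zero_less_numeral)
  then have nc: "norm c = 1" using Q by (simp add: c_def norm_divide)
  define Q1 where "Q1 = smult c Q"
  \<comment> \<open>The sign restores the leading coefficient, which reflection multiplies by
    (-1)^n.\<close>
  define Q2 where "Q2 = smult ((-1) ^ n) (refl_poly Q1)"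
  have lQ1: "lead_coeff P = lead_coeff Q1" using Q by (simp add: Q1_def c_def)
  have e1: "amb_poly 1 P * amb_poly (-1) P = amb_poly 1 Q1 * amb_poly (-1) Q1"
    using eq nc by (simp add: Q1_def amb_poly_smult)
  have nn: "norm ((-1) ^ n :: complex) = 1" by (simp add: norm_power)
  have e2: "amb_poly 1 P * amb_poly (-1) P = amb_poly 1 Q2 * amb_poly (-1) Q2"
    using e1 nn by (simp add: Q2_def amb_poly_smult amb_poly_refl mult.commute)
  have dQ1: "degree Q1 = n" using dQ c0 by (simp add: Q1_def)
  have lQ2: "lead_coeff P = lead_coeff Q2"
    unfolding Q2_def lead_coeff_smult by (subst lead_coeff_comp) (auto simp: dQ1 lQ1 simp flip: power_mult_distrib)
  let ?Z = "{z. poly (heat P) z = 0}" and ?Y = "{z. poly (heat Q1) z = 0}" and ?X = "{z. poly (heat Q2) z = 0}"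
  have hQ: "poly (heat Q2) z = (-1) ^ n * poly (heat Q1) (- z)" for z
    by (simp add: Q2_def heat_smult heat_refl poly_pcompose)
  have q0: "heat P \<noteq> 0" and qs: "\<And>z. poly (heat P) z = 0 \<Longrightarrow> poly (pderiv (heat P)) z \<noteq> 0 \<and> poly (heat P) (- z) \<noteq> 0"
    using gen by (auto simp: generic_def)
  have fin: "finite ?Z" using poly_roots_finite[OF q0] .
  have card: "card ?Z = n" using simple_roots_decompose(2)[OF q0] qs dP by auto
  have Z: "?Z - ?X \<subseteq> ?Z - (?Z - ?Y)"
  proof (rule subsetI, rule ccontr)
    fix z assume "z \<in> ?Z - ?X" "z \<notin> ?Z - (?Z - ?Y)"
    then have z: "poly (heat P) z = 0" "poly (heat Q2) z \<noteq> 0" "poly (heat Q1) z \<noteq> 0" by auto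
    have P': "heat P * refl_poly (heat P) = heat Q1 * refl_poly (heat Q1)"
      using amb_poly_product_top(3)[OF e1 P] unfolding lQ1[symmetric]
      by (rule smult_left_cancel[THEN iffD1, rotated]) (use P in simp)
    have "poly (heat P) z * poly (heat P) (- z) = poly (heat Q1) z * poly (heat Q1) (- z)"
      using arg_cong[OF P', of "\<lambda>p. poly p z"] by (simp add: poly_pcompose)
    then show False using z hQ[of z] by simp
  qed
  have "P = Q1 \<or> P = Q2"
  proof (cases "2 * card (?Z - ?Y) \<le> n")
    case True
    then show ?thesis using partner_roots[OF gen e1 lQ1] by simp
  next
    case False
    have "card (?Z - ?X) \<le> card (?Z - (?Z - ?Y))" using Z fin by (intro card_mono) auto
    also have "\<dots> = n - card (?Z - ?Y)" using fin card by (subst card_Diff_subset) auto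
    finally have "2 * card (?Z - ?X) \<le> n" using False by linarith
    then show ?thesis using partner_roots[OF gen e2 lQ2] by simp
  qed
  then show ?thesis
  proof
    assume "P = Q1"
    then have "Q = smult (1 / c) P" using c0 by (simp add: Q1_def)
    then show ?thesis using nc by (intro exI[of _ "1 / c"]) (auto simp: norm_divide)
  next
    assume "P = Q2"
    then have "refl_poly P = smult ((-1) ^ n * c) Q" by (simp add: Q2_def Q1_def pcompose_smult)
    then have "Q = smult (1 / ((-1) ^ n * c)) (refl_poly P)" using c0 by simp
    then show ?thesis using nc nn by (intro exI[of _ "1 / ((-1) ^ n * c)"]) (auto simp: norm_divide norm_mult)
  qed
qed

section \<open>Closed null sets in the space of coefficients\<close>

abbreviation cborel :: "nat \<Rightarrow> cseq measure" where
  "cborel n \<equiv> (\<Pi>\<^sub>M j\<in>{..n}. lborel)"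

interpretation cps: product_sigma_finite "\<lambda>_::nat. lborel :: complex measure"
  by standard

text \<open>Coefficient vectors are constantly \<open>undefined\<close> outside the index set, so
  they embed measurably into the space of all sequences. Bad sets can thus be described as Borel
  sets of sequences.\<close>

lemma id_measurable_PiM:
  "(\<lambda>p. p) \<in> measurable (\<Pi>\<^sub>M j\<in>I. (lborel :: complex measure)) (borel :: cseq measure)"
proof -
  have "(\<lambda>p i. p i) \<in> measurable (\<Pi>\<^sub>M j\<in>I. (lborel :: complex measure)) (Pi\<^sub>M UNIV (\<lambda>_::nat. borel))"
  proof (rule measurable_PiM_single')
    fix i :: nat
    show "(\<lambda>p. p i) \<in> (\<Pi>\<^sub>M j\<in>I. (lborel :: complex measure)) \<rightarrow>\<^sub>M borel"
    proof (cases "i \<in> I")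
      case True
      then have "(\<lambda>p. p i) \<in> (\<Pi>\<^sub>M j\<in>I. (lborel :: complex measure)) \<rightarrow>\<^sub>M lborel" by (rule measurable_component_singleton)
      then show ?thesis by simp
    next
      case False
      show ?thesis
        by (rule measurable_cong[THEN iffD2, of _ _ "\<lambda>_. undefined"])
           (use False in \<open>auto simp: space_PiM PiE_def extensional_def\<close>)
    qed
  qed auto
  then show ?thesis unfolding measurable_cong_sets[OF refl sets_PiM_equal_borel] .
qed

lemma continuous_on_upd: "continuous_on UNIV (\<lambda>y. x(k := y))" for x :: "nat \<Rightarrow> complex"
proof (rule continuous_on_coordinatewise_then_product)
  show "continuous_on UNIV (\<lambda>y. (x(k := y)) i)" for i
    by (cases "i = k") (auto intro!: continuous_intros)
qed

lemma continuous_on_shear: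
  fixes h :: "cseq \<Rightarrow> complex"
  assumes h: "continuous_on UNIV h"
  shows "continuous_on UNIV (\<lambda>p. p(k := (a::real) *\<^sub>R p k + h p))"
proof (rule continuous_on_coordinatewise_then_product)
  show "continuous_on UNIV (\<lambda>p. (p(k := a *\<^sub>R p k + h p)) i)" for i
    by (cases "i = k") (auto intro!: continuous_intros h)
qed

text \<open>Tonelli for the indicator of \<open>F\<close>. It reduces questions about null sets to a
  single coordinate.\<close>

lemma AE_PiM_insert:
  assumes F: "F \<in> sets (borel :: cseq measure)" and "finite I" "j \<notin> I"
  shows "(AE p in \<Pi>\<^sub>M j\<in>insert j I. lborel. p \<notin> F) \<longleftrightarrow>
    (AE p in \<Pi>\<^sub>M j\<in>I. lborel. AE y in lborel. p(j := y) \<notin> F)"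
proof -
  let ?M = "\<lambda>I. \<Pi>\<^sub>M j\<in>I. (lborel :: complex measure)"
  have m: "(\<lambda>p. indicator F p :: ennreal) \<in> borel_measurable (?M J)" for J
    using measurable_compose[OF id_measurable_PiM borel_measurable_indicator[OF F]] .
  have upd: "(\<lambda>y. x(j := y)) \<in> lborel \<rightarrow>\<^sub>M (borel :: cseq measure)" for x
    using borel_measurable_continuous_onI[OF continuous_on_upd] by simp
  have "(AE p in ?M (insert j I). p \<notin> F) \<longleftrightarrow> (\<integral>\<^sup>+p. indicator F p \<partial>?M (insert j I)) = 0"
    by (subst nn_integral_0_iff_AE[OF m]) (auto simp: indicator_def)
  also have "(\<integral>\<^sup>+p. indicator F p \<partial>?M (insert j I)) = (\<integral>\<^sup>+x. (\<integral>\<^sup>+y. indicator F (x(j := y)) \<partial>lborel) \<partial>?M I)"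
    by (rule cps.product_nn_integral_insert[OF assms(2,3) m])
  also have "\<dots> = 0 \<longleftrightarrow> (AE x in ?M I. (\<integral>\<^sup>+y. indicator F (x(j := y)) \<partial>lborel) = 0)"
  proof (rule nn_integral_0_iff_AE)
    have *: "(\<lambda>(x, y). x(j := y)) \<in> ?M I \<Otimes>\<^sub>M lborel \<rightarrow>\<^sub>M ?M (insert j I)"
      by (rule measurable_add_dim)
    show "(\<lambda>x. \<integral>\<^sup>+y. indicator F (x(j := y)) \<partial>lborel) \<in> borel_measurable (?M I)"
      by (rule sigma_finite_measure.borel_measurable_nn_integral[OF lborel.sigma_finite_measure_axioms])
         (use measurable_compose[OF * m] in \<open>simp add: split_def\<close>)
  qed
  also have "\<dots> \<longleftrightarrow> (AE x in ?M I. AE y in lborel. x(j := y) \<notin> F)"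
    by (subst nn_integral_0_iff_AE[OF measurable_compose[OF upd borel_measurable_indicator[OF F]]]) (auto simp: indicator_def)
  finally show ?thesis .
qed

lemma AE_lborel_affine:
  assumes "AE y in lborel. (y::complex) \<notin> G" "G \<in> sets borel" "(a::real) \<noteq> 0"
  shows "AE y in lborel. a *\<^sub>R y + t \<notin> G"
proof -
  have "AE y in density (distr lborel borel (\<lambda>x. t + a *\<^sub>R x)) (\<lambda>_. ennreal (\<bar>a\<bar> ^ DIM(complex))). y \<notin> G"
    unfolding lborel_affine[OF assms(3), of t, symmetric] by (rule assms(1))
  then have "AE y in distr lborel borel (\<lambda>x. t + a *\<^sub>R x). y \<notin> G"
    using assms(3) by (subst (asm) AE_density) (auto simp: ennreal_eq_0_iff)
  then show ?thesis
    using assms(2) by (subst (asm) AE_distr_iff) (auto simp: add.commute)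
qed

text \<open>With the other coordinates fixed, the k-th one undergoes the affine bijection y -> a y +
  h(p), because \<open>h\<close> does not depend on it.\<close>

lemma AE_PiM_shear:
  assumes F: "closed F" and AE: "AE p in cborel n. p \<notin> F"
    and a: "(a::real) \<noteq> 0" and k: "k \<le> n"
    and h: "continuous_on UNIV h" "\<And>p y. h (p(k := y)) = h p"
  shows "AE p in cborel n. p(k := a *\<^sub>R p k + h p) \<notin> F"
proof -
  define I where "I = {..n} - {k}"
  have I: "finite I" "k \<notin> I" "{..n} = insert k I" using k by (auto simp: I_def)
  define G where "G = (\<lambda>p. p(k := a *\<^sub>R p k + h p)) -` F"
  have G: "closed G" unfolding G_def by (rule closed_vimage[OF F continuous_on_shear[OF h(1)]])
  have "AE p in \<Pi>\<^sub>M j\<in>I. lborel. AE y in lborel. p(k := y) \<notin> F"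
    using AE AE_PiM_insert[OF borel_closed[OF F] I(1,2)] unfolding I(3) by simp
  then have "AE p in \<Pi>\<^sub>M j\<in>I. lborel. AE y in lborel. p(k := y) \<notin> G"
  proof eventually_elim
    case (elim p)
    have "AE y in lborel. a *\<^sub>R y + h p \<notin> {y. p(k := y) \<in> F}"
      by (rule AE_lborel_affine[OF _ _ a]) (use elim closed_vimage[OF F continuous_on_upd] in \<open>auto simp: vimage_def\<close>)
    then show ?case by eventually_elim (simp add: G_def h(2))
  qed
  then have "AE p in cborel n. p \<notin> G"
    using AE_PiM_insert[OF borel_closed[OF G] I(1,2)] unfolding I(3) by simp
  then show ?thesis by (simp add: G_def)
qed

text \<open>The identity beyond n leaves the \<open>undefined\<close> components alone. Two
  instances matter: the action of \<open>heat\<close> on coefficients and the scaling of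
  zeros.\<close>

definition triangular :: "nat \<Rightarrow> (nat \<Rightarrow> real) \<Rightarrow> (nat \<Rightarrow> nat \<Rightarrow> complex) \<Rightarrow> cseq \<Rightarrow> nat \<Rightarrow> complex" where
  "triangular n a C p = (\<lambda>i. if i \<le> n then a i *\<^sub>R p i + (\<Sum>j\<in>{i<..n}. C i j * p j) else p i)"

lemma continuous_on_triangular: "continuous_on UNIV (triangular n a C)"
  unfolding triangular_def
proof (rule continuous_on_coordinatewise_then_product)
  show "continuous_on UNIV (\<lambda>p. if i \<le> n then a i *\<^sub>R p i + (\<Sum>j\<in>{i<..n}. C i j * p j) else p i)" for i
    by (cases "i \<le> n") (auto intro!: continuous_intros)
qed

lemma AE_triangular:
  assumes F: "closed F" and AE: "AE p in cborel n. p \<notin> F" and a: "\<And>i. i \<le> n \<Longrightarrow> a i \<noteq> 0"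
  shows "AE p in cborel n. triangular n a C p \<notin> F"
proof -
  \<comment> \<open>\<open>S k\<close> has treated the components below k. The k-th shear reads only
    components above k, which are still the original ones; this is why the shears are composed in
    the order 0, 1, ..., n.\<close>
  define S where "S k p = (\<lambda>i. if i < k then a i *\<^sub>R p i + (\<Sum>j\<in>{i<..n}. C i j * p j) else p i)" for k and p :: "nat \<Rightarrow> complex"
  have "AE p in cborel n. S k p \<notin> F" if "k \<le> Suc n" for k
    using that F AE
  proof (induction k arbitrary: F)
    case 0
    then show ?case by (simp add: S_def)
  next
    case (Suc k)
    define h where "h p = (\<Sum>j\<in>{k<..n}. C k j * p j)" for p :: "nat \<Rightarrow> complex"
    have h: "continuous_on UNIV h" "\<And>p y. h (p(k := y)) = h p"
      unfolding h_def by (auto intro!: continuous_intros sum.cong)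
    define G where "G = (\<lambda>p. p(k := a k *\<^sub>R p k + h p)) -` F"
    have "closed G" unfolding G_def by (rule closed_vimage[OF Suc.prems(2) continuous_on_shear[OF h(1)]])
    moreover have "AE p in cborel n. p \<notin> G"
      unfolding G_def vimage_Collect_eq using AE_PiM_shear[OF Suc.prems(2,3) a _ h] Suc.prems(1) by simp
    ultimately have "AE p in cborel n. S k p \<notin> G" using Suc by simp
    moreover have "(S k p)(k := a k *\<^sub>R S k p k + h (S k p)) = S (Suc k) p" for p
    proof -
      have "h (S k p) = h p" unfolding h_def by (rule sum.cong) (auto simp: S_def)
      moreover have "S k p k = p k" by (simp add: S_def)
      ultimately show ?thesis by (intro ext) (simp add: S_def h_def less_Suc_eq)
    qed
    ultimately show ?case by (simp add: G_def)
  qed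
  moreover have "S (Suc n) = triangular n a C"
    by (intro ext) (simp add: S_def triangular_def less_Suc_eq_le)
  ultimately show ?thesis by (metis order_refl)
qed

text \<open>
  Closed null sets are nowhere dense, so a countable union of them is null and meager at once.
\<close>

definition thin :: "nat \<Rightarrow> cseq set \<Rightarrow> bool" where
  "thin n B \<longleftrightarrow> (\<exists>F::nat \<Rightarrow> cseq set. B \<subseteq> (\<Union>k. F k) \<and> (\<forall>k. closed (F k) \<and> (AE p in cborel n. p \<notin> F k)))"

lemma thin_subset: "thin n B \<Longrightarrow> A \<subseteq> B \<Longrightarrow> thin n A"
  unfolding thin_def by (elim exE conjE, rule exI, rule conjI) (rule subset_trans)

lemma thin_closed: "closed B \<Longrightarrow> AE p in cborel n. p \<notin> B \<Longrightarrow> thin n B"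
  unfolding thin_def by (rule exI[of _ "\<lambda>_. B"]) simp

lemma thin_UN:
  assumes "\<And>i::nat. thin n (B i)" shows "thin n (\<Union>i. B i)"
proof -
  obtain F :: "nat \<Rightarrow> nat \<Rightarrow> cseq set" where
    F: "\<And>i. B i \<subseteq> (\<Union>k. F i k)" "\<And>i k. closed (F i k)" "\<And>i k. AE p in cborel n. p \<notin> F i k"
    using assms unfolding thin_def by metis
  show ?thesis unfolding thin_def
  proof (intro exI[of _ "\<lambda>k. F (fst (prod_decode k)) (snd (prod_decode k))"] conjI allI)
    show "(\<Union>i. B i) \<subseteq> (\<Union>k. F (fst (prod_decode k)) (snd (prod_decode k)))"
    proof
      fix x assume "x \<in> (\<Union>i. B i)"
      then obtain i k where "x \<in> F i k" using F(1) by blast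
      then show "x \<in> (\<Union>k. F (fst (prod_decode k)) (snd (prod_decode k)))"
        by (intro UN_I[of "prod_encode (i, k)"]) auto
    qed
  qed (use F in auto)
qed

lemma thin_Un:
  assumes "thin n A" "thin n B" shows "thin n (A \<union> B)"
proof -
  have "thin n (\<Union>i::nat. if i = 0 then A else B)" by (rule thin_UN) (use assms in auto)
  then show ?thesis by (rule thin_subset) (auto split: if_splits)
qed

lemma thin_AE: assumes "thin n B" shows "AE p in cborel n. p \<notin> B"
proof -
  obtain F :: "nat \<Rightarrow> cseq set" where F: "B \<subseteq> (\<Union>k. F k)" "\<And>k. AE p in cborel n. p \<notin> F k"
    using assms unfolding thin_def by metis
  have "AE p in cborel n. \<forall>k. p \<notin> F k" using F(2) by (subst AE_all_countable) auto
  then show ?thesis by eventually_elim (use F(1) in auto)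
qed

lemma thin_triangular_vimage:
  assumes "thin n B" "\<And>i. i \<le> n \<Longrightarrow> a i \<noteq> 0"
  shows "thin n (triangular n a C -` B)"
proof -
  obtain F :: "nat \<Rightarrow> cseq set" where F: "B \<subseteq> (\<Union>k. F k)" "\<And>k. closed (F k)" "\<And>k. AE p in cborel n. p \<notin> F k"
    using assms(1) unfolding thin_def by metis
  have "AE p in cborel n. p \<notin> triangular n a C -` F k" for k
    using AE_triangular[OF F(2,3) assms(2)] by auto
  moreover have "closed (triangular n a C -` F k)" for k
    by (rule closed_vimage[OF F(2) continuous_on_triangular])
  moreover have "triangular n a C -` B \<subseteq> (\<Union>k. triangular n a C -` F k)"
    by (metis F(1) vimage_UN vimage_mono)
  ultimately show ?thesis unfolding thin_def by blast
qed

lemma emeasure_lborel_open_pos: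
  fixes X :: "complex set"
  assumes "open X" "X \<noteq> {}" shows "emeasure lborel X \<noteq> 0"
proof
  assume "emeasure lborel X = 0"
  then have "X \<in> null_sets lborel" using assms by (auto intro: null_setsI)
  then have "negligible X" by (simp add: negligible_iff_null_sets null_sets_completionI)
  then show False using open_not_negligible assms by blast
qed

text \<open>A nonempty open set contains a box whose measure is a product of positive numbers, so a
  closed null set has empty interior.\<close>

theorem thin_null_meager:
  assumes "thin n B" and E: "E = {p \<in> {..n} \<rightarrow>\<^sub>E UNIV. p \<in> B}"
  shows "E \<in> null_sets (lebesgue_coeffs n)" "meager_in (top_coeffs n) E"
proof -
  have sp: "space (cborel n) = {..n} \<rightarrow>\<^sub>E UNIV" by (simp add: space_PiM)
  obtain N where "{p \<in> space (cborel n). \<not> p \<notin> B} \<subseteq> N" "emeasure (cborel n) N = 0" "N \<in> sets (cborel n)"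
    by (rule AE_E[OF thin_AE[OF assms(1)]])
  then have "E \<subseteq> N" "N \<in> null_sets (cborel n)" by (auto simp: E sp)
  then show "E \<in> null_sets (lebesgue_coeffs n)"
    unfolding lebesgue_coeffs_def by (meson null_sets_completionI null_sets_completion_subset)
next
  obtain F :: "nat \<Rightarrow> cseq set" where F: "B \<subseteq> (\<Union>k. F k)" "\<And>k. closed (F k)" "\<And>k. AE p in cborel n. p \<notin> F k"
    using assms(1) unfolding thin_def by metis
  have top: "topspace (top_coeffs n) = {..n} \<rightarrow>\<^sub>E UNIV" by (simp add: top_coeffs_def)
  define D where "D k = {p \<in> {..n} \<rightarrow>\<^sub>E UNIV. p \<in> F k}" for k
  \<comment> \<open>Components beyond n are constant on the space of coefficient vectors, so closed
    sets of sequences have closed traces there.\<close>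
  have cont: "continuous_map (top_coeffs n) (euclidean :: cseq topology) (\<lambda>p. p)"
    unfolding euclidean_product_topology[symmetric] continuous_map_componentwise_UNIV
  proof
    fix i
    show "continuous_map (top_coeffs n) (euclidean :: complex topology) (\<lambda>p. p i)"
    proof (cases "i \<le> n")
      case True
      then show ?thesis unfolding top_coeffs_def by (intro continuous_map_product_projection) auto
    next
      case False
      have "continuous_map (top_coeffs n) (euclidean :: complex topology) (\<lambda>p. undefined)" by simp
      then show ?thesis
        by (rule continuous_map_eq) (use False in \<open>auto simp: top PiE_def extensional_def\<close>)
    qed
  qed
  have closed_D: "closedin (top_coeffs n) (D k)" for k
    using closedin_continuous_map_preimage[OF cont, of "F k"] F(2)[of k] by (simp add: D_def top)
  have int_D: "top_coeffs n interior_of D k = {}" for k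
  proof (rule ccontr)
    assume "top_coeffs n interior_of D k \<noteq> {}"
    then obtain x U where U: "openin (top_coeffs n) U" "U \<subseteq> D k" "x \<in> U"
      by (auto simp: interior_of_def)
    then obtain X where X: "\<And>i. i \<le> n \<Longrightarrow> open (X i)" "x \<in> PiE {..n} X" "PiE {..n} X \<subseteq> U"
      unfolding top_coeffs_def openin_product_topology_alt by (force simp: atMost_def)
    have XM: "PiE {..n} X \<in> sets (cborel n)" using X(1) by (intro sets_PiM_I_finite) auto
    have "emeasure (cborel n) (PiE {..n} X) = (\<Prod>i\<le>n. emeasure lborel (X i))"
      using X(1) by (intro cps.emeasure_PiM) auto
    also have "\<dots> \<noteq> 0" using X emeasure_lborel_open_pos by (auto simp: PiE_def Pi_def) blast
    finally have "emeasure (cborel n) (PiE {..n} X) \<noteq> 0" .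
    moreover have "AE p in cborel n. p \<notin> PiE {..n} X"
      using F(3)[of k] by eventually_elim (use X(3) U(2) in \<open>auto simp: D_def\<close>)
    then have "emeasure (cborel n) (PiE {..n} X) = 0"
      using XM AE_iff_null_sets by auto
    ultimately show False by simp
  qed
  have nd: "nowhere_dense_in (top_coeffs n) (E \<inter> D k)" for k
  proof -
    have "top_coeffs n closure_of (E \<inter> D k) \<subseteq> D k"
      using closed_D by (metis closure_of_minimal inf_le2)
    then have "top_coeffs n interior_of (top_coeffs n closure_of (E \<inter> D k)) \<subseteq> {}"
      using int_D[of k] interior_of_mono by blast
    then show ?thesis by (auto simp: nowhere_dense_in_def top E)
  qed
  show "meager_in (top_coeffs n) E"
    unfolding meager_in_def
    by (intro exI[of _ "range (\<lambda>k. E \<inter> D k)"] conjI) (use nd F(1) in \<open>auto simp: E D_def\<close>)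
qed

section \<open>The exceptional polynomials\<close>

definition cpoly :: "nat \<Rightarrow> cseq \<Rightarrow> complex poly" where
  "cpoly n q = (\<Sum>j\<le>n. monom (q j) j)"

lemma coeff_cpoly: "coeff (cpoly n q) i = (if i \<le> n then q i else 0)"
  by (simp add: cpoly_def coeff_sum)

lemma degree_cpoly_le: "degree (cpoly n q) \<le> n"
  by (rule degree_le) (simp add: coeff_cpoly)

lemma degree_cpoly: "q n \<noteq> 0 \<Longrightarrow> degree (cpoly n q) = n"
  using degree_cpoly_le[of n q] le_degree[of "cpoly n q" n] by (simp add: coeff_cpoly)

lemma poly_cpoly: "poly (cpoly n q) x = (\<Sum>j\<le>n. q j * x ^ j)"
  by (simp add: cpoly_def poly_sum poly_monom)

lemma pderiv_sum: "pderiv (sum f A) = (\<Sum>x\<in>A. pderiv (f x))"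
  by (induction A rule: infinite_finite_induct) (simp_all add: pderiv_add)

lemma poly_pderiv_cpoly: "poly (pderiv (cpoly n q)) x = (\<Sum>j\<le>n. q j * (of_nat j * x ^ (j - 1)))"
  by (simp add: cpoly_def poly_sum poly_monom pderiv_sum pderiv_monom mult_ac)

lemma cpoly_upd0: "cpoly n (q(0 := y)) = [:y - q 0:] + cpoly n q"
  by (rule poly_eqI) (simp add: coeff_cpoly coeff_pCons split: nat.splits)

text \<open>Projection along a compact factor is a closed map. This is why zeros are confined to a
  ball of radius R below: the existential quantifier over zeros then preserves closedness, and the
  union over R is countable.\<close>

lemma closed_projection:
  fixes C :: "('a::topological_space \<times> 'b::topological_space) set"
  assumes C: "closed C" and K: "compact K"
  shows "closed {x. \<exists>y\<in>K. (x, y) \<in> C}"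
proof -
  have "closed_map (prod_topology euclidean (top_of_set K)) (euclidean :: 'a topology) fst"
    using K by (intro Abstract_Topological_Spaces.closed_map_fst) (simp add: compact_space_subtopology)
  moreover have "closedin (prod_topology (euclidean :: 'a topology) (top_of_set K)) (C \<inter> UNIV \<times> K)"
    using closedin_closed_Int[OF C, of "UNIV \<times> K"] by (simp add: prod_topology_subtopology Int_commute)
  ultimately have "closed (fst ` (C \<inter> UNIV \<times> K))"
    unfolding closed_map_def closed_closedin by blast
  moreover have "fst ` (C \<inter> UNIV \<times> K) = {x. \<exists>y\<in>K. (x, y) \<in> C}" by force
  ultimately show ?thesis by simp
qed

lemma AE_lborel_finite: "finite A \<Longrightarrow> AE y in lborel. (y::'a::euclidean_space) \<notin> A"
  by (rule AE_not_in) (simp add: finite_imp_null_set_lborel)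

lemma AE_slice:
  assumes F: "F \<in> sets (borel :: cseq measure)" and k: "k \<le> n"
    and slice: "\<And>q. finite {y. q(k := y) \<in> F}"
  shows "AE q in cborel n. q \<notin> F"
proof -
  define I where "I = {..n} - {k}"
  have I: "finite I" "k \<notin> I" "{..n} = insert k I" using k by (auto simp: I_def)
  have "AE y in lborel. q(k := y) \<notin> F" for q
    using AE_lborel_finite[OF slice[of q]] by simp
  then show ?thesis unfolding I(3) AE_PiM_insert[OF F I(1,2)] by simp
qed

lemma closed_coordinate_zero: "closed {q :: nat \<Rightarrow> complex. q k = 0}"
  by (rule closed_Collect_eq[OF continuous_on_product_coordinates continuous_on_const])

lemma AE_coordinate: "k \<le> n \<Longrightarrow> AE q in cborel n. q k \<noteq> 0"
  using AE_slice[OF borel_closed[OF closed_coordinate_zero], of k n k] by simp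

lemma continuous_on_fst_coord [continuous_intros]: "continuous_on S (\<lambda>x::cseq \<times> 'b::topological_space. fst x j)"
  using continuous_on_product_then_coordinatewise[where f = fst and S = S] by (simp add: continuous_on_fst)

lemma continuous_on_snd_coord [continuous_intros]: "continuous_on S (\<lambda>x::'b::topological_space \<times> cseq. snd x j)"
  using continuous_on_product_then_coordinatewise[where f = snd and S = S] by (simp add: continuous_on_snd)

section \<open>Closed sets of bad coefficients\<close>

definition double_root_set :: "nat \<Rightarrow> nat \<Rightarrow> cseq set" where
  "double_root_set n R = {q. \<exists>z\<in>cball 0 (real R). poly (cpoly n q) z = 0 \<and> poly (pderiv (cpoly n q)) z = 0}"

definition opposite_root_set :: "nat \<Rightarrow> nat \<Rightarrow> cseq set" where
  "opposite_root_set n R = {q. \<exists>z\<in>cball 0 (real R). poly (cpoly n q) z = 0 \<and> poly (cpoly n q) (- z) = 0}"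

text \<open>The zeros form a point of a product of balls, compact by Tychonoff. The factorization is
  stated pointwise with \<open>q n\<close> as leading factor, so that every requirement is an
  equation between continuous functions of q and r.\<close>

definition resonant_set :: "nat \<Rightarrow> nat \<Rightarrow> nat \<Rightarrow> cseq set" where
  "resonant_set n m R = {q. \<exists>r\<in>PiE UNIV (\<lambda>_. cball 0 (real R)).
     (\<forall>x. poly (cpoly n q) x = q n * (\<Prod>i<n. x - r i)) \<and> (\<forall>k\<in>{m..<n}. gen_cond n m r (r k))}"

lemma closed_double_root_set: "closed (double_root_set n R)"
proof -
  have "closed {x::cseq \<times> complex. poly (cpoly n (fst x)) (snd x) = 0 \<and> poly (pderiv (cpoly n (fst x))) (snd x) = 0}"
    unfolding poly_cpoly poly_pderiv_cpoly
    by (intro closed_Collect_conj closed_Collect_eq continuous_intros)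
  from closed_projection[OF this compact_cball[of 0 "real R"]] show ?thesis
    by (simp add: double_root_set_def)
qed

lemma closed_opposite_root_set: "closed (opposite_root_set n R)"
proof -
  have "closed {x::cseq \<times> complex. poly (cpoly n (fst x)) (snd x) = 0 \<and> poly (cpoly n (fst x)) (- snd x) = 0}"
    unfolding poly_cpoly
    by (intro closed_Collect_conj closed_Collect_eq continuous_intros)
  from closed_projection[OF this compact_cball[of 0 "real R"]] show ?thesis
    by (simp add: opposite_root_set_def)
qed

lemma compact_PiE_UNIV:
  fixes K :: "complex set"
  assumes "compact K" shows "compact (PiE (UNIV :: nat set) (\<lambda>_. K))"
  using assms compactin_PiE[of "\<lambda>_::nat. euclidean :: complex topology" UNIV "\<lambda>_. K"]
  by (simp add: euclidean_product_topology)

lemma closed_resonant_set: "closed (resonant_set n m R)"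
proof -
  have "closed {x::cseq \<times> cseq. (\<forall>y. poly (cpoly n (fst x)) y = fst x n * (\<Prod>i<n. y - snd x i))
     \<and> (\<forall>k\<in>{m..<n}. gen_cond n m (snd x) (snd x k))}"
    unfolding poly_cpoly gen_cond_def res_num_def res_den_def Ball_def
    by (intro closed_Collect_conj closed_Collect_all closed_Collect_imp open_Collect_const closed_Collect_eq continuous_intros)
  from closed_projection[OF this compact_PiE_UNIV[OF compact_cball[of 0 "real R"]]] show ?thesis
    by (simp add: resonant_set_def)
qed

text \<open>Only the constant coefficient is varied. The hyperplane q k = 0 is null, and for k > 0
  this variation does not lead into or out of it.\<close>

lemma thin_slice:
  assumes B: "closed B" and k: "k \<le> n" "k > 0" and fin: "\<And>q. q k \<noteq> 0 \<Longrightarrow> finite {y. q(0 := y) \<in> B}"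
  shows "thin n B"
proof (rule thin_closed[OF B])
  have "AE q in cborel n. q \<notin> B - {q. q k = 0}"
  proof (rule AE_slice[where k = 0])
    show "B - {q. q k = 0} \<in> sets borel"
      by (intro sets.Diff borel_closed B closed_coordinate_zero)
    show "finite {y. q(0 := y) \<in> B - {q. q k = 0}}" for q :: "nat \<Rightarrow> complex"
      using fin[of q] k by (cases "q k = 0") auto
  qed simp
  then show "AE q in cborel n. q \<notin> B" using AE_coordinate[OF k(1)] by eventually_elim auto
qed

text \<open>A double zero is a critical point, and the derivative does not contain the constant
  coefficient. Finitely many critical points leave finitely many bad constants.\<close>

lemma thin_double_root_set:
  assumes "n \<ge> 1" shows "thin n (double_root_set n R)"
proof (rule thin_slice[OF closed_double_root_set order_refl])
  fix q :: "nat \<Rightarrow> complex" assume "q n \<noteq> 0"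
  then have "pderiv (cpoly n q) \<noteq> 0"
    using degree_cpoly[of q n] assms pderiv_eq_0_iff[of "cpoly n q"] by simp
  then have "finite ((\<lambda>z. q 0 - poly (cpoly n q) z) ` {z. poly (pderiv (cpoly n q)) z = 0})"
    by (intro finite_imageI poly_roots_finite)
  moreover have "{y. q(0 := y) \<in> double_root_set n R} \<subseteq> (\<lambda>z. q 0 - poly (cpoly n q) z) ` {z. poly (pderiv (cpoly n q)) z = 0}"
  proof
    fix y assume "y \<in> {y. q(0 := y) \<in> double_root_set n R}"
    then obtain z where "poly (cpoly n (q(0 := y))) z = 0" "poly (pderiv (cpoly n (q(0 := y)))) z = 0"
      by (auto simp: double_root_set_def)
    then have "y = q 0 - poly (cpoly n q) z" "poly (pderiv (cpoly n q)) z = 0"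
      by (simp_all add: cpoly_upd0 pderiv_add pderiv_pCons algebra_simps)
    then show "y \<in> (\<lambda>z. q 0 - poly (cpoly n q) z) ` {z. poly (pderiv (cpoly n q)) z = 0}" by blast
  qed
  ultimately show "finite {y. q(0 := y) \<in> double_root_set n R}" by (rule rev_finite_subset)
qed (use assms in simp)

text \<open>At opposite zeros the odd part of the polynomial vanishes. The odd part does not contain
  the constant coefficient and is nonzero if q 1 is, so there are finitely many candidates z, each
  of which determines the constant.\<close>

lemma thin_opposite_root_set:
  assumes "n \<ge> 1" shows "thin n (opposite_root_set n R)"
proof (rule thin_slice[OF closed_opposite_root_set assms])
  fix q :: "nat \<Rightarrow> complex" assume q: "q 1 \<noteq> 0"
  define d where "d = cpoly n q - refl_poly (cpoly n q)"
  have "poly (pderiv d) 0 = 2 * q 1"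
    using assms by (simp add: d_def pderiv_diff pderiv_pcompose pderiv_pCons poly_pcompose poly_0_coeff_0 coeff_pderiv coeff_cpoly)
  then have "d \<noteq> 0" using q by auto
  then have "finite ((\<lambda>z. q 0 - poly (cpoly n q) z) ` {z. poly d z = 0})"
    by (intro finite_imageI poly_roots_finite)
  moreover have "{y. q(0 := y) \<in> opposite_root_set n R} \<subseteq> (\<lambda>z. q 0 - poly (cpoly n q) z) ` {z. poly d z = 0}"
  proof
    fix y assume "y \<in> {y. q(0 := y) \<in> opposite_root_set n R}"
    then obtain z where "poly (cpoly n (q(0 := y))) z = 0" "poly (cpoly n (q(0 := y))) (- z) = 0"
      by (auto simp: opposite_root_set_def)
    then have *: "y - q 0 + poly (cpoly n q) z = 0" "y - q 0 + poly (cpoly n q) (- z) = 0"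
      by (simp_all add: cpoly_upd0)
    then have "poly d z = 0" by (simp add: d_def poly_pcompose) (metis add_left_cancel)
    moreover have "y = q 0 - poly (cpoly n q) z" using *(1) by (simp add: algebra_simps)
    ultimately show "y \<in> (\<lambda>z. q 0 - poly (cpoly n q) z) ` {z. poly d z = 0}" by blast
  qed
  ultimately show "finite {y. q(0 := y) \<in> opposite_root_set n R}" by (rule rev_finite_subset)
qed simp

text \<open>In the variable z^2 the numerator has degree at most m - 1, while the other n - m >= m
  zeros have distinct squares. Vanishing at all of them would make it zero; but at (r 0)^2 only the
  summand with i = 0 survives, a product of nonzero factors.\<close>

lemma resonance_numerator_nonzero:
  fixes r :: "nat \<Rightarrow> complex"
  assumes m: "0 < m" "2 * m \<le> n"
    and nz: "\<And>i. i < n \<Longrightarrow> r i \<noteq> 0"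
    and inj: "inj_on (\<lambda>i. (r i)\<^sup>2) {..<n}"
  shows "\<exists>k\<in>{m..<n}. res_num m r (r k) \<noteq> 0"
proof (rule ccontr)
  assume A: "\<not> ?thesis"
  define Y where "Y = (\<Sum>i<m. smult (r i) (\<Prod>j\<in>{..<m} - {i}. [:- (r j)\<^sup>2, 1:]))"
  have pY: "poly Y (w\<^sup>2) = res_num m r w" for w
    by (simp add: Y_def res_num_def poly_sum poly_prod)
  have "degree Y \<le> m - 1" unfolding Y_def
  proof (rule degree_sum_le)
    fix i assume i: "i \<in> {..<m}"
    have "degree (\<Prod>j\<in>{..<m} - {i}. [:- (r j)\<^sup>2, 1:]) \<le> (\<Sum>j\<in>{..<m} - {i}. degree [:- (r j)\<^sup>2, 1:])"
      using degree_prod_sum_le[of "{..<m} - {i}" "\<lambda>j. [:- (r j)\<^sup>2, 1:]"] by (simp add: o_def)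
    also have "\<dots> = m - 1" using i by simp
    finally show "degree (smult (r i) (\<Prod>j\<in>{..<m} - {i}. [:- (r j)\<^sup>2, 1:])) \<le> m - 1"
      using degree_smult_le order_trans by blast
  qed simp
  have "Y = 0"
  proof (rule ccontr)
    assume Y0: "Y \<noteq> 0"
    have "(\<lambda>k. (r k)\<^sup>2) ` {m..<n} \<subseteq> {x. poly Y x = 0}" using A by (auto simp: pY)
    then have "card ((\<lambda>k. (r k)\<^sup>2) ` {m..<n}) \<le> card {x. poly Y x = 0}"
      by (intro card_mono poly_roots_finite[OF Y0])
    also have "card ((\<lambda>k. (r k)\<^sup>2) ` {m..<n}) = n - m"
      by (subst card_image) (auto intro: inj_on_subset[OF inj])
    also have "card {x. poly Y x = 0} \<le> degree Y" by (rule card_poly_roots_bound[OF Y0])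
    finally show False using \<open>degree Y \<le> m - 1\<close> m by linarith
  qed
  then have "0 = poly Y ((r 0)\<^sup>2)" by simp
  also have "\<dots> = (\<Sum>i\<in>{0}. r i * (\<Prod>j\<in>{..<m} - {i}. (r 0)\<^sup>2 - (r j)\<^sup>2))"
    unfolding pY res_num_def
  proof (rule sum.mono_neutral_right)
    show "\<forall>i\<in>{..<m} - {0}. r i * (\<Prod>j\<in>{..<m} - {i}. (r 0)\<^sup>2 - (r j)\<^sup>2) = 0"
    proof
      fix i assume "i \<in> {..<m} - {0}"
      then have "(\<Prod>j\<in>{..<m} - {i}. (r 0)\<^sup>2 - (r j)\<^sup>2) = 0" using m by (intro prod_zero) auto
      then show "r i * (\<Prod>j\<in>{..<m} - {i}. (r 0)\<^sup>2 - (r j)\<^sup>2) = 0" by simp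
    qed
  qed (use m in auto)
  finally have "r 0 * (\<Prod>j\<in>{..<m} - {0}. (r 0)\<^sup>2 - (r j)\<^sup>2) = 0" by simp
  moreover have "(r 0)\<^sup>2 - (r j)\<^sup>2 \<noteq> 0" if "j \<in> {..<m} - {0}" for j
    using inj_onD[OF inj, of 0 j] that m by auto
  ultimately show False using nz[of 0] m by (auto simp: prod_zero_iff)
qed

section \<open>Resonance along rays\<close>

text \<open>
  Multiplies the zeros of a polynomial by \<open>l\<close>. Both sides of the resonance condition are homogeneous in the
  zeros, of degrees differing by two, so each choice of zeros is resonant for at most one \<open>l > 0\<close>.
\<close>

definition dilate :: "nat \<Rightarrow> real \<Rightarrow> cseq \<Rightarrow> nat \<Rightarrow> complex" where
  "dilate n l q = triangular n (\<lambda>i. l ^ (n - i)) (\<lambda>_ _. 0) q"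

lemma dilate_apply: "dilate n l q i = (if i \<le> n then of_real (l ^ (n - i)) * q i else q i)"
  by (simp add: dilate_def triangular_def scaleR_conv_of_real)

lemma dilate_dilate: "l \<noteq> 0 \<Longrightarrow> dilate n l (dilate n (1 / l) q) = q"
  by (intro ext) (simp add: dilate_apply power_divide)

lemma poly_dilate: "poly (cpoly n (dilate n l q)) (of_real l * x) = of_real l ^ n * poly (cpoly n q) x"
  unfolding poly_cpoly sum_distrib_left
proof (intro sum.cong refl)
  fix j assume "j \<in> {..n}"
  then have "complex_of_real l ^ n = of_real l ^ (n - j) * of_real l ^ j" by (simp flip: power_add)
  then show "dilate n l q j * (of_real l * x) ^ j = of_real l ^ n * (q j * x ^ j)"
    using \<open>j \<in> {..n}\<close> by (simp add: dilate_apply power_mult_distrib mult_ac)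
qed

text \<open>In the zeros, the left-hand side has degree 2m + 1 and the right-hand side 2m - 1, since
  conjugation commutes with a real factor; the quotient l^2 remains.\<close>

lemma gen_cond_dilate:
  assumes l: "l > 0" and m: "0 < m" and g: "gen_cond n m (\<lambda>i. of_real l * r i) (of_real l * z)"
  shows "of_real (l\<^sup>2) * (cnj (\<Sum>i<m. r i) * res_den m r z) =
    of_nat n / 2 * res_num m r z"
proof -
  define c where "c = complex_of_real l"
  have c: "c \<noteq> 0" "cnj c = c" using l by (auto simp: c_def)
  define X where "X = res_den m r z"
  define Y where "Y = res_num m r z"
  have d: "(c * z)\<^sup>2 - (c * r i)\<^sup>2 = c\<^sup>2 * (z\<^sup>2 - (r i)\<^sup>2)" for i by (simp add: power_mult_distrib algebra_simps)
  have 1: "(\<Prod>i<m. (c * z)\<^sup>2 - (c * r i)\<^sup>2) = (c\<^sup>2) ^ m * X"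
    unfolding d prod.distrib X_def res_den_def by simp
  have 2: "(\<Sum>i<m. c * r i * (\<Prod>j\<in>{..<m} - {i}. (c * z)\<^sup>2 - (c * r j)\<^sup>2)) = c * (c\<^sup>2) ^ (m - 1) * Y"
    unfolding Y_def res_num_def sum_distrib_left
    by (intro sum.cong refl) (simp add: d prod.distrib)
  have 3: "cnj (\<Sum>i<m. c * r i) = c * cnj (\<Sum>i<m. r i)"
    by (simp add: c flip: sum_distrib_left)
  have "c * cnj (\<Sum>i<m. r i) * ((c\<^sup>2) ^ m * X) = of_nat n / 2 * (c * (c\<^sup>2) ^ (m - 1) * Y)"
    using g unfolding gen_cond_def res_num_def res_den_def c_def[symmetric] 1 2 3 by simp
  moreover have "(c\<^sup>2) ^ m = c\<^sup>2 * (c\<^sup>2) ^ (m - 1)" using m by (cases m) auto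
  ultimately have "(c * (c\<^sup>2) ^ (m - 1)) * (c\<^sup>2 * (cnj (\<Sum>i<m. r i) * X)) = (c * (c\<^sup>2) ^ (m - 1)) * (of_nat n / 2 * Y)"
    by (simp only: mult_ac)
  then have "c\<^sup>2 * (cnj (\<Sum>i<m. r i) * X) = of_nat n / 2 * Y"
    by (rule mult_left_cancel[THEN iffD1, rotated]) (use c in simp)
  then show ?thesis by (simp add: c_def X_def Y_def)
qed

text \<open>There are finitely many enumerations of the zeros. For each of them, some k with nonzero
  numerator determines l^2 and hence l.\<close>

lemma finite_resonant_scales:
  assumes qn: "q n \<noteq> 0" and m: "0 < m" "2 * m \<le> n"
    and simple: "\<And>z. poly (cpoly n q) z = 0 \<Longrightarrow> poly (pderiv (cpoly n q)) z \<noteq> 0 \<and> poly (cpoly n q) (- z) \<noteq> 0"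
  shows "finite {l. l > 0 \<and> dilate n l q \<in> resonant_set n m R}"
proof -
  let ?p = "cpoly n q"
  have p0: "?p \<noteq> 0" using degree_cpoly[of q n] qn m coeff_cpoly[of n q n] by auto
  define Z where "Z = {z. poly ?p z = 0}"
  have finZ: "finite Z" unfolding Z_def by (rule poly_roots_finite[OF p0])
  \<comment> \<open>Membership in \<open>PiE\<close> fixes the values from n on as
    \<open>undefined\<close>; otherwise the set of enumerations would be infinite.\<close>
  define Tup where "Tup = {r \<in> PiE {..<n} (\<lambda>_. Z). \<forall>x. poly ?p x = q n * (\<Prod>i<n. x - r i)}"
  have finT: "finite Tup" unfolding Tup_def by (rule finite_subset[OF _ finite_PiE[of "{..<n}" "\<lambda>_. Z"]]) (use finZ in auto)
  define L where "L r = {l. l > 0 \<and> (\<forall>k\<in>{m..<n}. complex_of_real (l\<^sup>2) * (cnj (\<Sum>i<m. r i) * res_den m r (r k)) =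
    of_nat n / 2 * res_num m r (r k))}" for r
  have finL: "finite (L r)" if T: "r \<in> Tup" for r
  proof -
    have pd: "poly ?p x = q n * (\<Prod>i<n. x - r i)" for x using T by (auto simp: Tup_def)
    have root: "poly ?p (r i) = 0" if "i < n" for i
      unfolding pd using that by (auto simp: prod_zero_iff)
    have nz: "r i \<noteq> 0" if "i < n" for i
      using simple[OF root[OF that]] root[OF that] by auto
    have "?p = smult (q n) (\<Prod>i<n. [:- r i, 1:])"
      by (rule poly_ext) (simp add: pd poly_prod)
    have inj: "inj_on (\<lambda>i. (r i)\<^sup>2) {..<n}"
    proof (rule inj_onI, rule ccontr)
      fix i j assume ij: "i \<in> {..<n}" "j \<in> {..<n}" "(r i)\<^sup>2 = (r j)\<^sup>2" "i \<noteq> j"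
      have "r i = - r j \<Longrightarrow> False" using simple[OF root[of j]] root[of i] ij by auto
      then have e: "r j = r i" using ij(3) by (auto simp: power2_eq_iff)
      define rest where "rest = (\<Prod>k\<in>{..<n} - {i} - {j}. [:- r k, 1:])"
      have "(\<Prod>k<n. [:- r k, 1:]) = [:- r i, 1:] * ([:- r i, 1:] * rest)"
        using ij by (simp add: rest_def prod.remove[of "{..<n}" i] prod.remove[of "{..<n} - {i}" j] e del: mult_pCons_left)
      then have "?p = smult (q n) ([:- r i, 1:] * ([:- r i, 1:] * rest))"
        using \<open>?p = smult (q n) (\<Prod>i<n. [:- r i, 1:])\<close> by simp
      then have "poly (pderiv ?p) (r i) = 0"
        by (simp only: pderiv_smult pderiv_mult poly_smult poly_add poly_mult) simp
      then show False using simple[OF root[of i]] ij by auto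
    qed
    obtain k where k: "k \<in> {m..<n}" "res_num m r (r k) \<noteq> 0"
      using resonance_numerator_nonzero[OF m nz inj] by blast
    have "l1 = l2" if "l1 \<in> L r" "l2 \<in> L r" for l1 l2
    proof -
      let ?c = "cnj (\<Sum>i<m. r i) * res_den m r (r k)"
      let ?d = "of_nat n / 2 * res_num m r (r k)"
      have "complex_of_real (l1\<^sup>2) * ?c = ?d" "complex_of_real (l2\<^sup>2) * ?c = ?d"
        using that k(1) unfolding L_def by blast+
      moreover have "?d \<noteq> 0" using k(2) m by simp
      moreover have "x = y" if "x * c = d" "y * c = d" "d \<noteq> 0" for x y c d :: complex using that by auto
      ultimately have "complex_of_real (l1\<^sup>2) = complex_of_real (l2\<^sup>2)" by blast
      then have "l1\<^sup>2 = l2\<^sup>2" by (simp only: of_real_eq_iff)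
      then show "l1 = l2" using that by (auto simp: L_def power2_eq_iff)
    qed
    then have "L r = {} \<or> (\<exists>l. L r = {l})" by blast
    then show ?thesis by auto
  qed
  have "{l. l > 0 \<and> dilate n l q \<in> resonant_set n m R} \<subseteq> (\<Union>r\<in>Tup. L r)"
  proof
    fix l assume "l \<in> {l. l > 0 \<and> dilate n l q \<in> resonant_set n m R}"
    then have l: "l > 0" and D: "dilate n l q \<in> resonant_set n m R" by auto
    have Dn: "dilate n l q n = q n" by (simp add: dilate_apply)
    obtain \<xi> where \<xi>: "\<And>x. poly (cpoly n (dilate n l q)) x = q n * (\<Prod>i<n. x - \<xi> i)"
      "\<And>k. k \<in> {m..<n} \<Longrightarrow> gen_cond n m \<xi> (\<xi> k)"
      using D unfolding resonant_set_def mem_Collect_eq Dn by blast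
    define r where "r = restrict (\<lambda>i. \<xi> i / of_real l) {..<n}"
    have z: "\<xi> i = of_real l * r i" if "i < n" for i using l that by (simp add: r_def)
    have pd: "poly ?p x = q n * (\<Prod>i<n. x - r i)" for x
    proof -
      have "of_real l ^ n * poly ?p x = q n * (\<Prod>i<n. of_real l * x - \<xi> i)"
        using \<xi>(1)[of "of_real l * x"] by (simp add: poly_dilate)
      also have "(\<Prod>i<n. of_real l * x - \<xi> i) = (\<Prod>i<n. of_real l * (x - r i))"
        by (intro prod.cong refl) (simp add: z algebra_simps)
      also have "\<dots> = of_real l ^ n * (\<Prod>i<n. x - r i)" by (simp add: prod.distrib)
      finally show ?thesis using l by simp
    qed
    have "r \<in> Tup"
      using pd by (auto simp: Tup_def Z_def PiE_iff prod_zero_iff) (auto simp: r_def)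
    moreover have "l \<in> L r"
      unfolding L_def
    proof (intro CollectI conjI ballI l)
      fix k assume k: "k \<in> {m..<n}"
      have "gen_cond n m (\<lambda>i. of_real l * r i) (of_real l * r k) = gen_cond n m \<xi> (\<xi> k)"
        unfolding gen_cond_def res_num_def res_den_def using z m k by simp
      then have "gen_cond n m (\<lambda>i. of_real l * r i) (of_real l * r k)" using \<xi>(2)[OF k] by simp
      from gen_cond_dilate[OF l m(1) this]
      show "complex_of_real (l\<^sup>2) * (cnj (\<Sum>i<m. r i) * res_den m r (r k)) =
        of_nat n / 2 * res_num m r (r k)" .
    qed
    ultimately show "l \<in> (\<Union>r\<in>Tup. L r)" by blast
  qed
  then show ?thesis using finT finL by (meson finite_UN_I finite_subset)
qed

lemma simple_roots_outside:
  assumes "\<And>R. q \<notin> double_root_set n R" "\<And>R. q \<notin> opposite_root_set n R" "poly (cpoly n q) z = 0"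
  shows "poly (pderiv (cpoly n q)) z \<noteq> 0 \<and> poly (cpoly n q) (- z) \<noteq> 0"
proof -
  have "z \<in> cball 0 (real (nat \<lceil>norm z\<rceil>))" by (simp add: real_nat_ceiling_ge)
  then show ?thesis using assms(1,2)[of "nat \<lceil>norm z\<rceil>"] assms(3)
    unfolding double_root_set_def opposite_root_set_def by blast
qed

lemma continuous_on_dilate: "continuous_on UNIV (\<lambda>x. dilate n (fst x) (snd x))"
  unfolding dilate_apply[abs_def]
proof (rule continuous_on_coordinatewise_then_product)
  show "continuous_on UNIV (\<lambda>x. if i \<le> n then complex_of_real (fst x ^ (n - i)) * snd x i else snd x i)" for i
    by (cases "i \<le> n") (auto intro!: continuous_intros)
qed

text \<open>Fubini on pairs (l, q): for almost every q only finitely many l > 0 are resonant, so for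
  some l > 0 almost no \<open>dilate n l q\<close> is resonant. Scaling back by 1/l, a nonsingular
  diagonal map, yields the claim for q itself.\<close>

lemma thin_resonant_set:
  assumes m: "0 < m" "2 * m \<le> n" shows "thin n (resonant_set n m R)"
proof (rule thin_closed[OF closed_resonant_set])
  let ?B = "resonant_set n m R"
  have n1: "n \<ge> 1" using m by simp
  interpret pair_sigma_finite "lborel :: real measure" "cborel n"
    by (rule pair_sigma_finite.intro[OF lborel.sigma_finite_measure_axioms cps.sigma_finite[OF finite_atMost]])
  define P where "P l q \<longleftrightarrow> \<not> (l > 0 \<and> dilate n l q \<in> ?B)" for l q
  have "AE q in cborel n. q \<notin> (\<Union>R. double_root_set n R)" "AE q in cborel n. q \<notin> (\<Union>R. opposite_root_set n R)"
    by (intro thin_AE thin_UN thin_double_root_set thin_opposite_root_set n1)+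
  moreover have "AE q in cborel n. q n \<noteq> 0" by (rule AE_coordinate) simp
  ultimately have "AE q in cborel n. AE l in lborel. P l q"
  proof eventually_elim
    case (elim q)
    have "finite {l. l > 0 \<and> dilate n l q \<in> ?B}"
      using elim by (intro finite_resonant_scales m simple_roots_outside) auto
    from AE_lborel_finite[OF this] show ?case by eventually_elim (simp add: P_def)
  qed
  moreover have "{x \<in> space (lborel \<Otimes>\<^sub>M cborel n). P (fst x) (snd x)} \<in> sets (lborel \<Otimes>\<^sub>M cborel n)"
  proof -
    have "(\<lambda>x. (fst x, snd x)) \<in> (lborel :: real measure) \<Otimes>\<^sub>M cborel n \<rightarrow>\<^sub>M borel \<Otimes>\<^sub>M (borel :: cseq measure)"
      by (intro measurable_Pair measurable_compose[OF measurable_snd id_measurable_PiM] measurable_compose[OF measurable_fst]) simp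
    then have id: "(\<lambda>x. x) \<in> (lborel :: real measure) \<Otimes>\<^sub>M cborel n \<rightarrow>\<^sub>M (borel :: (real \<times> cseq) measure)"
      by (simp add: borel_prod)
    have "{x :: real \<times> cseq. fst x > 0} \<inter> (\<lambda>x. dilate n (fst x) (snd x)) -` ?B \<in> sets borel"
      by (intro sets.Int borel_open borel_closed closed_vimage closed_resonant_set continuous_on_dilate open_Collect_less continuous_intros)
    from measurable_sets[OF id this]
    have "({x. fst x > 0} \<inter> (\<lambda>x. dilate n (fst x) (snd x)) -` ?B) \<inter> space (lborel \<Otimes>\<^sub>M cborel n) \<in> sets (lborel \<Otimes>\<^sub>M cborel n)"
      by simp
    then have "space (lborel \<Otimes>\<^sub>M cborel n) - ({x. fst x > 0} \<inter> (\<lambda>x. dilate n (fst x) (snd x)) -` ?B) \<inter> space (lborel \<Otimes>\<^sub>M cborel n) \<in> sets (lborel \<Otimes>\<^sub>M cborel n)"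
      by (rule sets.compl_sets)
    moreover have "space (lborel \<Otimes>\<^sub>M cborel n) - ({x. fst x > 0} \<inter> (\<lambda>x. dilate n (fst x) (snd x)) -` ?B) \<inter> space (lborel \<Otimes>\<^sub>M cborel n)
      = {x \<in> space (lborel \<Otimes>\<^sub>M cborel n). P (fst x) (snd x)}"
      by (auto simp: P_def)
    ultimately show ?thesis by simp
  qed
  ultimately have AE: "AE l in lborel. AE q in cborel n. P l q" by (simp add: AE_commute)
  have "\<exists>l>0. AE q in cborel n. P l q"
  proof (rule ccontr)
    assume "\<not> ?thesis"
    then have "AE l in lborel. l \<notin> {0<..<1::real}" using AE by (auto elim!: eventually_mono)
    then have "{0<..<1::real} \<in> null_sets lborel" by (subst AE_iff_null_sets) auto
    then show False by (simp add: null_sets_def)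
  qed
  then obtain l where l: "l > 0" "AE q in cborel n. P l q" by blast
  define G where "G = dilate n l -` ?B"
  have "closed G" unfolding G_def dilate_def[abs_def]
    by (rule closed_vimage[OF closed_resonant_set]) (rule continuous_on_triangular)
  moreover have "AE q in cborel n. q \<notin> G" using l(2) by eventually_elim (use l(1) in \<open>simp add: P_def G_def\<close>)
  ultimately have "AE q in cborel n. dilate n (1 / l) q \<notin> G"
    unfolding dilate_def by (rule AE_triangular) (use l in simp)
  then show "AE q in cborel n. q \<notin> ?B" using l(1) by (simp add: G_def dilate_dilate)
qed

lemma thin_not_generic: "thin n {q. \<not> generic n (cpoly n q)}"
proof -
  have t0: "thin n {q. q n = 0}"
    by (rule thin_closed[OF closed_coordinate_zero]) (use AE_coordinate[OF order_refl, of n] in simp)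
  show ?thesis
  proof (cases "n = 0")
    case True
    have "generic 0 (cpoly 0 q)" if "q 0 \<noteq> 0" for q
    proof -
      have "cpoly 0 q = [:q 0:]" by (simp add: cpoly_def monom_0)
      then show ?thesis using that by (auto simp: generic_def)
    qed
    then have "{q. \<not> generic n (cpoly n q)} \<subseteq> {q. q n = 0}" using True by blast
    then show ?thesis by (rule thin_subset[OF t0])
  next
    case False
    define B where "B = {q. q n = 0} \<union> (\<Union>R. double_root_set n R) \<union> (\<Union>R. opposite_root_set n R)
      \<union> (\<Union>m. \<Union>R. if 0 < m \<and> 2 * m \<le> n then resonant_set n m R else {})"
    have e: "thin n {}" by (rule thin_subset[OF t0]) simp
    have "thin n B" unfolding B_def using False e
      by (intro thin_Un thin_UN t0 thin_double_root_set thin_opposite_root_set) (auto intro: thin_resonant_set)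
    have "generic n (cpoly n q)" if q: "q \<notin> B" for q
    proof -
      have qn: "q n \<noteq> 0" using q by (auto simp: B_def)
      have d: "degree (cpoly n q) = n" using degree_cpoly qn by blast
      have lead: "lead_coeff (cpoly n q) = q n" by (simp add: d coeff_cpoly)
      have simple: "poly (cpoly n q) z = 0 \<Longrightarrow> poly (pderiv (cpoly n q)) z \<noteq> 0 \<and> poly (cpoly n q) (- z) \<noteq> 0" for z
        by (rule simple_roots_outside) (use q in \<open>auto simp: B_def\<close>)
      have "\<exists>k\<in>{m..<n}. \<not> gen_cond n m r (r k)"
        if m: "0 < m" "2 * m \<le> n" and r: "cpoly n q = smult (lead_coeff (cpoly n q)) (\<Prod>i<n. [:- r i, 1:])" for m r
      proof (rule ccontr)
        assume A: "\<not> ?thesis"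
        define R where "R = nat \<lceil>\<Sum>i<n. norm (r i)\<rceil>"
        \<comment> \<open>The value 0 from n on keeps the whole sequence in the ball of radius
          R.\<close>
        define \<xi> where "\<xi> i = (if i < n then r i else 0)" for i
        have "norm (r i) \<le> real R" if "i < n" for i
        proof -
          have "norm (r i) \<le> (\<Sum>i<n. norm (r i))" by (rule member_le_sum) (use that in auto)
          then show ?thesis unfolding R_def by linarith
        qed
        then have "\<xi> \<in> PiE UNIV (\<lambda>_. cball 0 (real R))" by (auto simp: \<xi>_def)
        moreover have "poly (cpoly n q) x = q n * (\<Prod>i<n. x - \<xi> i)" for x
          using arg_cong[OF r[unfolded lead], of "\<lambda>p. poly p x"] by (simp add: poly_prod \<xi>_def)
        moreover have "gen_cond n m \<xi> (\<xi> k)" if k: "k \<in> {m..<n}" for k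
        proof -
          have "gen_cond n m \<xi> (\<xi> k) = gen_cond n m r (r k)"
            unfolding gen_cond_def res_num_def res_den_def using m k by (simp add: \<xi>_def)
          then show ?thesis using A k by blast
        qed
        ultimately have "q \<in> resonant_set n m R" unfolding resonant_set_def by blast
        then show False using q m unfolding B_def by auto
      qed
      then show ?thesis using d qn lead simple by (auto simp: generic_def)
    qed
    then have "{q. \<not> generic n (cpoly n q)} \<subseteq> B" by blast
    with \<open>thin n B\<close> show ?thesis by (rule thin_subset)
  qed
qed

lemma heat_sum: "heat (sum f A) = (\<Sum>x\<in>A. heat (f x))"
  by (induction A rule: infinite_finite_induct) (simp_all add: heat_add)

text \<open>The transform of the monomial of degree j has degree j and leading coefficient sqrt pi,
  so on coefficients it is a triangular matrix with diagonal sqrt pi.\<close>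

lemma heat_cpoly:
  "heat (cpoly n p) = cpoly n (triangular n (\<lambda>_. sqrt pi) (\<lambda>i j. coeff (heat (monom 1 j)) i) p)"
proof (rule poly_eqI)
  fix i
  have c: "coeff (heat (cpoly n p)) i = (\<Sum>j\<le>n. p j * coeff (heat (monom 1 j)) i)"
  proof -
    have "heat (monom a j) = smult a (heat (monom 1 j))" for a j
      using heat_smult[of a "monom 1 j"] by (simp only: smult_monom mult_1_right)
    then have "heat (cpoly n p) = (\<Sum>j\<le>n. smult (p j) (heat (monom 1 j)))"
      unfolding cpoly_def heat_sum by (intro sum.cong refl)
    then show ?thesis by (simp only: coeff_sum coeff_smult)
  qed
  show "coeff (heat (cpoly n p)) i = coeff (cpoly n (triangular n (\<lambda>_. sqrt pi) (\<lambda>i j. coeff (heat (monom 1 j)) i) p)) i"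
  proof (cases "i \<le> n")
    case False
    then show ?thesis
      using degree_cpoly_le[of n p] by (simp add: coeff_cpoly coeff_eq_0)
  next
    case True
    have "(\<Sum>j\<le>n. p j * coeff (heat (monom 1 j)) i) = (\<Sum>j\<in>insert i {i<..n}. p j * coeff (heat (monom 1 j)) i)"
      using True by (intro sum.mono_neutral_right) (auto simp: coeff_eq_0 degree_monom_eq)
    also have "\<dots> = p i * of_real (sqrt pi) + (\<Sum>j\<in>{i<..n}. coeff (heat (monom 1 j)) i * p j)"
      using coeff_heat_aux[of "monom 1 i" i] by (simp add: degree_monom_le mult.commute)
    finally show ?thesis using True by (simp add: c coeff_cpoly triangular_def scaleR_conv_of_real mult.commute)
  qed
qed

theorem thin_not_generic_heat: "thin n {p. \<not> generic n (heat (cpoly n p))}"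
  using thin_triangular_vimage[OF thin_not_generic, of n "\<lambda>_. sqrt pi"] by (simp add: heat_cpoly vimage_def)

section \<open>Entire functions of quadratic exponential growth\<close>

lemma polynomial_growth_imp_poly:
  assumes hol: "f holomorphic_on UNIV" and bd: "\<And>z. r \<le> norm z \<Longrightarrow> norm (f z) \<le> C * (1 + norm z) ^ k"
  shows "\<exists>M. \<forall>z. f z = poly M z"
proof -
  have "norm (f z) \<le> (\<bar>C\<bar> * 2 ^ k) * norm z ^ k" if "max r 1 \<le> norm z" for z
  proof -
    have "norm (f z) \<le> C * (1 + norm z) ^ k" using bd that by simp
    also have "\<dots> \<le> \<bar>C\<bar> * (1 + norm z) ^ k" by (intro mult_right_mono) auto
    also have "\<dots> \<le> \<bar>C\<bar> * (2 * norm z) ^ k" using that by (intro mult_left_mono power_mono) auto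
    finally show ?thesis by (simp add: power_mult_distrib mult_ac)
  qed
  from Liouville_polynomial[OF hol this]
  have "f z = (\<Sum>j\<le>k. (deriv ^^ j) f 0 / fact j * z ^ j)" for z .
  then have "f z = poly (cpoly k (\<lambda>j. (deriv ^^ j) f 0 / fact j)) z" for z
    by (simp add: poly_cpoly)
  then show ?thesis by blast
qed

lemma holomorphic_on_scaled:
  assumes "f holomorphic_on UNIV" shows "(\<lambda>z. f (c * z)) holomorphic_on S"
  using holomorphic_on_compose_gen[of "\<lambda>z. c * z" S f UNIV] assms by (simp add: o_def holomorphic_intros)

text \<open>A zero of \<open>g\<close> is a zero of \<open>M\<close>; dividing both by the linear
  factor lowers the degree of \<open>M\<close>. So \<open>g\<close> has finitely many zeros.\<close>

lemma entire_factor_out_zeros: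
  assumes "g holomorphic_on UNIV" "f holomorphic_on UNIV" "\<And>z. g z * f z = poly M z" "M \<noteq> 0"
  shows "\<exists>p h. p \<noteq> 0 \<and> h holomorphic_on UNIV \<and> (\<forall>z. h z \<noteq> 0) \<and> (\<forall>z. g z = poly p z * h z)"
  using assms
proof (induction "degree M" arbitrary: M g rule: less_induct)
  case less
  show ?case
  proof (cases "\<exists>a. g a = 0")
    case False
    then show ?thesis using less by (intro exI[of _ 1] exI[of _ g]) auto
  next
    case True
    then obtain a where a: "g a = 0" ..
    define g1 where "g1 z = (if z = a then deriv g a else (g z - g a) / (z - a))" for z
    have hol: "g1 holomorphic_on UNIV" unfolding g1_def using less(2) by (intro pole_lemma) auto
    have g: "g z = (z - a) * g1 z" for z using a by (simp add: g1_def)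
    have "poly M a = 0" using less(4)[of a] a by simp
    then obtain M' where M': "M = [:- a, 1:] * M'" by (metis dvdE poly_eq_0_iff_dvd)
    have M'0: "M' \<noteq> 0" using less(5) M' by auto
    have d: "degree M' < degree M" unfolding M' using M'0 by (subst degree_mult_eq) auto
    have ne: "g1 z * f z = poly M' z" if "z \<noteq> a" for z
    proof -
      have "(z - a) * (g1 z * f z) = (z - a) * poly M' z"
        using less(4)[of z] by (simp add: g M' algebra_simps)
      then show ?thesis using that by simp
    qed
    have "g1 z * f z - poly M' z = 0" for z
    proof (rule analytic_continuation_open[of "UNIV - {a}" UNIV "\<lambda>z. g1 z * f z - poly M' z" "\<lambda>_. 0"])
      show "UNIV - {a} \<noteq> {}" by (metis Diff_eq_empty_iff UNIV_I finite.emptyI finite_insert infinite_UNIV_char_0 rev_finite_subset)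
      show "(\<lambda>z. g1 z * f z - poly M' z) holomorphic_on UNIV"
        unfolding poly_altdef using hol less(3) by (intro holomorphic_intros)
    qed (use ne in auto)
    then have "\<And>z. g1 z * f z = poly M' z" by simp
    from less(1)[OF d hol less(3) this M'0] obtain p h where
      ph: "p \<noteq> 0" "h holomorphic_on UNIV" "\<forall>z. h z \<noteq> 0" "\<forall>z. g1 z = poly p z * h z" by blast
    have "[:- a, 1:] * p \<noteq> 0" using ph(1) by (simp only: mult_eq_0_iff) simp
    moreover have "g z = poly ([:- a, 1:] * p) z * h z" for z
      using ph(4) by (simp only: poly_mult g) simp
    ultimately show ?thesis using ph(2,3) by blast
  qed
qed

lemma poly_lower_bound:
  fixes p :: "complex poly"
  assumes "p \<noteq> 0"
  shows "\<exists>r c. c > 0 \<and> (\<forall>z. r \<le> norm z \<longrightarrow> c \<le> norm (poly p z))"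
proof (cases p)
  case (pCons a q)
  show ?thesis
  proof (cases "q = 0")
    case True
    then show ?thesis using assms pCons by (intro exI[of _ 0] exI[of _ "norm a"]) auto
  next
    case False
    from poly_infinity[OF False, of 1 a] show ?thesis using pCons by (metis zero_less_one)
  qed
qed

text \<open>On the disc of radius 2 |z| the upper bound for the real part yields a bound for |k(z)|
  of order 1 + |z|^2, and Liouville for polynomial growth applies.\<close>

lemma Borel_Caratheodory_quadratic:
  assumes k: "k holomorphic_on UNIV" and bd: "\<And>z. Re (k z) \<le> a + b * (norm z)\<^sup>2"
  shows "\<exists>k0 k1 k2. \<forall>z. k z = k0 + k1 * z + k2 * z\<^sup>2"
proof -
  define f where "f z = k z - k 0" for z
  \<comment> \<open>An upper bound for Re f on the disc of radius 2 s; the summand 1 makes it strict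
    and positive.\<close>
  define A where "A s = \<bar>a\<bar> + norm (k 0) + 1 + \<bar>b\<bar> * (2 * s)\<^sup>2" for s
  have Apos: "A s > 0" for s
  proof -
    have "0 \<le> \<bar>b\<bar> * (2 * s)\<^sup>2" by simp
    then show ?thesis unfolding A_def by (smt (verit) norm_ge_zero abs_ge_zero)
  qed
  have Re_f: "Re (f z) < A s" if "norm z \<le> 2 * s" for z s
  proof -
    have "b * (norm z)\<^sup>2 \<le> \<bar>b\<bar> * (2 * s)\<^sup>2"
      using that by (intro mult_mono power_mono) auto
    moreover have "- Re (k 0) \<le> norm (k 0)" using abs_Re_le_cmod[of "k 0"] by linarith
    ultimately show ?thesis using bd[of z] unfolding f_def A_def by simp
  qed
  have fb: "norm (f z) \<le> 2 * A (norm z)" if "z \<noteq> 0" for z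
  proof -
    define s where "s = norm z"
    have s: "s > 0" using that by (simp add: s_def)
    txt \<open>The Schwarz lemma applies to \<open>\<phi>\<close> because \<open>Re f < A\<close> means that \<open>f\<close> is closer to \<open>0\<close> than to \<open>2 A\<close>.\<close>
    define \<phi> where "\<phi> w = f (of_real (2 * s) * w) / (2 * of_real (A s) - f (of_real (2 * s) * w))" for w
    have key: "norm (f w) < norm (2 * of_real (A s) - f w)" if "norm w \<le> 2 * s" for w
    proof -
      have "(norm (2 * of_real (A s) - f w))\<^sup>2 - (norm (f w))\<^sup>2 = 4 * A s * (A s - Re (f w))"
        by (simp add: cmod_power2) (simp add: power2_eq_square algebra_simps)
      moreover have "4 * A s * (A s - Re (f w)) > 0" using Apos[of s] Re_f[OF that] by simp
      ultimately have "(norm (f w))\<^sup>2 < (norm (2 * of_real (A s) - f w))\<^sup>2" by linarith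
      then show ?thesis by (rule power_less_imp_less_base) simp
    qed
    have nw: "norm (of_real (2 * s) * w) \<le> 2 * s" if "norm w < 1" for w :: complex
      using that s by (simp add: norm_mult)
    have "norm (\<phi> (z / of_real (2 * s))) \<le> norm (z / of_real (2 * s))"
    proof (rule Schwarz_Lemma(1)[of \<phi>])
      have fh: "f holomorphic_on UNIV" unfolding f_def by (intro holomorphic_intros k)
      have "(\<lambda>w. f (of_real (2 * s) * w)) holomorphic_on ball 0 1"
        by (rule holomorphic_on_scaled[OF fh])
      then show "\<phi> holomorphic_on ball 0 1"
        unfolding \<phi>_def using key[OF nw] by (intro holomorphic_intros) force+
      show "\<phi> 0 = 0" by (simp add: \<phi>_def f_def)
      show "norm (\<phi> w) < 1" if "norm w < 1" for w
        using key[OF nw[OF that]] unfolding \<phi>_def norm_divide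
        by (simp add: divide_less_eq_1)
      show "norm (z / of_real (2 * s)) < 1" using s by (simp add: norm_divide s_def)
    qed
    \<comment> \<open>z lies at half the radius of the disc. The factor 1/2 gives 2 |f(z)| <= 2 A +
      |f(z)|, from which |f(z)| <= 2 A.\<close>
    also have "norm (z / of_real (2 * s)) = 1 / 2" using s by (simp add: norm_divide s_def)
    also have "z / of_real (2 * s) * of_real (2 * s) = z" using s by simp
    then have "\<phi> (z / of_real (2 * s)) = f z / (2 * of_real (A s) - f z)"
      unfolding \<phi>_def by (simp add: mult.commute)
    finally have "norm (f z) / norm (2 * of_real (A s) - f z) \<le> 1 / 2" by (simp add: norm_divide)
    moreover have "norm (2 * of_real (A s) - f z) > 0"
      using key[of z] s norm_ge_zero[of "f z"] unfolding s_def by linarith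
    ultimately have "2 * norm (f z) \<le> norm (2 * of_real (A s) - f z)" by (simp add: divide_le_eq)
    also have "\<dots> \<le> 2 * A s + norm (f z)"
      using norm_triangle_ineq4[of "2 * of_real (A s)" "f z"] Apos[of s] by (simp add: norm_mult)
    finally show ?thesis by (simp add: s_def)
  qed
  have kb: "norm (k z) \<le> (2 * (\<bar>a\<bar> + norm (k 0) + 1) + norm (k 0) + 8 * \<bar>b\<bar>) * norm z ^ 2" if "1 \<le> norm z" for z
  proof -
    have z2: "1 \<le> (norm z)\<^sup>2" using that by simp
    have "norm (k z) \<le> norm (f z) + norm (k 0)" unfolding f_def using norm_triangle_ineq2[of "k z" "k 0"] by simp
    also have "norm (f z) \<le> 2 * A (norm z)" using that by (intro fb) auto
    also have "2 * A (norm z) + norm (k 0) = (2 * (\<bar>a\<bar> + norm (k 0) + 1) + norm (k 0)) * 1 + 8 * \<bar>b\<bar> * (norm z)\<^sup>2"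
      by (simp add: A_def power_mult_distrib)
    also have "\<dots> \<le> (2 * (\<bar>a\<bar> + norm (k 0) + 1) + norm (k 0)) * (norm z)\<^sup>2 + 8 * \<bar>b\<bar> * (norm z)\<^sup>2"
      using z2 by (intro add_right_mono mult_left_mono) auto
    finally show ?thesis by (simp add: algebra_simps)
  qed
  define c :: "nat \<Rightarrow> complex" where "c j = (deriv ^^ j) k 0 / fact j" for j
  have s3: "(\<Sum>j\<le>2. F j) = F 0 + F 1 + F 2" for F :: "nat \<Rightarrow> complex"
    by (simp add: numeral_2_eq_2)
  have "k z = c 0 + c 1 * z + c 2 * z\<^sup>2" for z
  proof -
    have "k z = (\<Sum>j\<le>2. (deriv ^^ j) k 0 / fact j * z ^ j)" by (rule Liouville_polynomial[OF k kb])
    then show ?thesis unfolding s3 c_def[symmetric] by simp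
  qed
  then show ?thesis by blast
qed

theorem entire_quadratic_growth_poly_symmetric_product:
  fixes g :: "complex \<Rightarrow> complex"
  assumes hol: "g holomorphic_on UNIV" and growth: "\<And>z. norm (g z) \<le> exp (K * (1 + (norm z)\<^sup>2))"
    and prod: "\<And>z. norm (g z * g (- z)) \<le> C * (1 + norm z) ^ N"
    and nz: "g z0 \<noteq> 0"
  shows "\<exists>p b. p \<noteq> 0 \<and> (\<forall>z. g z = poly p z * exp (b * z))"
proof -
  have hol': "(\<lambda>z. g (- z)) holomorphic_on UNIV"
    using holomorphic_on_scaled[OF hol, of "-1"] by simp
  have "(\<lambda>z. g z * g (- z)) holomorphic_on UNIV" using hol hol' by (rule holomorphic_on_mult)
  from polynomial_growth_imp_poly[OF this, of 0] prod obtain M where M: "\<And>z. g z * g (- z) = poly M z" by blast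
  \<comment> \<open>Since \<open>g\<close> is nonzero near z0, a vanishing product would make it
    zero near -z0 and hence everywhere.\<close>
  have "M \<noteq> 0"
  proof
    assume "M = 0"
    then have z: "g z * g (- z) = 0" for z using M by simp
    have "isCont g z0" using hol by (metis UNIV_I holomorphic_on_imp_continuous_on continuous_on_eq_continuous_at open_UNIV)
    then obtain e where e: "e > 0" "\<And>z. z \<in> ball z0 e \<Longrightarrow> g z \<noteq> 0"
      using nz continuous_at_avoid[of z0 g 0] by (auto simp: dist_commute)
    have "g z0 = 0"
    proof (rule analytic_continuation_open[of "ball (- z0) e" UNIV g "\<lambda>_. 0"])
      fix z assume "z \<in> ball (- z0) e"
      then have "- z \<in> ball z0 e" by (simp add: dist_norm norm_minus_commute add.commute)
      then show "g z = 0" using e(2) z[of z] by auto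
    qed (use hol e in auto)
    then show False using nz by simp
  qed
  from entire_factor_out_zeros[OF hol hol' M this] obtain p h where
    p: "p \<noteq> 0" and h: "h holomorphic_on UNIV" "\<And>z. h z \<noteq> 0" and g: "\<And>z. g z = poly p z * h z" by blast
  obtain r c where c: "c > 0" "\<And>z. r \<le> norm z \<Longrightarrow> c \<le> norm (poly p z)"
    using poly_lower_bound[OF p] by blast
  obtain k where k: "k holomorphic_on UNIV" "\<And>z. exp (k z) = h z"
    by (rule holomorphic_logarithm_exists[OF convex_UNIV open_UNIV h(1)]) (use h in auto)
  have "compact (cball (0::complex) r)" by simp
  then have "bounded (h ` cball 0 r)"
    using h(1) by (intro compact_imp_bounded compact_continuous_image) (auto intro: holomorphic_on_imp_continuous_on holomorphic_on_subset)
  then obtain B where B: "\<And>z. norm z \<le> r \<Longrightarrow> norm (h z) \<le> B" unfolding bounded_iff by (metis imageI mem_cball_0)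
  \<comment> \<open>Inside the disc of radius r, \<open>h\<close> is bounded by compactness;
    outside, |p| >= c transfers the growth bound from \<open>g\<close> to \<open>h\<close>.\<close>
  have Re: "Re (k z) \<le> (ln (\<bar>B\<bar> + 1) + \<bar>K\<bar> + \<bar>ln c\<bar>) + \<bar>K\<bar> * (norm z)\<^sup>2" for z
  proof -
    have e: "Re (k z) = ln (norm (h z))" using k(2)[of z] by (metis ln_exp norm_exp_eq_Re)
    have lnB: "ln (\<bar>B\<bar> + 1) \<ge> 0" by simp
    have K0: "0 \<le> \<bar>K\<bar> * (norm z)\<^sup>2" by simp
    show ?thesis
    proof (cases "norm z \<le> r")
      case True
      have "ln (norm (h z)) \<le> ln (\<bar>B\<bar> + 1)" using B[OF True] h(2)[of z] by (subst ln_le_cancel_iff) auto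
      then show ?thesis using e K0 by linarith
    next
      case False
      have "c * norm (h z) \<le> norm (poly p z) * norm (h z)" using c(2)[of z] False by (intro mult_right_mono) auto
      also have "\<dots> = norm (g z)" by (simp add: g norm_mult)
      also have "\<dots> \<le> exp (K * (1 + (norm z)\<^sup>2))" by (rule growth)
      finally have "ln (c * norm (h z)) \<le> K * (1 + (norm z)\<^sup>2)"
        using c(1) h(2)[of z] by (metis ln_exp ln_mono mult_pos_pos zero_less_norm_iff exp_gt_zero)
      then have "ln c + ln (norm (h z)) \<le> K * (1 + (norm z)\<^sup>2)" using c(1) h(2)[of z] by (simp add: ln_mult)
      also have "\<dots> \<le> \<bar>K\<bar> * (1 + (norm z)\<^sup>2)" by (intro mult_right_mono) auto
      also have "\<dots> = \<bar>K\<bar> + \<bar>K\<bar> * (norm z)\<^sup>2" by (simp add: algebra_simps)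
      finally show ?thesis using e lnB abs_ge_minus_self[of "ln c"] by linarith
    qed
  qed
  from Borel_Caratheodory_quadratic[OF k(1) this] obtain k0 k1 k2 where kq: "\<And>z. k z = k0 + k1 * z + k2 * z\<^sup>2" by blast
  have hh: "h z * h (- z) = exp (2 * k0 + 2 * k2 * z\<^sup>2)" for z
    unfolding k(2)[symmetric] kq exp_add[symmetric] by (rule arg_cong[of _ _ exp]) (simp add: algebra_simps)
  have "\<exists>T. \<forall>z. h z * h (- z) = poly T z"
  proof (rule polynomial_growth_imp_poly)
    show "(\<lambda>z. h z * h (- z)) holomorphic_on UNIV" unfolding hh by (intro holomorphic_intros)
    fix z :: complex assume z: "r \<le> norm z"
    have "c * c * norm (h z * h (- z)) \<le> norm (poly p z) * norm (poly p (- z)) * norm (h z * h (- z))"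
      using c(1) c(2)[of z] c(2)[of "- z"] z by (intro mult_right_mono mult_mono) auto
    also have "\<dots> = norm (g z * g (- z))" by (simp add: g norm_mult)
    also have "\<dots> \<le> C * (1 + norm z) ^ N" by (rule prod)
    finally show "norm (h z * h (- z)) \<le> C / (c * c) * (1 + norm z) ^ N" using c(1) by (simp add: field_simps)
  qed
  then obtain T where T: "\<And>z. h z * h (- z) = poly T z" by blast
  \<comment> \<open>h(z) h(-z) has polynomial growth and is thus a polynomial; having no zeros, it
    is constant.\<close>
  have "constant (poly T)"
    using Fundamental_Theorem_Algebra.fundamental_theorem_of_algebra[of T] T h(2) by (metis mult_eq_0_iff)
  then have cst: "exp (2 * k0 + 2 * k2 * z\<^sup>2) = exp (2 * k0)" for z
  proof -
    have "poly T z = poly T 0" using \<open>constant (poly T)\<close> unfolding constant_def by blast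
    then show ?thesis using T[of z] T[of 0] hh[of z] hh[of 0] by simp
  qed
  have "k2 = 0"
  proof (rule ccontr)
    assume "k2 \<noteq> 0"
    \<comment> \<open>Chosen so that the exponent exceeds 2 k0 by exactly 1.\<close>
    define z where "z = csqrt (1 / (2 * k2))"
    have "2 * k2 * z\<^sup>2 = 1" using \<open>k2 \<noteq> 0\<close> by (simp add: z_def)
    then have "exp (2 * k0) * exp 1 = exp (2 * k0)" using cst[of z] by (simp add: exp_add)
    then have "exp (1::complex) = 1" by simp
    then have "norm (exp (1::complex)) = 1" by simp
    then show False by simp
  qed
  then have "g z = poly (smult (exp k0) p) z * exp (k1 * z)" for z
    by (simp add: g k(2)[symmetric] kq exp_add)
  moreover have "smult (exp k0) p \<noteq> 0" using p by simp
  ultimately show ?thesis by blast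
qed

section \<open>The Bargmann transform\<close>

abbreviation barg_ker :: "complex \<Rightarrow> real \<Rightarrow> complex" where
  "barg_ker z t \<equiv> exp (2 * z * of_real t - (of_real t)\<^sup>2 / 2)"

text \<open>Up to a constant, the Bargmann transform in the variable sqrt 2 z without its factor
  exp(-z^2). With that factor restored, P(t) exp(-t^2/2) is mapped exactly to
  \<open>heat P\<close>.\<close>

definition barg :: "(real \<Rightarrow> complex) \<Rightarrow> complex \<Rightarrow> complex" where
  "barg v z = (LINT t|lborel. v t * barg_ker z t)"

text \<open>Borel measurable functions over \<open>lborel\<close> allow Fubini and substitutions
  directly; the passage from Lebesgue measurable functions is made at the end.\<close>

definition L2 :: "(real \<Rightarrow> complex) \<Rightarrow> bool" where
  "L2 v \<longleftrightarrow> v \<in> borel_measurable borel \<and> integrable lborel (\<lambda>t. (norm (v t))\<^sup>2)"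

lemma L2_measurable [measurable_dest]: "L2 v \<Longrightarrow> v \<in> borel_measurable borel"
  by (simp add: L2_def)

lemma integrable_real_gauss: "integrable lborel (\<lambda>t. exp (a * t - t\<^sup>2) :: real)"
proof -
  have "integrable lborel (\<lambda>t. norm (poly 1 (complex_of_real t) * exp (- (of_real t)\<^sup>2 + of_real a * of_real t)))"
    by (intro integrable_norm gint_integrable)
  then show ?thesis by (simp add: norm_mult add.commute power2_eq_square)
qed

lemma integral_real_gauss: "(LINT t|lborel. exp (a * t - t\<^sup>2)) = sqrt pi * exp (a\<^sup>2 / 4)"
proof -
  have "complex_of_real (LINT t|lborel. exp (a * t - t\<^sup>2)) = gint (of_real a) 1"
    unfolding gint_def by (subst integral_complex_of_real[symmetric]) (simp add: exp_of_real[symmetric] add.commute del: exp_of_real)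
  also have "\<dots> = of_real (sqrt pi * exp (a\<^sup>2 / 4))" by (simp add: gint_1 exp_of_real[symmetric] del: exp_of_real)
  finally show ?thesis by (simp only: of_real_eq_iff)
qed

lemma norm_gauss_factor: "norm (barg_ker z t) = exp (2 * Re z * t - t\<^sup>2 / 2)"
  by (simp add: power2_eq_square)

lemma barg_dominated:
  "norm (v t * barg_ker z t) \<le> ((norm (v t))\<^sup>2 + exp (4 * Re z * t - t\<^sup>2)) / 2"
proof -
  have "(exp (2 * Re z * t - t\<^sup>2 / 2))\<^sup>2 = exp (4 * Re z * t - t\<^sup>2)"
    by (simp add: power2_eq_square flip: exp_add)
  moreover have "2 * a * b \<le> a\<^sup>2 + b\<^sup>2" for a b :: real
    using sum_squares_bound[of a b] by simp
  ultimately have "2 * norm (v t) * exp (2 * Re z * t - t\<^sup>2 / 2) \<le> (norm (v t))\<^sup>2 + exp (4 * Re z * t - t\<^sup>2)"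
    by metis
  then show ?thesis unfolding norm_mult norm_gauss_factor by simp
qed

lemma barg_integrable:
  assumes v: "L2 v"
  shows "integrable lborel (\<lambda>t. v t * barg_ker z t)"
proof (rule Bochner_Integration.integrable_bound)
  show "integrable lborel (\<lambda>t. ((norm (v t))\<^sup>2 + exp (4 * Re z * t - t\<^sup>2)) / 2)"
    using v integrable_real_gauss[of "4 * Re z"] unfolding L2_def by (intro integrable_divide_zero Bochner_Integration.integrable_add) auto
  show "(\<lambda>t. v t * barg_ker z t) \<in> borel_measurable lborel"
    using L2_measurable[OF v] by measurable
  show "AE t in lborel. norm (v t * barg_ker z t)
      \<le> norm (((norm (v t))\<^sup>2 + exp (4 * Re z * t - t\<^sup>2)) / 2)"
    by (intro AE_I2 order_trans[OF barg_dominated]) simp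
qed

lemma barg_growth:
  assumes v: "L2 v"
  shows "\<exists>K. \<forall>z. norm (barg v z * exp (- z\<^sup>2)) \<le> exp (K * (1 + (norm z)\<^sup>2))"
proof -
  define N where "N = (LINT t|lborel. (norm (v t))\<^sup>2)"
  have N: "N \<ge> 0" unfolding N_def by simp
  \<comment> \<open>The integral of exp(4 Re z t - t^2) contributes at most sqrt pi exp(4 |z|^2),
    and the factor exp(-z^2) at most exp(|z|^2); together they give 5.\<close>
  define K where "K = ln (1 + N + sqrt pi) + 5"
  have K0: "ln (1 + N + sqrt pi) \<ge> 0" using N by simp
  have "norm (barg v z * exp (- z\<^sup>2)) \<le> exp (K * (1 + (norm z)\<^sup>2))" for z
  proof -
    have i: "integrable lborel (\<lambda>t. (norm (v t))\<^sup>2)" using v by (simp add: L2_def)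
    have "norm (barg v z) \<le> (LINT t|lborel. norm (v t * barg_ker z t))"
      unfolding barg_def by (rule integral_norm_bound)
    also have "\<dots> \<le> (LINT t|lborel. ((norm (v t))\<^sup>2 + exp (4 * Re z * t - t\<^sup>2)) / 2)"
      using i integrable_real_gauss[of "4 * Re z"]
      by (intro integral_mono barg_dominated integrable_norm barg_integrable[OF v] integrable_divide_zero Bochner_Integration.integrable_add) auto
    also have "\<dots> = (N + sqrt pi * exp (4 * (Re z)\<^sup>2)) / 2"
      using i integrable_real_gauss[of "4 * Re z"] integral_real_gauss[of "4 * Re z"] unfolding N_def by (simp add: power_mult_distrib)
    also have "\<dots> \<le> (1 + N + sqrt pi) * exp (4 * (norm z)\<^sup>2)"
    proof -
      have "(Re z)\<^sup>2 \<le> (norm z)\<^sup>2" using abs_Re_le_cmod[of z] by (metis abs_norm_cancel power2_le_iff_abs_le abs_ge_zero power2_abs power_mono)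
      then have 1: "exp (4 * (Re z)\<^sup>2) \<le> exp (4 * (norm z)\<^sup>2)" by simp
      have 2: "1 \<le> exp (4 * (norm z)\<^sup>2)" by simp
      have "N \<le> N * exp (4 * (norm z)\<^sup>2)" using mult_left_mono[OF 2 N] by simp
      moreover have "sqrt pi * exp (4 * (Re z)\<^sup>2) \<le> sqrt pi * exp (4 * (norm z)\<^sup>2)" using 1 by (intro mult_left_mono) auto
      moreover have "(1 + N + sqrt pi) * exp (4 * (norm z)\<^sup>2) = exp (4 * (norm z)\<^sup>2) + N * exp (4 * (norm z)\<^sup>2) + sqrt pi * exp (4 * (norm z)\<^sup>2)"
        by (simp add: algebra_simps)
      moreover have "0 \<le> N * exp (4 * (norm z)\<^sup>2)" "0 \<le> sqrt pi * exp (4 * (norm z)\<^sup>2)" "0 \<le> exp (4 * (norm z)\<^sup>2)" using N by auto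
      moreover have "(x + y) / 2 \<le> R" if "x \<le> x'" "y \<le> y'" "R = e + x' + y'" "0 \<le> x'" "0 \<le> y'" "0 \<le> e" for x y x' y' e R :: real
        using that by argo
      ultimately show ?thesis by blast
    qed
    finally have b: "norm (barg v z) \<le> (1 + N + sqrt pi) * exp (4 * (norm z)\<^sup>2)" .
    have "norm (exp (- z\<^sup>2)) \<le> exp ((norm z)\<^sup>2)"
      using norm_exp[of "- z\<^sup>2"] by (simp add: norm_power)
    then have "norm (barg v z * exp (- z\<^sup>2)) \<le> (1 + N + sqrt pi) * exp (4 * (norm z)\<^sup>2) * exp ((norm z)\<^sup>2)"
      unfolding norm_mult using N by (intro mult_mono b) auto
    also have "\<dots> = exp (ln (1 + N + sqrt pi) + 5 * (norm z)\<^sup>2)"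
    proof -
      have "exp (ln (1 + N + sqrt pi)) = 1 + N + sqrt pi"
        by (rule exp_ln) (use N in \<open>simp add: add_pos_nonneg\<close>)
      moreover have "exp (5 * x) = exp (4 * x) * exp x" for x :: real
        by (simp flip: exp_add)
      ultimately show ?thesis by (simp only: exp_add mult.assoc)
    qed
    also have "\<dots> \<le> exp (K * (1 + (norm z)\<^sup>2))"
      using K0 by (simp add: K_def algebra_simps)
    finally show ?thesis .
  qed
  then show ?thesis by blast
qed

lemma integrable_abs_gauss:
  assumes v: "L2 v"
  shows "integrable lborel (\<lambda>t. norm (v t) * exp (2 * r * \<bar>t\<bar> - t\<^sup>2 / 2))"
proof (rule Bochner_Integration.integrable_bound)
  have "integrable lborel (\<lambda>t. norm (v t) * exp (2 * s * t - t\<^sup>2 / 2))" for s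
    using integrable_norm[OF barg_integrable[OF v, of "of_real s"]]
    unfolding norm_mult norm_gauss_factor by simp
  from Bochner_Integration.integrable_add[OF this[of r] this[of "- r"]]
  show "integrable lborel (\<lambda>t. norm (v t) * exp (2 * r * t - t\<^sup>2 / 2) + norm (v t) * exp (2 * (- r) * t - t\<^sup>2 / 2))" .
  show "(\<lambda>t. norm (v t) * exp (2 * r * \<bar>t\<bar> - t\<^sup>2 / 2)) \<in> borel_measurable lborel"
    using L2_measurable[OF v] by measurable
  show "AE t in lborel. norm (norm (v t) * exp (2 * r * \<bar>t\<bar> - t\<^sup>2 / 2))
     \<le> norm (norm (v t) * exp (2 * r * t - t\<^sup>2 / 2) + norm (v t) * exp (2 * (- r) * t - t\<^sup>2 / 2))"
  proof (intro AE_I2)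
    fix t
    have "0 \<le> norm (v t) * exp (2 * r * t - t\<^sup>2 / 2)" "0 \<le> norm (v t) * exp (2 * (- r) * t - t\<^sup>2 / 2)" by auto
    then show "norm (norm (v t) * exp (2 * r * \<bar>t\<bar> - t\<^sup>2 / 2))
     \<le> norm (norm (v t) * exp (2 * r * t - t\<^sup>2 / 2) + norm (v t) * exp (2 * (- r) * t - t\<^sup>2 / 2))"
      by (cases "t \<ge> 0") (auto simp: abs_of_nonneg)
  qed
qed

text \<open>The factor exp(2 z t) is expanded and integrated term by term, dominated by |v(t)| exp(2
  |z| |t| - t^2/2). The power series yields holomorphy without differentiation under the
  integral.\<close>

lemma barg_sums:
  assumes v: "L2 v"
  shows "(\<lambda>k. (LINT t|lborel. v t * exp (- (of_real t)\<^sup>2 / 2) * (2 * of_real t) ^ k / fact k) * z ^ k) sums barg v z"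
proof -
  define f where "f k t = v t * exp (- (complex_of_real t)\<^sup>2 / 2) * ((2 * of_real t * z) ^ k / fact k)" for k t
  have exr: "(\<lambda>k. x ^ k / fact k) sums exp x" for x :: real
    using exp_converges[of x] by (simp only: real_scaleR_def divide_inverse mult.commute)
  have exc: "(\<lambda>k. x ^ k / fact k) sums exp x" for x :: complex
    using exp_converges[of x] by (simp only: scaleR_conv_of_real of_real_inverse of_real_fact divide_inverse mult.commute)
  have ne: "norm (exp (- (complex_of_real t)\<^sup>2 / 2)) = exp (- t\<^sup>2 / 2)" for t
    by (simp add: power2_eq_square)
  have n: "norm (f k t) = norm (v t) * exp (- t\<^sup>2 / 2) * ((2 * \<bar>t\<bar> * norm z) ^ k / fact k)" for k t
    unfolding f_def norm_mult ne norm_divide norm_power norm_fact by simp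
  have se: "(\<lambda>k. norm (f k t)) sums (norm (v t) * exp (- t\<^sup>2 / 2) * exp (2 * \<bar>t\<bar> * norm z))" for t
    unfolding n by (intro sums_mult exr)
  have E: "norm (v t) * exp (- t\<^sup>2 / 2) * exp (2 * \<bar>t\<bar> * norm z) = norm (v t) * exp (2 * norm z * \<bar>t\<bar> - t\<^sup>2 / 2)" for t
    unfolding mult.assoc exp_add[symmetric] by (simp add: mult_ac)
  note int = integrable_abs_gauss[OF v, of "norm z"]
  have le: "norm (f k t) \<le> norm (v t) * exp (2 * norm z * \<bar>t\<bar> - t\<^sup>2 / 2)" for k t
    using sum_le_suminf[OF sums_summable[OF se[of t]], of "{k}"] sums_unique[OF se[of t]] E[of t] by simp
  have m: "f k \<in> borel_measurable lborel" for k
    unfolding f_def using L2_measurable[OF v] by measurable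
  have fi: "integrable lborel (f k)" for k
    by (rule Bochner_Integration.integrable_bound[OF int m]) (use le in auto)
  have "(\<lambda>k. LINT t|lborel. f k t) sums (LINT t|lborel. (\<Sum>k. f k t))"
  proof (rule sums_integral[OF fi])
    show "AE t in lborel. summable (\<lambda>k. norm (f k t))" using sums_summable[OF se] by simp
    show "summable (\<lambda>k. LINT t|lborel. norm (f k t))"
    proof (rule summableI_nonneg_bounded)
      fix n
      have "(\<Sum>k<n. LINT t|lborel. norm (f k t)) = (LINT t|lborel. (\<Sum>k<n. norm (f k t)))"
        by (intro Bochner_Integration.integral_sum[symmetric] integrable_norm fi)
      also have "\<dots> \<le> (LINT t|lborel. norm (v t) * exp (2 * norm z * \<bar>t\<bar> - t\<^sup>2 / 2))"
      proof (intro integral_mono int Bochner_Integration.integrable_sum integrable_norm fi)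
        fix t
        show "(\<Sum>k<n. norm (f k t)) \<le> norm (v t) * exp (2 * norm z * \<bar>t\<bar> - t\<^sup>2 / 2)"
          using sum_le_suminf[OF sums_summable[OF se[of t]], of "{..<n}"] sums_unique[OF se[of t]] E[of t] by simp
      qed
      finally show "(\<Sum>k<n. LINT t|lborel. norm (f k t)) \<le> (LINT t|lborel. norm (v t) * exp (2 * norm z * \<bar>t\<bar> - t\<^sup>2 / 2))" .
    qed simp
  qed
  moreover have "(\<Sum>k. f k t) = v t * barg_ker z t" for t
  proof -
    have "(\<lambda>k. f k t) sums (v t * exp (- (complex_of_real t)\<^sup>2 / 2) * exp (2 * of_real t * z))"
      unfolding f_def by (intro sums_mult exc)
    then have "(\<Sum>k. f k t) = v t * exp (- (complex_of_real t)\<^sup>2 / 2) * exp (2 * of_real t * z)" by (rule sums_unique[symmetric])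
    also have "\<dots> = v t * barg_ker z t"
      unfolding mult.assoc exp_add[symmetric] by (simp add: mult_ac)
    finally show ?thesis .
  qed
  moreover have "(LINT t|lborel. f k t) = (LINT t|lborel. v t * exp (- (of_real t)\<^sup>2 / 2) * (2 * of_real t) ^ k / fact k) * z ^ k" for k
  proof -
    have "f k t = v t * exp (- (of_real t)\<^sup>2 / 2) * (2 * of_real t) ^ k / fact k * z ^ k" for t
      by (simp add: f_def power_mult_distrib mult_ac)
    then show ?thesis by (simp only: integral_mult_left_zero)
  qed
  ultimately show ?thesis by (simp only: barg_def)
qed

lemma barg_holomorphic:
  assumes v: "L2 v" shows "barg v holomorphic_on UNIV"
proof -
  have b: "barg v holomorphic_on ball 0 r" for r
    by (rule power_series_holomorphic[where a = "\<lambda>k. LINT t|lborel. v t * exp (- (of_real t)\<^sup>2 / 2) * (2 * of_real t) ^ k / fact k"])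
       (use barg_sums[OF v] in simp)
  have "barg v field_differentiable at z" for z
    by (rule holomorphic_on_imp_differentiable_at[OF b[of "norm z + 1"]]) auto
  then show ?thesis by (simp add: holomorphic_on_def)
qed

section \<open>Injectivity of the Fourier and Bargmann transforms\<close>

lemma real_fourier_injective:
  fixes f :: "real \<Rightarrow> real"
  assumes f: "integrable lborel f" and ft: "\<And>y. (LINT t|lborel. of_real (f t) * cis (y * t)) = 0"
  shows "AE t in lborel. f t = 0"
proof -
  define fp fm where "fp t = max 0 (f t)" and "fm t = max 0 (- f t)" for t
  have int: "integrable lborel fp" "integrable lborel fm" unfolding fp_def fm_def using f by auto
  have d: "f t = fp t - fm t" "fp t \<ge> 0" "fm t \<ge> 0" for t by (auto simp: fp_def fm_def)
  have [measurable]: "fp \<in> borel_measurable borel" "fm \<in> borel_measurable borel"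
    using int by (auto dest: borel_measurable_integrable)
  have icis: "integrable lborel (\<lambda>t. complex_of_real (h t) * cis (y * t))" if "integrable lborel h" for h y
  proof (rule Bochner_Integration.integrable_bound[OF that])
    have "h \<in> borel_measurable lborel" using that by (rule borel_measurable_integrable)
    then show "(\<lambda>t. complex_of_real (h t) * cis (y * t)) \<in> borel_measurable lborel"
      unfolding cis_conv_exp by measurable
  qed (simp add: norm_mult)
  have eq: "(LINT t|lborel. of_real (fp t) * cis (y * t)) = (LINT t|lborel. of_real (fm t) * cis (y * t))" for y
  proof -
    have "(LINT t|lborel. of_real (f t) * cis (y * t)) = (LINT t|lborel. of_real (fp t) * cis (y * t)) - (LINT t|lborel. of_real (fm t) * cis (y * t))"
      unfolding d(1) of_real_diff left_diff_distrib by (intro Bochner_Integration.integral_diff icis int)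
    then show ?thesis using ft[of y] by simp
  qed
  define m where "m = (LINT t|lborel. fp t)"
  have m2: "m = (LINT t|lborel. fm t)"
    using eq[of 0] by (simp add: m_def)
  have m0: "m \<ge> 0" unfolding m_def using d by simp
  show ?thesis
  proof (cases "m = 0")
    case True
    have "AE t in lborel. fp t = 0" "AE t in lborel. fm t = 0"
      using integral_nonneg_eq_0_iff_AE[OF int(1)] integral_nonneg_eq_0_iff_AE[OF int(2)] d True m2 m_def by auto
    then show ?thesis by eventually_elim (simp add: d)
  next
    case False
    then have mp: "m > 0" using m0 by simp
    have char: "char (density lborel (\<lambda>t. ennreal (h t / m))) y = (LINT t|lborel. of_real (h t) * cis (y * t)) / of_real m"
      and distr: "real_distribution (density lborel (\<lambda>t. ennreal (h t / m)))"
      if h: "integrable lborel h" "\<And>t. h t \<ge> 0" "(LINT t|lborel. h t) = m" "h \<in> borel_measurable borel" for h y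
    proof -
      have "char (density lborel (\<lambda>t. ennreal (h t / m))) y = (LINT t|lborel. (h t / m) *\<^sub>R cis (y * t))"
        unfolding char_def using h mp
        by (subst integral_density) (auto simp: cis_conv_exp)
      also have "\<dots> = (LINT t|lborel. of_real (h t) * cis (y * t) / of_real m)"
        by (simp add: scaleR_conv_of_real)
      finally show "char (density lborel (\<lambda>t. ennreal (h t / m))) y = (LINT t|lborel. of_real (h t) * cis (y * t)) / of_real m" by simp
      have "(\<integral>\<^sup>+t. ennreal (h t / m) \<partial>lborel) = ennreal (LINT t|lborel. h t / m)"
        using h mp by (intro nn_integral_eq_integral) auto
      then have "emeasure (density lborel (\<lambda>t. ennreal (h t / m))) UNIV = 1"
        using h mp by (subst emeasure_density) auto
      then show "real_distribution (density lborel (\<lambda>t. ennreal (h t / m)))"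
        unfolding real_distribution_def real_distribution_axioms_def by (auto intro!: prob_spaceI)
    qed
    \<comment> \<open>At y = 0 both parts have the same mass m. Divided by m they are probability
      densities with equal characteristic functions, so the uniqueness theorem of Levy
      applies.\<close>
    have "density lborel (\<lambda>t. ennreal (fp t / m)) = density lborel (\<lambda>t. ennreal (fm t / m))"
    proof (rule Levy_uniqueness)
      show "real_distribution (density lborel (\<lambda>t. ennreal (fp t / m)))" by (rule distr) (use int d m_def in auto)
      show "real_distribution (density lborel (\<lambda>t. ennreal (fm t / m)))" by (rule distr) (use int d m2 in auto)
      show "char (density lborel (\<lambda>t. ennreal (fp t / m))) = char (density lborel (\<lambda>t. ennreal (fm t / m)))"
        by (rule ext, subst (1 2) char) (use int d m2 m_def eq in auto)
    qed
    then have "AE t in lborel. ennreal (fp t / m) = ennreal (fm t / m)"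
      by (intro sigma_finite_measure.density_unique[OF lborel.sigma_finite_measure_axioms]) auto
    then show ?thesis
    proof eventually_elim
      case (elim t)
      then have "fp t / m = fm t / m" using mp d by (subst (asm) ennreal_inj) auto
      then show ?case using mp d(1)[of t] by simp
    qed
  qed
qed

text \<open>The transform of cnj h at y is the conjugate of that of h at -y, so the transform of Re
  h vanishes too. The imaginary part is the real part of -i f.\<close>

lemma complex_fourier_injective:
  fixes f :: "real \<Rightarrow> complex"
  assumes fi: "integrable lborel f" and f0: "\<And>y. (LINT t|lborel. f t * cis (y * t)) = 0"
  shows "AE t in lborel. f t = 0"
proof -
  have Re0: "AE t in lborel. Re (h t) = 0"
    if hi: "integrable lborel h" and h0: "\<And>y. (LINT t|lborel. h t * cis (y * t)) = 0" for h :: "real \<Rightarrow> complex"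
  proof (rule real_fourier_injective)
    show "integrable lborel (\<lambda>t. Re (h t))" using hi by (rule integrable_Re)
    fix y
    have int: "integrable lborel (\<lambda>t. k t * cis (y * t))" if "integrable lborel k" for k :: "real \<Rightarrow> complex"
    proof (rule Bochner_Integration.integrable_bound[OF that])
      have "k \<in> borel_measurable lborel" using that by (rule borel_measurable_integrable)
      then show "(\<lambda>t. k t * cis (y * t)) \<in> borel_measurable lborel" unfolding cis_conv_exp by measurable
    qed (simp add: norm_mult)
    have chi: "integrable lborel (\<lambda>t. cnj (h t))" using hi by simp
    have "(LINT t|lborel. cnj (h t) * cis (y * t)) = (LINT t|lborel. cnj (h t * cis (- y * t)))"
      by (simp add: cis_cnj)
    also have "\<dots> = 0" unfolding Bochner_Integration.integral_cnj h0 by simp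
    finally have c0: "(LINT t|lborel. cnj (h t) * cis (y * t)) = 0" .
    have "complex_of_real (Re (h t)) * cis (y * t) = (h t * cis (y * t) + cnj (h t) * cis (y * t)) / 2" for t
      by (simp add: complex_add_cnj distrib_right[symmetric])
    then have "(LINT t|lborel. complex_of_real (Re (h t)) * cis (y * t)) = (LINT t|lborel. (h t * cis (y * t) + cnj (h t) * cis (y * t)) / 2)"
      by (simp only:)
    also have "\<dots> = 0"
      unfolding integral_divide_zero Bochner_Integration.integral_add[OF int[OF hi] int[OF chi]] h0 c0 by simp
    finally show "(LINT t|lborel. complex_of_real (Re (h t)) * cis (y * t)) = 0" .
  qed
  have "AE t in lborel. Re (- \<i> * f t) = 0"
    by (rule Re0) (use fi in simp, simp only: mult.assoc integral_mult_right_zero f0 mult_zero_right)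
  with Re0[OF fi f0] show ?thesis by eventually_elim (simp add: complex_eq_iff)
qed

text \<open>On the imaginary axis, z = i y/2, the transform is the Fourier transform of v(t)
  exp(-t^2/2).\<close>

lemma barg_injective:
  assumes v: "L2 v" and w: "L2 w" and eq: "\<And>z. barg v z = barg w z"
  shows "AE t in lborel. v t = w t"
proof -
  define f where "f t = (v t - w t) * exp (- (complex_of_real t)\<^sup>2 / 2)" for t
  have *: "integrable lborel (\<lambda>t. f t * cis (y * t)) \<and> (LINT t|lborel. f t * cis (y * t)) = 0" for y
  proof -
    define z where "z = \<i> * of_real (y / 2)"
    have e: "f t * cis (y * t) = v t * barg_ker z t - w t * barg_ker z t" for t
    proof -
      have "2 * z * of_real t - (complex_of_real t)\<^sup>2 / 2 = - (complex_of_real t)\<^sup>2 / 2 + \<i> * of_real (y * t)"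
        by (simp add: z_def algebra_simps)
      then show ?thesis unfolding f_def cis_conv_exp by (simp only: exp_add left_diff_distrib mult.assoc)
    qed
    show ?thesis
      unfolding e using eq[of z] unfolding barg_def
      by (simp add: Bochner_Integration.integral_diff barg_integrable v w)
  qed
  have "integrable lborel f" using *[of 0] by simp
  from complex_fourier_injective[OF this] * have "AE t in lborel. f t = 0" by blast
  then show ?thesis by eventually_elim (simp add: f_def)
qed

section \<open>The ambiguity function controls the Bargmann transform\<close>

definition amb :: "(real \<Rightarrow> complex) \<Rightarrow> real \<Rightarrow> real \<Rightarrow> complex" where
  "amb v x y = (LINT t|lborel. v t * cnj (v (t - x)) * cis (y * t))"

text \<open>If \<open>f\<close> is not integrable, its integral is 0 by convention; integrability of
  the majorant suffices.\<close>

lemma norm_integral_le: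
  fixes f :: "'a \<Rightarrow> complex"
  assumes "integrable M g" "\<And>x. norm (f x) \<le> g x"
  shows "norm (integral\<^sup>L M f) \<le> integral\<^sup>L M g"
proof (cases "integrable M f")
  case True
  have "norm (integral\<^sup>L M f) \<le> (LINT x|M. norm (f x))" by (rule integral_norm_bound)
  also have "\<dots> \<le> integral\<^sup>L M g" using assms True by (intro integral_mono integrable_norm)
  finally show ?thesis .
next
  case False
  have "0 \<le> g x" for x using assms(2)[of x] norm_ge_zero order_trans by blast
  then show ?thesis using False by (simp add: not_integrable_integral_eq)
qed

lemma cis_measurable [measurable]: "f \<in> borel_measurable M \<Longrightarrow> (\<lambda>x. cis (f x)) \<in> borel_measurable M"
  unfolding cis_conv_exp by measurable

lemma cnj_measurable [measurable]: "f \<in> borel_measurable M \<Longrightarrow> (\<lambda>x. cnj (f x)) \<in> borel_measurable M"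
  by (rule measurable_compose[OF _ borel_measurable_continuous_onI]) (auto intro!: continuous_intros)

lemma L2_shift_integrable:
  assumes v: "L2 v" shows "integrable lborel (\<lambda>t. v t * cnj (v (t - x)))"
proof (rule Bochner_Integration.integrable_bound)
  have i: "integrable lborel (\<lambda>t. (norm (v t))\<^sup>2)" using v by (simp add: L2_def)
  have "integrable lborel (\<lambda>t. (norm (v (- x + 1 * t)))\<^sup>2)"
    using lborel_integrable_real_affine[OF i, of 1 "- x"] by simp
  then have "integrable lborel (\<lambda>t. (norm (v (t - x)))\<^sup>2)" by simp
  then show "integrable lborel (\<lambda>t. ((norm (v t))\<^sup>2 + (norm (v (t - x)))\<^sup>2) / 2)"
    using i by (intro integrable_divide_zero Bochner_Integration.integrable_add) auto
  show "(\<lambda>t. v t * cnj (v (t - x))) \<in> borel_measurable lborel" using L2_measurable[OF v] by measurable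
  show "AE t in lborel. norm (v t * cnj (v (t - x))) \<le> norm (((norm (v t))\<^sup>2 + (norm (v (t - x)))\<^sup>2) / 2)"
  proof (rule AE_I2)
    fix t
    show "norm (v t * cnj (v (t - x))) \<le> norm (((norm (v t))\<^sup>2 + (norm (v (t - x)))\<^sup>2) / 2)"
      using sum_squares_bound[of "norm (v t)" "norm (v (t - x))"] by (simp add: norm_mult)
  qed
qed

text \<open>The frequency 2 s reproduces the Gaussian exp(-\<tau>^2) up to a constant, and 4 \<eta>
  is the modulation that arises in the product of Bargmann transforms.\<close>

lemma gauss_fourier:
  "(LINT s|lborel. exp (- (complex_of_real s)\<^sup>2) * cis ((4 * \<eta> + 2 * s) * \<tau>)) =
    of_real (sqrt pi) * exp (- (of_real \<tau>)\<^sup>2 + \<i> * of_real (4 * \<eta> * \<tau>))"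
proof -
  have e: "exp (- (complex_of_real s)\<^sup>2) * cis ((4 * \<eta> + 2 * s) * \<tau>) =
      exp (\<i> * of_real (4 * \<eta> * \<tau>)) * (poly 1 (of_real s) * exp (- (of_real s)\<^sup>2 + 2 * \<i> * of_real \<tau> * of_real s))" for s
    unfolding cis_conv_exp poly_1 mult_1 exp_add[symmetric] by (rule arg_cong[of _ _ exp]) (simp add: algebra_simps)
  have "(LINT s|lborel. exp (- (complex_of_real s)\<^sup>2) * cis ((4 * \<eta> + 2 * s) * \<tau>)) = exp (\<i> * of_real (4 * \<eta> * \<tau>)) * gint (2 * \<i> * of_real \<tau>) 1"
    unfolding e integral_mult_right_zero gint_def ..
  also have "\<dots> = of_real (sqrt pi) * (exp (\<i> * of_real (4 * \<eta> * \<tau>)) * exp ((2 * \<i> * of_real \<tau>)\<^sup>2 / 4))"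
    by (simp only: gint_1 mult_ac)
  also have "exp (\<i> * of_real (4 * \<eta> * \<tau>)) * exp ((2 * \<i> * of_real \<tau>)\<^sup>2 / 4) = exp (- (complex_of_real \<tau>)\<^sup>2 + \<i> * of_real (4 * \<eta> * \<tau>))"
    unfolding exp_add[symmetric] by (rule arg_cong[of _ _ exp]) (simp add: power_mult_distrib)
  finally show ?thesis .
qed

definition gauss_corr :: "(real \<Rightarrow> complex) \<Rightarrow> real \<Rightarrow> real \<Rightarrow> complex" where
  "gauss_corr v \<eta> x = (LINT t|lborel. v t * cnj (v (t - x)) * exp (- (of_real (t - x / 2))\<^sup>2 + \<i> * of_real (4 * \<eta> * (t - x / 2))))"

lemma integrable_gauss: "integrable lborel (\<lambda>s. exp (- (complex_of_real s)\<^sup>2))"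
  using gint_integrable[of 1 0] by simp

text \<open>
  Writing the Gaussian as a Fourier integral turns the correlation into an average of the ambiguity function.
\<close>

lemma gauss_corr_amb:
  assumes v: "L2 v"
  shows "of_real (sqrt pi) * gauss_corr v \<eta> x =
    (LINT s|lborel. exp (- (complex_of_real s)\<^sup>2) * cis (- ((4 * \<eta> + 2 * s) * x / 2)) * amb v x (4 * \<eta> + 2 * s))"
proof -
  define w where "w t = v t * cnj (v (t - x))" for t
  define f where "f t s = w t * (exp (- (complex_of_real s)\<^sup>2) * cis ((4 * \<eta> + 2 * s) * (t - x / 2)))" for t s
  have wi: "integrable lborel w" unfolding w_def by (rule L2_shift_integrable[OF v])
  have wm [measurable]: "w \<in> borel_measurable borel" using borel_measurable_integrable[OF wi] by simp
  have gn: "integrable lborel (\<lambda>s. norm (exp (- (complex_of_real s)\<^sup>2)))" by (intro integrable_norm integrable_gauss)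
  have nf: "norm (f t s) = norm (w t) * norm (exp (- (complex_of_real s)\<^sup>2))" for t s
    by (simp add: f_def norm_mult del: norm_exp_eq_Re)
  have fi: "integrable (lborel \<Otimes>\<^sub>M lborel) (\<lambda>(t, s). f t s)"
  proof (rule lborel_pair.Fubini_integrable)
    show "(\<lambda>(t, s). f t s) \<in> borel_measurable (lborel \<Otimes>\<^sub>M lborel)"
      unfolding f_def split_def by measurable
    show "integrable lborel (\<lambda>t. LINT s|lborel. norm (case (t, s) of (t, s) \<Rightarrow> f t s))"
      unfolding prod.case nf integral_mult_right_zero by (intro integrable_mult_left integrable_norm wi)
    show "AE t in lborel. integrable lborel (\<lambda>s. case (t, s) of (t, s) \<Rightarrow> f t s)"
    proof (rule AE_I2)
      fix t
      show "integrable lborel (\<lambda>s. case (t, s) of (t, s) \<Rightarrow> f t s)"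
      proof (rule Bochner_Integration.integrable_bound[OF integrable_mult_right[OF gn, of "norm (w t)"]])
        show "(\<lambda>s. case (t, s) of (t, s) \<Rightarrow> f t s) \<in> borel_measurable lborel"
          unfolding prod.case f_def by measurable
        show "AE s in lborel. norm (case (t, s) of (t, s) \<Rightarrow> f t s) \<le> norm (norm (w t) * norm (exp (- (complex_of_real s)\<^sup>2)))"
          by (intro AE_I2) (simp only: prod.case nf real_norm_def abs_ge_self)
      qed
    qed
  qed
  have "of_real (sqrt pi) * gauss_corr v \<eta> x = (LINT t|lborel. LINT s|lborel. f t s)"
    unfolding f_def integral_mult_right_zero gauss_fourier gauss_corr_def w_def
    by (simp only: mult_ac flip: integral_mult_right_zero)
  also have "\<dots> = (LINT s|lborel. LINT t|lborel. f t s)"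
    by (rule lborel_pair.Fubini_integral[OF fi, symmetric])
  also have "(\<lambda>s. LINT t|lborel. f t s) = (\<lambda>s. exp (- (complex_of_real s)\<^sup>2) * cis (- ((4 * \<eta> + 2 * s) * x / 2)) * amb v x (4 * \<eta> + 2 * s))"
  proof
    fix s
    have "f t s = exp (- (complex_of_real s)\<^sup>2) * cis (- ((4 * \<eta> + 2 * s) * x / 2)) * (w t * cis ((4 * \<eta> + 2 * s) * t))" for t
    proof -
      have "cis ((4 * \<eta> + 2 * s) * (t - x / 2)) = cis (- ((4 * \<eta> + 2 * s) * x / 2)) * cis ((4 * \<eta> + 2 * s) * t)"
        unfolding cis_mult by (rule arg_cong[of _ _ cis]) (simp add: field_simps)
      then show ?thesis unfolding f_def by (simp only: mult_ac)
    qed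
    then show "(LINT t|lborel. f t s) = exp (- (complex_of_real s)\<^sup>2) * cis (- ((4 * \<eta> + 2 * s) * x / 2)) * amb v x (4 * \<eta> + 2 * s)"
      by (simp only: integral_mult_right_zero amb_def w_def)
  qed
  finally show ?thesis .
qed

text \<open>Replacing the second variable by t - x combines the exponents into a Gaussian in the
  midpoint t - x/2, modulated by 4 Im z, times a function of x alone. The conjugate creates the
  correlation v(t) cnj (v(t - x)) and leaves the modulus of the product unchanged.\<close>

lemma barg_product:
  assumes v: "L2 v"
  shows "barg v z * cnj (barg v (- z)) = (LINT x|lborel. of_real (exp (- x\<^sup>2 / 4 + 2 * Re z * x)) * gauss_corr v (Im z) x)"
proof -
  define W where "W t = v t * barg_ker z t" for t
  define W' where "W' t = cnj (v t * barg_ker (- z) t)" for t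
  have Wi: "integrable lborel W" "integrable lborel W'"
    unfolding W_def W'_def complex_integrable_cnj by (rule barg_integrable[OF v])+
  have [measurable]: "W \<in> borel_measurable borel" "W' \<in> borel_measurable borel"
    using Wi by (auto dest: borel_measurable_integrable)
  have sh: "integrable lborel (\<lambda>x. W' (t - x))" "(LINT x|lborel. W' (t - x)) = (LINT s|lborel. W' s)"
    "(LINT x|lborel. norm (W' (t - x))) = (LINT s|lborel. norm (W' s))" for t
    using lborel_integrable_real_affine[OF Wi(2), of "-1" t]
      lborel_integral_real_affine[of "-1" W' t] lborel_integral_real_affine[of "-1" "\<lambda>s. norm (W' s)" t] by simp_all
  define f where "f t x = W t * W' (t - x)" for t x
  have fi: "integrable (lborel \<Otimes>\<^sub>M lborel) (\<lambda>(t, x). f t x)"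
  proof (rule lborel_pair.Fubini_integrable)
    show "(\<lambda>(t, x). f t x) \<in> borel_measurable (lborel \<Otimes>\<^sub>M lborel)"
      unfolding f_def split_def by measurable
    show "integrable lborel (\<lambda>t. LINT x|lborel. norm (case (t, x) of (t, x) \<Rightarrow> f t x))"
      unfolding prod.case f_def norm_mult integral_mult_right_zero sh by (intro integrable_mult_left integrable_norm Wi)
    show "AE t in lborel. integrable lborel (\<lambda>x. case (t, x) of (t, x) \<Rightarrow> f t x)"
      unfolding prod.case f_def by (intro AE_I2 integrable_mult_right sh)
  qed
  have "barg v z * cnj (barg v (- z)) = (LINT t|lborel. W t) * (LINT s|lborel. W' s)"
    unfolding barg_def W_def W'_def Bochner_Integration.integral_cnj ..
  also have "\<dots> = (LINT t|lborel. LINT x|lborel. f t x)"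
    unfolding f_def integral_mult_right_zero sh integral_mult_left_zero ..
  also have "\<dots> = (LINT x|lborel. LINT t|lborel. f t x)"
    by (rule lborel_pair.Fubini_integral[OF fi, symmetric])
  also have "(\<lambda>x. LINT t|lborel. f t x) = (\<lambda>x. of_real (exp (- x\<^sup>2 / 4 + 2 * Re z * x)) * gauss_corr v (Im z) x)"
  proof
    fix x
    have "f t x = of_real (exp (- x\<^sup>2 / 4 + 2 * Re z * x)) *
      (v t * cnj (v (t - x)) * exp (- (of_real (t - x / 2))\<^sup>2 + \<i> * of_real (4 * Im z * (t - x / 2))))" for t
    proof -
      have "(2 * z * of_real t - (of_real t)\<^sup>2 / 2) + cnj (2 * (- z) * of_real (t - x) - (of_real (t - x))\<^sup>2 / 2)
        = of_real (- x\<^sup>2 / 4 + 2 * Re z * x) + (- (of_real (t - x / 2))\<^sup>2 + \<i> * of_real (4 * Im z * (t - x / 2)))"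
        by (simp add: complex_eq_iff power2_eq_square) (simp add: field_simps)
      then have "barg_ker z t * exp (cnj (2 * (- z) * of_real (t - x) - (of_real (t - x))\<^sup>2 / 2))
        = exp (of_real (- x\<^sup>2 / 4 + 2 * Re z * x)) * exp (- (of_real (t - x / 2))\<^sup>2 + \<i> * of_real (4 * Im z * (t - x / 2)))"
        by (simp only: exp_add[symmetric])
      then show ?thesis
        unfolding f_def W_def W'_def complex_cnj_mult exp_cnj exp_of_real[symmetric] by (simp only: mult_ac)
    qed
    then show "(LINT t|lborel. f t x) = of_real (exp (- x\<^sup>2 / 4 + 2 * Re z * x)) * gauss_corr v (Im z) x"
      by (simp only: integral_mult_right_zero gauss_corr_def)
  qed
  finally show ?thesis .
qed

lemma integrable_gauss_power: "integrable lborel (\<lambda>x::real. (1 + x\<^sup>2) ^ n * exp (- x\<^sup>2 / 2))"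
proof -
  have "(1 + x\<^sup>2) ^ n * exp (- x\<^sup>2 / 2) = (\<Sum>k\<le>n. of_nat (n choose k) * (\<bar>x\<bar> ^ (2 * k) * exp (- x\<^sup>2 / 2)))" for x :: real
    unfolding add.commute[of 1] binomial_ring by (simp add: sum_distrib_right power_mult mult.assoc)
  then show ?thesis
    by (simp only:) (intro Bochner_Integration.integrable_sum integrable_mult_right integrable_abs_power_gauss)
qed

text \<open>Separates the centre (2 \<xi>, 2 \<eta>) from the deviations (x, 2 s), so that a
  polynomial factor in the centre leaves the integrals.\<close>

lemma quadratic_split:
  fixes \<xi> \<eta> x s :: real
  shows "1 + (2 * \<xi> + x)\<^sup>2 + (2 * \<eta> + 2 * s)\<^sup>2 \<le> 8 * (1 + \<xi>\<^sup>2 + \<eta>\<^sup>2) * ((1 + x\<^sup>2) * (1 + s\<^sup>2))"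
proof -
  have "0 \<le> (2 * \<xi> - x)\<^sup>2 + (2 * \<eta> - 2 * s)\<^sup>2" by simp
  then have "1 + (2 * \<xi> + x)\<^sup>2 + (2 * \<eta> + 2 * s)\<^sup>2 \<le> 1 + 8 * \<xi>\<^sup>2 + 2 * x\<^sup>2 + 8 * \<eta>\<^sup>2 + 8 * s\<^sup>2"
    by (simp add: power2_eq_square algebra_simps)
  also have "\<dots> \<le> 8 * (1 + \<xi>\<^sup>2 + \<eta>\<^sup>2) + 8 * (x\<^sup>2 + s\<^sup>2)" by (simp add: algebra_simps)
  also have "\<dots> \<le> 8 * (1 + \<xi>\<^sup>2 + \<eta>\<^sup>2) + 8 * (1 + \<xi>\<^sup>2 + \<eta>\<^sup>2) * (x\<^sup>2 + s\<^sup>2 + x\<^sup>2 * s\<^sup>2)"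
  proof -
    have "1 * (x\<^sup>2 + s\<^sup>2) \<le> (1 + \<xi>\<^sup>2 + \<eta>\<^sup>2) * (x\<^sup>2 + s\<^sup>2 + x\<^sup>2 * s\<^sup>2)"
      by (intro mult_mono) auto
    from mult_left_mono[OF this, of 8] show ?thesis
      by (simp only: mult_1 add_le_cancel_left mult.assoc zero_le_numeral)
  qed
  also have "\<dots> = 8 * (1 + \<xi>\<^sup>2 + \<eta>\<^sup>2) * ((1 + x\<^sup>2) * (1 + s\<^sup>2))" by (simp add: algebra_simps)
  finally show ?thesis .
qed

text \<open>Completing squares centres the average of the ambiguity function at 2 z and produces
  exp(2 \<xi>^2 - 2 \<eta>^2). The two factors exp(-z^2) cancel this exactly, and only polynomial
  growth remains.\<close>

theorem barg_product_bound:
  assumes v: "L2 v" and C: "C \<ge> 0"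
    and bd: "\<And>x y. norm (amb v x y) \<le> C * (1 + x\<^sup>2 + y\<^sup>2) ^ n * exp (- (x\<^sup>2 + y\<^sup>2) / 4)"
  shows "\<exists>C'. \<forall>z. norm ((barg v z * exp (- z\<^sup>2)) * (barg v (- z) * exp (- (- z)\<^sup>2))) \<le> C' * (1 + norm z) ^ (2 * n)"
proof -
  define h where "h x = (1 + x\<^sup>2) ^ n * exp (- x\<^sup>2 / 2)" for x :: real
  define D where "D = (LINT x|lborel. h x)"
  have hi: "integrable lborel h" unfolding h_def by (rule integrable_gauss_power)
  have h0: "h x \<ge> 0" for x by (simp add: h_def)
  have D0: "D \<ge> 0" unfolding D_def using h0 by simp
  have "norm ((barg v z * exp (- z\<^sup>2)) * (barg v (- z) * exp (- (- z)\<^sup>2))) \<le> (C * 8 ^ n * D * D) * (1 + norm z) ^ (2 * n)" for z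
  proof -
    define \<xi> \<eta> where "\<xi> = Re z" and "\<eta> = Im z"
    define A where "A = C * (8 * (1 + \<xi>\<^sup>2 + \<eta>\<^sup>2)) ^ n"
    have corr: "norm (gauss_corr v \<eta> x) \<le> A * D * exp (- 2 * \<eta>\<^sup>2 - x\<^sup>2 / 4) * (1 + (x - 2 * \<xi>)\<^sup>2) ^ n" for x
    proof -
      define G where "G s = exp (- (complex_of_real s)\<^sup>2) * cis (- ((4 * \<eta> + 2 * s) * x / 2)) * amb v x (4 * \<eta> + 2 * s)" for s
      define B where "B = A * exp (- 2 * \<eta>\<^sup>2 - x\<^sup>2 / 4) * (1 + (x - 2 * \<xi>)\<^sup>2) ^ n"
      \<comment> \<open>Shifting s by -\<eta> turns the exponent into -(s - \<eta>)^2 - (s +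
        \<eta>)^2 = -2 \<eta>^2 - 2 s^2. The weaker exp(-s^2/2) is kept so that both integrations
        use the weight \<open>h\<close>.\<close>
      have GB: "norm (G (- \<eta> + 1 * s)) \<le> B * h s" for s
      proof -
        have y: "4 * \<eta> + 2 * (- \<eta> + 1 * s) = 2 * \<eta> + 2 * s" by simp
        have "norm (exp (- (complex_of_real (- \<eta> + 1 * s))\<^sup>2)) = exp (- (s - \<eta>)\<^sup>2)"
          by (simp add: power2_eq_square algebra_simps)
        then have "norm (G (- \<eta> + 1 * s)) = exp (- (s - \<eta>)\<^sup>2) * norm (amb v x (2 * \<eta> + 2 * s))"
          unfolding G_def y norm_mult by simp
        also have "\<dots> \<le> exp (- (s - \<eta>)\<^sup>2) * (C * (1 + x\<^sup>2 + (2 * \<eta> + 2 * s)\<^sup>2) ^ n * exp (- (x\<^sup>2 + (2 * \<eta> + 2 * s)\<^sup>2) / 4))"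
          by (intro mult_left_mono bd) simp
        also have "\<dots> = C * (1 + (2 * \<xi> + (x - 2 * \<xi>))\<^sup>2 + (2 * \<eta> + 2 * s)\<^sup>2) ^ n * (exp (- 2 * \<eta>\<^sup>2 - x\<^sup>2 / 4) * exp (- 2 * s\<^sup>2))"
        proof -
          have "exp (- (s - \<eta>)\<^sup>2) * exp (- (x\<^sup>2 + (2 * \<eta> + 2 * s)\<^sup>2) / 4) = exp (- 2 * \<eta>\<^sup>2 - x\<^sup>2 / 4) * exp (- 2 * s\<^sup>2)"
            unfolding exp_add[symmetric] by (rule arg_cong[of _ _ exp]) (simp add: power2_eq_square field_simps)
          then show ?thesis by (simp add: mult_ac)
        qed
        also have "\<dots> \<le> C * (8 * (1 + \<xi>\<^sup>2 + \<eta>\<^sup>2) * ((1 + (x - 2 * \<xi>)\<^sup>2) * (1 + s\<^sup>2))) ^ n * (exp (- 2 * \<eta>\<^sup>2 - x\<^sup>2 / 4) * exp (- s\<^sup>2 / 2))"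
          using C by (intro mult_mono power_mono quadratic_split) auto
        also have "\<dots> = B * h s" by (simp add: A_def B_def h_def power_mult_distrib mult_ac)
        finally show ?thesis .
      qed
      have "(LINT s|lborel. G s) = (LINT s|lborel. G (- \<eta> + 1 * s))"
        using lborel_integral_real_affine[of 1 G "- \<eta>"] by simp
      also have "norm \<dots> \<le> (LINT s|lborel. B * h s)"
        by (rule norm_integral_le[OF integrable_mult_right[OF hi] GB])
      finally have "norm (LINT s|lborel. G s) \<le> B * D" by (simp add: D_def)
      moreover have "of_real (sqrt pi) * gauss_corr v \<eta> x = (LINT s|lborel. G s)"
        unfolding G_def by (rule gauss_corr_amb[OF v])
      ultimately have "norm (of_real (sqrt pi) * gauss_corr v \<eta> x) \<le> B * D" by simp
      then have "sqrt pi * norm (gauss_corr v \<eta> x) \<le> B * D" by (simp add: norm_mult)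
      moreover have "1 * norm (gauss_corr v \<eta> x) \<le> sqrt pi * norm (gauss_corr v \<eta> x)"
        using pi_ge_two by (intro mult_right_mono) (auto simp: real_le_rsqrt)
      ultimately show ?thesis unfolding B_def by (simp add: mult_ac)
    qed
    have "norm (barg v z * cnj (barg v (- z))) \<le> (LINT x|lborel. A * D * exp (- 2 * \<eta>\<^sup>2 + 2 * \<xi>\<^sup>2) * h (- 2 * \<xi> + 1 * x))"
      unfolding barg_product[OF v]
    proof (rule norm_integral_le)
      show "integrable lborel (\<lambda>x. A * D * exp (- 2 * \<eta>\<^sup>2 + 2 * \<xi>\<^sup>2) * h (- 2 * \<xi> + 1 * x))"
        by (intro integrable_mult_right lborel_integrable_real_affine hi) simp
      fix x
      have "norm (of_real (exp (- x\<^sup>2 / 4 + 2 * Re z * x)) * gauss_corr v (Im z) x) = exp (- x\<^sup>2 / 4 + 2 * \<xi> * x) * norm (gauss_corr v \<eta> x)"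
        by (simp add: norm_mult \<xi>_def \<eta>_def)
      also have "\<dots> \<le> exp (- x\<^sup>2 / 4 + 2 * \<xi> * x) * (A * D * exp (- 2 * \<eta>\<^sup>2 - x\<^sup>2 / 4) * (1 + (x - 2 * \<xi>)\<^sup>2) ^ n)"
        by (intro mult_left_mono corr) simp
      also have "\<dots> = A * D * exp (- 2 * \<eta>\<^sup>2 + 2 * \<xi>\<^sup>2) * h (- 2 * \<xi> + 1 * x)"
      proof -
        have "exp (- x\<^sup>2 / 4 + 2 * \<xi> * x) * exp (- 2 * \<eta>\<^sup>2 - x\<^sup>2 / 4) = exp (- 2 * \<eta>\<^sup>2 + 2 * \<xi>\<^sup>2) * exp (- (x - 2 * \<xi>)\<^sup>2 / 2)"
          unfolding exp_add[symmetric] by (rule arg_cong[of _ _ exp]) (simp add: power2_eq_square field_simps)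
        moreover have "- 2 * \<xi> + 1 * x = x - 2 * \<xi>" by simp
        ultimately show ?thesis unfolding h_def by (simp only: mult_ac)
      qed
      finally show "norm (of_real (exp (- x\<^sup>2 / 4 + 2 * Re z * x)) * gauss_corr v (Im z) x)
        \<le> A * D * exp (- 2 * \<eta>\<^sup>2 + 2 * \<xi>\<^sup>2) * h (- 2 * \<xi> + 1 * x)" .
    qed
    also have "\<dots> = A * D * exp (- 2 * \<eta>\<^sup>2 + 2 * \<xi>\<^sup>2) * D"
      using lborel_integral_real_affine[of 1 h "- 2 * \<xi>"] by (simp add: D_def)
    finally have b: "norm (barg v z * cnj (barg v (- z))) \<le> A * D * exp (- 2 * \<eta>\<^sup>2 + 2 * \<xi>\<^sup>2) * D" .
    have "norm ((barg v z * exp (- z\<^sup>2)) * (barg v (- z) * exp (- (- z)\<^sup>2))) = norm (barg v z * cnj (barg v (- z))) * exp (2 * \<eta>\<^sup>2 - 2 * \<xi>\<^sup>2)"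
    proof -
      have "norm (exp (- z\<^sup>2)) * norm (exp (- (- z)\<^sup>2)) = exp (2 * \<eta>\<^sup>2 - 2 * \<xi>\<^sup>2)"
        by (simp add: \<xi>_def \<eta>_def power2_eq_square flip: exp_add)
      then show ?thesis unfolding norm_mult complex_mod_cnj by (simp only: mult_ac)
    qed
    also have "\<dots> \<le> A * D * exp (- 2 * \<eta>\<^sup>2 + 2 * \<xi>\<^sup>2) * D * exp (2 * \<eta>\<^sup>2 - 2 * \<xi>\<^sup>2)"
      by (intro mult_right_mono b) simp
    also have "\<dots> = A * D * D * (exp (- 2 * \<eta>\<^sup>2 + 2 * \<xi>\<^sup>2) * exp (2 * \<eta>\<^sup>2 - 2 * \<xi>\<^sup>2))" by (simp only: mult_ac)
    also have "exp (- 2 * \<eta>\<^sup>2 + 2 * \<xi>\<^sup>2) * exp (2 * \<eta>\<^sup>2 - 2 * \<xi>\<^sup>2) = 1" by (simp flip: exp_add)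
    also have "A * D * D * 1 = (C * 8 ^ n * D * D) * (1 + (norm z)\<^sup>2) ^ n"
    proof -
      have "1 + \<xi>\<^sup>2 + \<eta>\<^sup>2 = 1 + (norm z)\<^sup>2" by (simp add: cmod_power2 \<xi>_def \<eta>_def)
      then show ?thesis unfolding A_def power_mult_distrib by (simp only: mult_ac mult_1_right mult_1)
    qed
    also have "\<dots> \<le> (C * 8 ^ n * D * D) * ((1 + norm z)\<^sup>2) ^ n"
      using C D0 by (intro mult_left_mono power_mono) (auto simp: power2_sum)
    finally show ?thesis by (simp add: power_mult)
  qed
  then show ?thesis by blast
qed

section \<open>Partners of polynomials times Gaussians\<close>

definition gauss_mult :: "complex poly \<Rightarrow> real \<Rightarrow> complex" where
  "gauss_mult P t = poly P (of_real t) * exp (- (of_real t)\<^sup>2 / 2)"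

lemma gauss_mult_measurable: "gauss_mult P \<in> borel_measurable borel"
  unfolding gauss_mult_def poly_altdef by measurable

lemma L2_gauss_mult: "L2 (gauss_mult P)"
  unfolding L2_def
proof
  show "gauss_mult P \<in> borel_measurable borel" by (rule gauss_mult_measurable)
  have "integrable lborel (\<lambda>t. norm (poly (P * P) (of_real t) * gauss_ker 0 t))"
    by (intro integrable_norm gint_integrable)
  moreover have "norm (poly (P * P) (complex_of_real t) * gauss_ker 0 t) = (norm (gauss_mult P t))\<^sup>2" for t
  proof -
    have "(exp (- t\<^sup>2 / 2))\<^sup>2 = exp (- t\<^sup>2)" by (simp add: power2_eq_square flip: exp_add)
    then show ?thesis by (simp add: gauss_mult_def norm_mult power_mult_distrib power2_eq_square[of "norm (poly P (complex_of_real t))"])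
  qed
  ultimately show "integrable lborel (\<lambda>t. (norm (gauss_mult P t))\<^sup>2)" by (simp only:)
qed

text \<open>Completing the square in -t^2 + (x + i y) t means shifting t by z = (x + i y)/2, which
  turns t - x into t - cnj z.\<close>

lemma amb_gauss_mult:
  fixes x y :: real
  defines "z \<equiv> Complex x y / 2"
  shows "amb (gauss_mult P) x y = exp ((Complex x y)\<^sup>2 / 4 - (of_real x)\<^sup>2 / 2) * eval2 (amb_poly 1 P) z (cnj z)"
proof -
  define c where "c = Complex x y"
  define S where "S = P * pcompose (cnj_poly P) [:- of_real x, 1:]"
  have e: "gauss_mult P t * cnj (gauss_mult P (t - x)) * cis (y * t) =
      exp (- (of_real x)\<^sup>2 / 2) * (poly S (of_real t) * gauss_ker c t)" for t
  proof -
    have p: "cnj (poly P (complex_of_real (t - x))) = poly (pcompose (cnj_poly P) [:- of_real x, 1:]) (of_real t)"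
      by (simp add: poly_pcompose poly_cnj_poly)
    have c: "c = of_real x + \<i> * of_real y" by (simp add: c_def complex_eq_iff)
    have "exp (- (of_real t)\<^sup>2 / 2) * exp (- (complex_of_real (t - x))\<^sup>2 / 2) * exp (\<i> * of_real (y * t)) =
        exp (- (of_real x)\<^sup>2 / 2) * gauss_ker c t"
      unfolding exp_add[symmetric] c by (rule arg_cong[of _ _ exp]) (simp add: power2_eq_square field_simps)
    moreover have cexp: "cnj (exp (- (complex_of_real (t - x))\<^sup>2 / 2)) = exp (- (of_real (t - x))\<^sup>2 / 2)" unfolding exp_cnj by simp
    moreover have "a * e1 * (b * e2) * e3 = e4 * (a * b * e5)" if "e1 * e2 * e3 = e4 * e5" for a b e1 e2 e3 e4 e5 :: complex
    proof -
      have "a * e1 * (b * e2) * e3 = a * b * (e1 * e2 * e3)" by (simp only: mult_ac)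
      then show ?thesis unfolding that by (simp only: mult_ac)
    qed
    ultimately show ?thesis
      unfolding gauss_mult_def complex_cnj_mult p cexp S_def poly_mult cis_conv_exp by blast
  qed
  have "amb (gauss_mult P) x y = exp (- (of_real x)\<^sup>2 / 2) * gint c S"
    unfolding amb_def e integral_mult_right_zero gint_def ..
  also have "\<dots> = exp (- (of_real x)\<^sup>2 / 2) * (exp (c\<^sup>2 / 4) * gint 0 (pcompose S [:c / 2, 1:]))"
    by (simp only: gint_shift[of c])
  also have "pcompose S [:c / 2, 1:] = pcompose P [:1 * z, 1:] * pcompose (cnj_poly P) [:- (1 * cnj z), 1:]"
  proof (rule poly_ext)
    fix w
    have zc: "c / 2 = z" by (simp add: c_def z_def)
    have "z - of_real x = - cnj z" by (simp add: z_def complex_eq_iff)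
    then have x: "- of_real x + (z + w) = - cnj z + w" by (simp add: algebra_simps)
    have ev: "poly [:a, 1:] v = a + v" for a v :: complex by simp
    show "poly (pcompose S [:c / 2, 1:]) w = poly (pcompose P [:1 * z, 1:] * pcompose (cnj_poly P) [:- (1 * cnj z), 1:]) w"
      unfolding S_def zc poly_mult poly_pcompose ev mult_1 x ..
  qed
  also have "gint 0 \<dots> = eval2 (amb_poly 1 P) z (cnj z)" by (rule eval2_amb_poly[symmetric])
  also have "exp (- (complex_of_real x)\<^sup>2 / 2) * (exp (c\<^sup>2 / 4) * eval2 (amb_poly 1 P) z (cnj z))
     = exp (c\<^sup>2 / 4 - (of_real x)\<^sup>2 / 2) * eval2 (amb_poly 1 P) z (cnj z)"
    unfolding mult.assoc[symmetric] exp_add[symmetric] by simp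
  finally show ?thesis by (simp add: c_def)
qed

lemma norm_amb_gauss_mult:
  fixes x y :: real
  defines "z \<equiv> Complex x y / 2"
  shows "norm (amb (gauss_mult P) x y) = exp (- (x\<^sup>2 + y\<^sup>2) / 4) * norm (eval2 (amb_poly 1 P) z (cnj z))"
proof -
  have "norm (exp ((Complex x y)\<^sup>2 / 4 - (complex_of_real x)\<^sup>2 / 2)) = exp (- (x\<^sup>2 + y\<^sup>2) / 4)"
    unfolding norm_exp_eq_Re by (rule arg_cong[of _ _ exp]) (simp add: power2_eq_square field_simps)
  then show ?thesis unfolding z_def amb_gauss_mult norm_mult by simp
qed

lemma cnj_gint: "cnj (gint 0 S) = gint 0 (cnj_poly S)"
  unfolding gint_def Bochner_Integration.integral_cnj[symmetric]
  by (simp add: exp_cnj poly_cnj_poly)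

lemma eval2_amb_poly_cnj: "cnj (eval2 (amb_poly 1 P) z (cnj z)) = eval2 (amb_poly (-1) P) z (cnj z)"
proof -
  have "cnj_poly (pcompose P [:1 * z, 1:] * pcompose (cnj_poly P) [:- (1 * cnj z), 1:])
    = pcompose P [:-1 * z, 1:] * pcompose (cnj_poly P) [:- (-1 * cnj z), 1:]"
  proof (rule poly_ext)
    fix x
    show "poly (cnj_poly (pcompose P [:1 * z, 1:] * pcompose (cnj_poly P) [:- (1 * cnj z), 1:])) x
      = poly (pcompose P [:-1 * z, 1:] * pcompose (cnj_poly P) [:- (-1 * cnj z), 1:]) x"
      by (simp add: poly_cnj_poly poly_pcompose)
  qed
  then show ?thesis by (simp only: eval2_amb_poly cnj_gint)
qed

text \<open>On w = cnj z the squared modulus is the product with the conjugate, which is the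
  polynomial for s = -1. Equality there extends to independent z and w.\<close>

lemma same_modulus_amb_poly:
  assumes "\<And>x y. norm (amb (gauss_mult P) x y) = norm (amb (gauss_mult Q) x y)"
  shows "amb_poly 1 P * amb_poly (-1) P = amb_poly 1 Q * amb_poly (-1) Q"
proof -
  have "eval2 (amb_poly 1 P * amb_poly (-1) P - amb_poly 1 Q * amb_poly (-1) Q) z (cnj z) = 0" for z
  proof -
    have z: "Complex (2 * Re z) (2 * Im z) / 2 = z" by (simp add: complex_eq_iff)
    have n: "norm (eval2 (amb_poly 1 P) z (cnj z)) = norm (eval2 (amb_poly 1 Q) z (cnj z))"
      using assms[of "2 * Re z" "2 * Im z"] unfolding norm_amb_gauss_mult z by simp
    have "eval2 (amb_poly 1 R * amb_poly (-1) R) z (cnj z) = of_real ((norm (eval2 (amb_poly 1 R) z (cnj z)))\<^sup>2)" for R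
      unfolding complex_norm_square eval2_amb_poly_cnj by simp
    then show ?thesis by (simp add: n)
  qed
  from eval2_zero_imp_zero[OF this] show ?thesis by simp
qed

lemma eval2_growth: "\<exists>C N. C \<ge> 0 \<and> (\<forall>z. norm (eval2 H z (cnj z)) \<le> C * (1 + norm z) ^ N)"
proof -
  define D where "D = (\<Sum>k\<le>degree H. degree (coeff H k))"
  define C where "C = (\<Sum>k\<le>degree H. \<Sum>j\<le>degree (coeff H k). norm (coeff (coeff H k) j))"
  have "norm (eval2 H z (cnj z)) \<le> C * (1 + norm z) ^ (D + degree H)" for z
  proof -
    have "eval2 H z (cnj z) = (\<Sum>k\<le>degree H. \<Sum>j\<le>degree (coeff H k). coeff (coeff H k) j * z ^ j * cnj z ^ k)"
      by (simp add: poly_altdef[of H] poly_sum poly_power) (simp add: poly_altdef sum_distrib_right)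
    also have "norm \<dots> \<le> (\<Sum>k\<le>degree H. \<Sum>j\<le>degree (coeff H k). norm (coeff (coeff H k) j) * (1 + norm z) ^ (D + degree H))"
    proof (intro sum_norm_le)
      fix k j assume k: "k \<in> {..degree H}" and j: "j \<in> {..degree (coeff H k)}"
      have "degree (coeff H k) \<le> D" unfolding D_def by (rule member_le_sum) (use k in auto)
      then have "(1 + norm z) ^ (j + k) \<le> (1 + norm z) ^ (D + degree H)"
        using k j by (intro power_increasing) auto
      moreover have "norm z ^ (j + k) \<le> (1 + norm z) ^ (j + k)" by (intro power_mono) auto
      ultimately have "norm z ^ (j + k) \<le> (1 + norm z) ^ (D + degree H)" by (rule order_trans[rotated])
      then show "norm (coeff (coeff H k) j * z ^ j * cnj z ^ k) \<le> norm (coeff (coeff H k) j) * (1 + norm z) ^ (D + degree H)"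
        by (simp add: norm_mult norm_power mult.assoc mult_left_mono flip: power_add)
    qed
    finally show ?thesis by (simp add: C_def sum_distrib_right)
  qed
  moreover have "C \<ge> 0" unfolding C_def by (intro sum_nonneg) auto
  ultimately show ?thesis by blast
qed

lemma amb_gauss_mult_bound:
  "\<exists>C N. C \<ge> 0 \<and> (\<forall>x y. norm (amb (gauss_mult P) x y) \<le> C * (1 + x\<^sup>2 + y\<^sup>2) ^ N * exp (- (x\<^sup>2 + y\<^sup>2) / 4))"
proof -
  obtain C N where C: "C \<ge> 0" "\<And>z. norm (eval2 (amb_poly 1 P) z (cnj z)) \<le> C * (1 + norm z) ^ N"
    using eval2_growth by blast
  have "norm (amb (gauss_mult P) x y) \<le> (C * 2 ^ N) * (1 + x\<^sup>2 + y\<^sup>2) ^ N * exp (- (x\<^sup>2 + y\<^sup>2) / 4)" for x y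
  proof -
    define z where "z = Complex x y / 2"
    have n: "norm (Complex x y / 2) ^ 2 = (x\<^sup>2 + y\<^sup>2) / 4" by (simp add: norm_divide power_divide cmod_power2)
    have "1 + norm z \<le> 2 * (1 + (norm z)\<^sup>2)"
      using sum_squares_bound[of 1 "norm z"] zero_le_power2[of "norm z"] unfolding power_one mult_1_right by argo
    also have "\<dots> \<le> 2 * (1 + x\<^sup>2 + y\<^sup>2)" unfolding z_def n by simp
    finally have "(1 + norm z) ^ N \<le> (2 * (1 + x\<^sup>2 + y\<^sup>2)) ^ N" by (intro power_mono) auto
    then have "C * (1 + norm z) ^ N \<le> C * (2 * (1 + x\<^sup>2 + y\<^sup>2)) ^ N" using C(1) by (intro mult_left_mono)
    then have "norm (eval2 (amb_poly 1 P) z (cnj z)) \<le> C * 2 ^ N * (1 + x\<^sup>2 + y\<^sup>2) ^ N"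
      using C(2)[of z] unfolding power_mult_distrib mult.assoc by linarith
    then have "exp (- (x\<^sup>2 + y\<^sup>2) / 4) * norm (eval2 (amb_poly 1 P) z (cnj z)) \<le> exp (- (x\<^sup>2 + y\<^sup>2) / 4) * (C * 2 ^ N * (1 + x\<^sup>2 + y\<^sup>2) ^ N)"
      by (intro mult_left_mono) auto
    then show ?thesis unfolding norm_amb_gauss_mult z_def[symmetric] by (simp only: mult_ac)
  qed
  then show ?thesis using C(1) by (intro exI[of _ "C * 2 ^ N"] exI[of _ N]) auto
qed

lemma AE_lborel_shift:
  assumes "AE t in lborel. P (t :: real)" shows "AE t in lborel. P (t - x)"
proof -
  obtain N where N: "{t. \<not> P t} \<subseteq> N" "N \<in> sets lborel" "emeasure lborel N = 0"
    using AE_E[OF assms] by auto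
  have "AE t in lborel. t \<notin> N" using N by (intro AE_not_in null_setsI)
  then have "AE t in lborel. - x + 1 * t \<notin> N"
    by (intro AE_borel_affine) (use N in auto)
  then show ?thesis by eventually_elim (use N(1) in auto)
qed

lemma amb_cong_AE:
  assumes ae: "AE t in lborel. f t = g t" and m: "f \<in> borel_measurable borel" "g \<in> borel_measurable borel"
  shows "amb f x y = amb g x y"
  unfolding amb_def
proof (rule integral_cong_AE)
  show "AE t in lborel. f t * cnj (f (t - x)) * cis (y * t) = g t * cnj (g (t - x)) * cis (y * t)"
    using ae AE_lborel_shift[OF ae, of x] by eventually_elim simp
qed (use m in measurable)

definition tf_shift :: "real \<Rightarrow> real \<Rightarrow> (real \<Rightarrow> complex) \<Rightarrow> real \<Rightarrow> complex" where
  "tf_shift \<alpha> \<beta> u t = cis (\<beta> * t) * u (t - \<alpha>)"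

lemma L2_tf_shift: assumes u: "L2 u" shows "L2 (tf_shift \<alpha> \<beta> u)"
  unfolding L2_def
proof
  show "tf_shift \<alpha> \<beta> u \<in> borel_measurable borel" unfolding tf_shift_def using L2_measurable[OF u] by measurable
  have i: "integrable lborel (\<lambda>t. (norm (u t))\<^sup>2)" using u by (simp add: L2_def)
  show "integrable lborel (\<lambda>t. (norm (tf_shift \<alpha> \<beta> u t))\<^sup>2)"
    using lborel_integrable_real_affine[OF i, of 1 "- \<alpha>"] by (simp add: tf_shift_def norm_mult)
qed

lemma norm_amb_tf_shift: "norm (amb (tf_shift \<alpha> \<beta> u) x y) = norm (amb u x y)"
proof -
  have "amb (tf_shift \<alpha> \<beta> u) x y = (LINT t|lborel. tf_shift \<alpha> \<beta> u (\<alpha> + 1 * t) * cnj (tf_shift \<alpha> \<beta> u (\<alpha> + 1 * t - x)) * cis (y * (\<alpha> + 1 * t)))"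
    unfolding amb_def by (subst lborel_integral_real_affine[where c = 1 and t = \<alpha>]) simp_all
  also have "\<dots> = (LINT t|lborel. cis (\<beta> * x + y * \<alpha>) * (u t * cnj (u (t - x)) * cis (y * t)))"
  proof (intro Bochner_Integration.integral_cong refl)
    fix t
    have "cis (\<beta> * (\<alpha> + t)) * cis (- (\<beta> * (\<alpha> + t - x))) * cis (y * (\<alpha> + t)) = cis (\<beta> * x + y * \<alpha>) * cis (y * t)"
      unfolding cis_mult by (rule arg_cong[of _ _ cis]) (simp add: algebra_simps)
    moreover have "tf_shift \<alpha> \<beta> u (\<alpha> + 1 * t) * cnj (tf_shift \<alpha> \<beta> u (\<alpha> + 1 * t - x)) * cis (y * (\<alpha> + 1 * t))
      = (cis (\<beta> * (\<alpha> + t)) * cis (- (\<beta> * (\<alpha> + t - x))) * cis (y * (\<alpha> + t))) * (u t * cnj (u (t - x)))"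
    proof -
      have a: "\<alpha> + t - \<alpha> = t" "\<alpha> + t - x - \<alpha> = t - x" by auto
      show ?thesis unfolding tf_shift_def mult_1 a complex_cnj_mult cis_cnj by (simp only: mult_ac)
    qed
    ultimately show "tf_shift \<alpha> \<beta> u (\<alpha> + 1 * t) * cnj (tf_shift \<alpha> \<beta> u (\<alpha> + 1 * t - x)) * cis (y * (\<alpha> + 1 * t))
      = cis (\<beta> * x + y * \<alpha>) * (u t * cnj (u (t - x)) * cis (y * t))"
      by (simp only: mult_ac)
  qed
  finally show ?thesis by (simp add: amb_def norm_mult)
qed

lemma barg_gauss_mult: "barg (gauss_mult P) z = exp (z\<^sup>2) * poly (heat P) z"
proof -
  have "gauss_mult P t * barg_ker z t = poly P (of_real t) * gauss_ker (2 * z) t" for t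
  proof -
    have "exp (- (complex_of_real t)\<^sup>2 / 2) * barg_ker z t = gauss_ker (2 * z) t"
      unfolding exp_add[symmetric] by (rule arg_cong[of _ _ exp]) simp
    then show ?thesis unfolding gauss_mult_def by (simp only: mult.assoc)
  qed
  then have "barg (gauss_mult P) z = gint (2 * z) P" unfolding barg_def gint_def by (simp only:)
  then show ?thesis by (simp only: bargmann_gauss)
qed

lemma barg_tf_shift:
  fixes \<alpha> \<beta> :: real
  defines "\<kappa> \<equiv> (\<i> * of_real \<beta> - of_real \<alpha>) / 2"
  shows "barg (tf_shift \<alpha> \<beta> u) z = exp (\<i> * of_real (\<alpha> * \<beta>) - (of_real \<alpha>)\<^sup>2 / 2 + 2 * of_real \<alpha> * z) * barg u (z + \<kappa>)"
proof -
  have "barg (tf_shift \<alpha> \<beta> u) z = (LINT t|lborel. tf_shift \<alpha> \<beta> u (\<alpha> + 1 * t) * barg_ker z (\<alpha> + 1 * t))"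
    unfolding barg_def by (subst lborel_integral_real_affine[where c = 1 and t = \<alpha>]) simp_all
  also have "\<dots> = (LINT t|lborel. exp (\<i> * of_real (\<alpha> * \<beta>) - (of_real \<alpha>)\<^sup>2 / 2 + 2 * of_real \<alpha> * z) * (u t * barg_ker (z + \<kappa>) t))"
  proof (intro Bochner_Integration.integral_cong refl)
    fix t
    have "exp (\<i> * of_real (\<beta> * (\<alpha> + 1 * t))) * barg_ker z (\<alpha> + 1 * t)
      = exp (\<i> * of_real (\<alpha> * \<beta>) - (of_real \<alpha>)\<^sup>2 / 2 + 2 * of_real \<alpha> * z) * barg_ker (z + \<kappa>) t"
      unfolding exp_add[symmetric] \<kappa>_def by (rule arg_cong[of _ _ exp]) (simp add: power2_eq_square field_simps)
    moreover have "\<alpha> + 1 * t - \<alpha> = t" by simp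
    ultimately show "tf_shift \<alpha> \<beta> u (\<alpha> + 1 * t) * barg_ker z (\<alpha> + 1 * t)
      = exp (\<i> * of_real (\<alpha> * \<beta>) - (of_real \<alpha>)\<^sup>2 / 2 + 2 * of_real \<alpha> * z) * (u t * barg_ker (z + \<kappa>) t)"
      unfolding tf_shift_def cis_conv_exp by (simp only: mult_ac)
  qed
  finally show ?thesis by (simp only: integral_mult_right_zero barg_def)
qed

lemma partner_is_tf_shift:
  assumes v: "L2 v" and P: "P \<noteq> 0" and eq: "\<And>x y. norm (amb (gauss_mult P) x y) = norm (amb v x y)"
  shows "\<exists>Q \<alpha> \<beta>. AE t in lborel. v t = tf_shift \<alpha> \<beta> (gauss_mult Q) t"
proof -
  define g where "g z = barg v z * exp (- z\<^sup>2)" for z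
  have hol: "g holomorphic_on UNIV" unfolding g_def by (intro holomorphic_intros barg_holomorphic v)
  obtain K where K: "\<And>z. norm (g z) \<le> exp (K * (1 + (norm z)\<^sup>2))"
    using barg_growth[OF v] unfolding g_def by blast
  obtain C N where C: "C \<ge> 0" "\<And>x y. norm (amb v x y) \<le> C * (1 + x\<^sup>2 + y\<^sup>2) ^ N * exp (- (x\<^sup>2 + y\<^sup>2) / 4)"
    using amb_gauss_mult_bound[of P] unfolding eq by blast
  obtain C' where C': "\<And>z. norm (g z * g (- z)) \<le> C' * (1 + norm z) ^ (2 * N)"
    using barg_product_bound[OF v C] unfolding g_def by blast
  \<comment> \<open>If the transform vanished, v would be zero almost everywhere; a vanishing
    ambiguity function is impossible for P \<noteq> 0.\<close>
  have "\<exists>z. g z \<noteq> 0"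
  proof (rule ccontr)
    assume "\<not> ?thesis"
    then have b0: "barg v z = 0" for z by (simp add: g_def)
    have "L2 (\<lambda>_. 0)" by (simp add: L2_def)
    moreover have "barg v z = barg (\<lambda>_. 0) z" for z by (simp only: b0) (simp add: barg_def)
    ultimately have ae: "AE t in lborel. v t = 0" by (rule barg_injective[OF v])
    have "amb v x y = amb (\<lambda>_. 0) x y" for x y
      by (rule amb_cong_AE[OF ae]) (use L2_measurable[OF v] in auto)
    then have v0: "amb v x y = 0" for x y by (simp add: amb_def)
    have g0: "amb (gauss_mult 0) x y = 0" for x y by (simp add: amb_def gauss_mult_def)
    have "amb_poly 1 P * amb_poly (-1) P = amb_poly 1 0 * amb_poly (-1) 0"
      by (rule same_modulus_amb_poly) (simp add: eq v0 g0)
    from amb_poly_product_top(1)[OF this P] show False by simp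
  qed
  then obtain z0 where "g z0 \<noteq> 0" ..
  from entire_quadratic_growth_poly_symmetric_product[OF hol K C' this] obtain p b where
    p: "\<And>z. g z = poly p z * exp (b * z)" by blast
  \<comment> \<open>A time-frequency shift multiplies the transform by exp(2 \<alpha> z), up to a
    constant, and moves its argument by \<kappa>. With exp((z + \<kappa>)^2) this gives the linear
    exponent 2 \<alpha> + 2 \<kappa> = \<alpha> + i \<beta>, which has to be b; \<open>d\<close>
    collects the constants.\<close>
  define \<alpha> \<beta> where "\<alpha> = Re b" and "\<beta> = Im b"
  define \<kappa> where "\<kappa> = (\<i> * of_real \<beta> - of_real \<alpha>) / 2"
  define d where "d = \<i> * of_real (\<alpha> * \<beta>) - (of_real \<alpha>)\<^sup>2 / 2 + \<kappa>\<^sup>2"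
  have b: "b = 2 * of_real \<alpha> + 2 * \<kappa>" by (simp add: \<kappa>_def \<alpha>_def \<beta>_def complex_eq_iff)
  obtain Q where Q: "heat Q = smult (exp (- d)) (pcompose p [:- \<kappa>, 1:])" using heat_surj by blast
  have "barg v z = barg (tf_shift \<alpha> \<beta> (gauss_mult Q)) z" for z
  proof -
    have "barg (tf_shift \<alpha> \<beta> (gauss_mult Q)) z = exp (\<i> * of_real (\<alpha> * \<beta>) - (of_real \<alpha>)\<^sup>2 / 2 + 2 * of_real \<alpha> * z) * (exp ((z + \<kappa>)\<^sup>2) * (exp (- d) * poly p z))"
      unfolding barg_tf_shift \<kappa>_def[symmetric] barg_gauss_mult Q by (simp add: poly_pcompose)
    also have "\<dots> = (exp (\<i> * of_real (\<alpha> * \<beta>) - (of_real \<alpha>)\<^sup>2 / 2 + 2 * of_real \<alpha> * z) * exp ((z + \<kappa>)\<^sup>2) * exp (- d)) * poly p z"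
      by (simp only: mult.assoc)
    also have "exp (\<i> * of_real (\<alpha> * \<beta>) - (of_real \<alpha>)\<^sup>2 / 2 + 2 * of_real \<alpha> * z) * exp ((z + \<kappa>)\<^sup>2) * exp (- d) = exp (b * z + z\<^sup>2)"
      unfolding exp_add[symmetric] by (rule arg_cong[of _ _ exp]) (simp add: b d_def power2_eq_square algebra_simps)
    also have "exp (b * z + z\<^sup>2) * poly p z = g z * exp (z\<^sup>2)" by (simp add: p exp_add)
    also have "\<dots> = barg v z" by (simp add: g_def mult.assoc flip: exp_add)
    finally show ?thesis by simp
  qed
  then have "AE t in lborel. v t = tf_shift \<alpha> \<beta> (gauss_mult Q) t"
    by (rule barg_injective[OF v L2_tf_shift[OF L2_gauss_mult]])
  then show ?thesis by blast
qed

theorem generic_only_trivial_partners: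
  assumes gen: "generic n (heat P)" and v: "L2 v"
    and eq: "\<And>x y. norm (amb (gauss_mult P) x y) = norm (amb v x y)"
  shows "\<exists>c \<alpha> \<beta>. norm c = 1 \<and>
        ((AE t in lborel. v t = c * cis (\<beta> * t) * gauss_mult P (t - \<alpha>)) \<or>
         (AE t in lborel. v t = c * cis (- \<beta> * t) * gauss_mult P (- t - \<alpha>)))"
proof -
  have P: "P \<noteq> 0" using gen by (auto simp: generic_def)
  obtain Q \<alpha> \<beta> where ae: "AE t in lborel. v t = tf_shift \<alpha> \<beta> (gauss_mult Q) t"
    using partner_is_tf_shift[OF v P eq] by blast
  have "amb v x y = amb (tf_shift \<alpha> \<beta> (gauss_mult Q)) x y" for x y
    by (rule amb_cong_AE[OF ae]) (use L2_measurable[OF v] L2_measurable[OF L2_tf_shift[OF L2_gauss_mult]] in auto)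
  then have "norm (amb (gauss_mult P) x y) = norm (amb (gauss_mult Q) x y)" for x y
    by (simp add: eq norm_amb_tf_shift)
  from generic_partner[OF gen same_modulus_amb_poly[OF this]]
  obtain c where c: "norm c = 1" "Q = smult c P \<or> Q = smult c (refl_poly P)" by blast
  from c(2) show ?thesis
  proof
    assume "Q = smult c P"
    then have "AE t in lborel. v t = c * cis (\<beta> * t) * gauss_mult P (t - \<alpha>)"
      using ae by (simp add: tf_shift_def gauss_mult_def mult_ac)
    then show ?thesis using c(1) by blast
  next
    assume Q: "Q = smult c (refl_poly P)"
    \<comment> \<open>The reflected form is written with -\<beta> t and -t - \<alpha>, so both
      parameters enter with opposite signs.\<close>
    have "tf_shift \<alpha> \<beta> (gauss_mult Q) t = c * cis (- (- \<beta>) * t) * gauss_mult P (- t - (- \<alpha>))" for t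
    proof -
      have "- t - (- \<alpha>) = - (t - \<alpha>)" by simp
      then show ?thesis
        unfolding tf_shift_def gauss_mult_def Q by (simp only: poly_smult poly_pcompose)
          (simp add: mult_ac power2_commute[of "complex_of_real \<alpha>"])
    qed
    then have "AE t in lborel. v t = c * cis (- (- \<beta>) * t) * gauss_mult P (- t - (- \<alpha>))"
      using ae by (simp only:)
    then show ?thesis using c(1) by blast
  qed
qed

section \<open>Transfer to Lebesgue measurable functions\<close>

lemma gauss_poly_eq: "gauss_poly n p = gauss_mult (cpoly n p)"
  by (rule ext) (simp add: gauss_poly_def gauss_mult_def poly_cpoly exp_of_real[symmetric] del: exp_of_real)

lemma square_integrable_Borel_version:
  assumes "square_integrable v"
  shows "\<exists>w. L2 w \<and> (AE t in lborel. v t = w t)"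
proof -
  have vm: "v \<in> borel_measurable (completion lborel)" and vi: "integrable lebesgue (\<lambda>t. (norm (v t))\<^sup>2)"
    using assms by (auto simp: square_integrable_def)
  have "(\<lambda>t. Re (v t)) \<in> borel_measurable (completion lborel)" "(\<lambda>t. Im (v t)) \<in> borel_measurable (completion lborel)"
    using vm by measurable
  from this[THEN completion_ex_borel_measurable_real] obtain a b
    where a: "a \<in> borel_measurable lborel" "AE t in lborel. Re (v t) = a t"
      and b: "b \<in> borel_measurable lborel" "AE t in lborel. Im (v t) = b t" by blast
  define w where "w t = Complex (a t) (b t)" for t
  have w: "w t = of_real (a t) + \<i> * of_real (b t)" for t by (simp add: w_def complex_eq_iff)
  have wm: "w \<in> borel_measurable borel" unfolding w using a(1) b(1) by measurable
  have ae: "AE t in lborel. v t = w t" using a(2) b(2) by eventually_elim (simp add: w_def complex_eq_iff)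
  have aeL: "AE t in lebesgue. v t = w t" by (rule AE_completion[OF ae])
  have wL: "w \<in> borel_measurable lebesgue" using wm by (simp add: measurable_completion)
  have "integrable lebesgue (\<lambda>t. (norm (w t))\<^sup>2)"
    by (rule integrable_cong_AE_imp[OF vi]) (use wL aeL in auto)
  then have "integrable lborel (\<lambda>t. (norm (w t))\<^sup>2)"
    using wm by (subst (asm) integrable_completion) auto
  then show ?thesis using wm ae by (auto simp: L2_def)
qed

text \<open>Translates of null sets are null, so the integrand for v agrees almost everywhere with
  that of the Borel function w and inherits its Lebesgue measurability.\<close>

lemma ambiguity_eq_amb:
  assumes w: "w \<in> borel_measurable borel" and ae: "AE t in lborel. v t = w t"
  shows "ambiguity v x y = amb w x y"
proof -
  have aeL: "AE t in lebesgue. v t = w t" by (rule AE_completion[OF ae])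
  have ae2: "AE t in lebesgue. v (t - x) = w (t - x)" by (rule AE_completion[OF AE_lborel_shift[OF ae]])
  have m: "(\<lambda>t. w t * cnj (w (t - x)) * cis (y * t)) \<in> borel_measurable borel" using w by measurable
  have AE: "AE t in lebesgue. w t * cnj (w (t - x)) * cis (y * t) = v t * cnj (v (t - x)) * cis (y * t)"
    using aeL ae2 by eventually_elim simp
  have mL: "(\<lambda>t. w t * cnj (w (t - x)) * cis (y * t)) \<in> borel_measurable lebesgue"
    using m by (simp add: measurable_completion)
  have "(\<lambda>t. v t * cnj (v (t - x)) * cis (y * t)) \<in> borel_measurable lebesgue"
    by (rule borel_measurable_AE[OF mL AE])
  then have "ambiguity v x y = (LINT t|lebesgue. w t * cnj (w (t - x)) * cis (y * t))"
    unfolding ambiguity_def using mL AE by (intro integral_cong_AE) (auto elim: eventually_mono)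
  also have "\<dots> = amb w x y"
    unfolding amb_def by (rule integral_completion) (use m in simp)
  finally show ?thesis .
qed

lemma generic_imp_only_trivial_partners:
  assumes gen: "generic n (heat (cpoly n p))"
  shows "only_trivial_partners (gauss_poly n p)"
  unfolding only_trivial_partners_def
proof (intro allI impI)
  fix v assume v: "square_integrable v" and partners: "ambiguity_partners (gauss_poly n p) v"
  let ?u = "gauss_mult (cpoly n p)"
  obtain w where w: "L2 w" "AE t in lborel. v t = w t"
    using square_integrable_Borel_version[OF v] by blast
  have "norm (amb ?u x y) = norm (amb w x y)" for x y
  proof -
    have "ambiguity (gauss_poly n p) x y = amb ?u x y"
      unfolding gauss_poly_eq by (rule ambiguity_eq_amb[OF gauss_mult_measurable]) simp
    moreover have "ambiguity v x y = amb w x y"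
      by (rule ambiguity_eq_amb[OF L2_measurable[OF w(1)] w(2)])
    ultimately show ?thesis using partners by (metis ambiguity_partners_def)
  qed
  from generic_only_trivial_partners[OF gen w(1) this] obtain c \<alpha> \<beta> where c: "norm c = 1"
    and alt: "(AE t in lborel. w t = c * cis (\<beta> * t) * ?u (t - \<alpha>)) \<or>
      (AE t in lborel. w t = c * cis (- \<beta> * t) * ?u (- t - \<alpha>))" by blast
  have T: "AE t in lebesgue. v t = h t" if "AE t in lborel. w t = h t" for h
    by (rule AE_completion) (use w(2) that in eventually_elim, simp)
  from alt show "trivial_partners (gauss_poly n p) v"
  proof
    assume "AE t in lborel. w t = c * cis (\<beta> * t) * ?u (t - \<alpha>)"
    from T[OF this] show ?thesis using c unfolding trivial_partners_def gauss_poly_eq by blast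
  next
    assume "AE t in lborel. w t = c * cis (- \<beta> * t) * ?u (- t - \<alpha>)"
    from T[OF this] show ?thesis using c unfolding trivial_partners_def gauss_poly_eq by blast
  qed
qed

theorem theoremA:
  fixes n :: nat
  defines "E \<equiv> {p \<in> {..n} \<rightarrow>\<^sub>E (UNIV :: complex set). \<not> only_trivial_partners (gauss_poly n p)}"
  shows "E \<in> null_sets (lebesgue_coeffs n) \<and> meager_in (top_coeffs n) E"
proof -
  have "thin n {p. \<not> only_trivial_partners (gauss_poly n p)}"
    by (rule thin_subset[OF thin_not_generic_heat]) (use generic_imp_only_trivial_partners in blast)
  from thin_null_meager[OF this] show ?thesis by (simp add: E_def)
qed

end
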